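(* Let $N$ be a connected 2-step nilpotent Lie group with left-invariant pseudo-Riemannian metric tensor and Lie algebra $\mathfrak n=\mathfrak U\oplus\mathfrak Z\oplus\mathfrak V\oplus\mathfrak E$. Let $\gamma$ be the geodesic with $\gamma(0)=1$ and $\dot\gamma(0)=u_0+z_0+v_0+e_0\in\mathfrak U\oplus\mathfrak Z\oplus\mathfrak V\oplus\mathfrak E$. Define $$\mathcal J_{\mathfrak E}:\mathfrak V\oplus\mathfrak E\to\mathfrak E,\ y\mapsto\big(\operatorname{ad}^\dagger_y(z_0+v_0)\big)^{\mathfrak E},\qquad \mathcal J_{\mathfrak U}:\mathfrak V\oplus\mathfrak E\to\mathfrak U,\ y\mapsto\big(\operatorname{ad}^\dagger_y(z_0+v_0)\big)^{\mathfrak U},$$ and $J=\mathcal J_{\mathfrak E}|_{\mathfrak E}\in\operatorname{End}(\mathfrak E)$. Write $\mathfrak E=\mathfrak E_1\oplus\mathfrak E_2$ as an orthogonal direct sum with $\mathfrak E_1=\ker J$; $J$ is invertible on $\mathfrak E_2$, and $J^{-1}$ denotes the inverse there. Decompose $\mathcal J_{\mathfrak E}v_0=y_1+y_2$ and $e_0=e_1+e_2$ in $\mathfrak E_1\oplus\mathfrak E_2$, and set $x_1=e_1+v_0-J^{-1}y_2$, $x_2=e_2+J^{-1}y_2$. Then $\gamma(t)=\exp\big(u(t)+z(t)+x(t)\big)$ with $u(t)\in\mathfrak U$, $z(t)\in\mathfrak Z$, $x(t)\in\mathfrak V\oplus\mathfrak E$ given by $$x(t)=t\,x_1+(e^{tJ}-I)J^{-1}x_2+\tfrac12t^2y_1,$$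 $$z(t)=t\,z_0+\mathcal I(t)^{\mathfrak Z},$$ $$u(t)=t\,u_0+\mathcal I(t)^{\mathfrak U}+\int_0^t\!\int_0^s\mathcal J_{\mathfrak U}\,\dot x(\sigma)\,d\sigma\,ds,$$ where $$\begin{aligned}\mathcal I(t)&=-\tfrac12\int_0^t[\dot x(s),x(s)]\,ds\\ &=\tfrac12t\big[x_1+\tfrac12ty_1,(e^{tJ}+I)J^{-1}x_2\big]-t\big[y_1,e^{tJ}J^{-2}x_2\big]+\tfrac1{12}t^3[x_1,y_1]\\ &\quad+\tfrac12\big[(e^{tJ}-I)J^{-1}x_2,J^{-1}x_2\big]-\big[x_1,(e^{tJ}-I)J^{-2}x_2\big]\\ &\quad+\big[y_1,(e^{tJ}-I)J^{-3}x_2\big]+\tfrac12\int_0^t\big[e^{sJ}J^{-1}x_2,e^{sJ}x_2\big]ds.\end{aligned}$$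
   Context: An inner product is a nondegenerate symmetric bilinear form. $\mathfrak n$ has center $\mathfrak z$, $[\mathfrak n,\mathfrak n]\subseteq\mathfrak z$. Decomposition: $\mathfrak U=\mathfrak z\cap\mathfrak z^\perp$; $\mathfrak V$ is a chosen totally null subspace with $\dim\mathfrak V=\dim\mathfrak U$, dually paired with $\mathfrak U$ by $\langle\,,\rangle$; $\mathfrak Z=\mathfrak z\cap\mathfrak U^\perp\cap\mathfrak V^\perp$; $\mathfrak E$ is the orthogonal complement of $\mathfrak Z$ in $\mathfrak U^\perp\cap\mathfrak V^\perp$. Then $\mathfrak z=\mathfrak U\oplus\mathfrak Z$ and $\mathfrak n=\mathfrak U\oplus\mathfrak Z\oplus\mathfrak V\oplus\mathfrak E$; superscripts denote components in this decomposition. $\operatorname{ad}^\dagger_x$ is the adjoint of $\operatorname{ad}_x$ with respect to $\langle\,,\rangle$: $\langle\operatorname{ad}^\dagger_xy,w\rangle=\langle y,[x,w]\rangle$. The operator $J$ is skew-adjoint with respect to $\langle\,,\rangle$. The orthogonal direct sum decomposition $\mathfrak E=\ker J\oplus\mathfrak E_2$ is part of the setting (i.e. $\ker J$ is taken to be nondegenerate). *)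

theory Defs
  imports "HOL-Analysis.Analysis" "HOL-Algebra.Group"
begin

section \<open>Smooth manifolds, given by an atlas\<close>

text \<open>
  \<open>Ck_on k S f\<close> is meant for open \<open>S\<close> and finite-dimensional domains: a map is \<open>C\<^sup>k\<^sup>+\<^sup>1\<close> iff it is
  differentiable and all its directional derivatives are \<open>C\<^sup>k\<close>.
\<close>

primrec Ck_on :: "nat \<Rightarrow> 'a::euclidean_space set \<Rightarrow> ('a \<Rightarrow> 'b::real_normed_vector) \<Rightarrow> bool" where
  "Ck_on 0 S f \<longleftrightarrow> continuous_on S f"
| "Ck_on (Suc k) S f \<longleftrightarrow>
     (\<forall>x\<in>S. f differentiable (at x)) \<and> (\<forall>v. Ck_on k S (\<lambda>x. frechet_derivative f (at x) v))"

definition smooth_on :: "'a::euclidean_space set \<Rightarrow> ('a \<Rightarrow> 'b::real_normed_vector) \<Rightarrow> bool" where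
  "smooth_on S f \<longleftrightarrow> (\<forall>k. Ck_on k S f)"

text \<open>A chart is a pair of a coordinate domain and a coordinate map, with values in the model space.\<close>

type_synonym ('g, 'a) chart = "'g set \<times> ('g \<Rightarrow> 'a)"

abbreviation dom_of :: "('g, 'a) chart \<Rightarrow> 'g set" where "dom_of c \<equiv> fst c"
abbreviation coord :: "('g, 'a) chart \<Rightarrow> 'g \<Rightarrow> 'a" where "coord c \<equiv> snd c"
abbreviation icoord :: "('g, 'a) chart \<Rightarrow> 'a \<Rightarrow> 'g" where "icoord c \<equiv> inv_into (fst c) (snd c)"

definition is_chart :: "('g::topological_space, 'a::euclidean_space) chart \<Rightarrow> bool" where
  "is_chart c \<longleftrightarrow> open (dom_of c) \<and> open (coord c ` dom_of c) \<and>
     homeomorphism (dom_of c) (coord c ` dom_of c) (coord c) (icoord c)"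

definition smooth_atlas :: "('g::topological_space, 'a::euclidean_space) chart set \<Rightarrow> bool" where
  "smooth_atlas A \<longleftrightarrow> (\<forall>c\<in>A. is_chart c) \<and> (\<Union>c\<in>A. dom_of c) = UNIV \<and>
     (\<forall>c\<in>A. \<forall>d\<in>A. smooth_on (coord c ` (dom_of c \<inter> dom_of d)) (coord d \<circ> icoord c))"

definition prod_atlas ::
  "('g, 'a) chart set \<Rightarrow> ('h, 'b) chart set \<Rightarrow> ('g \<times> 'h, 'a \<times> 'b) chart set" where
  "prod_atlas A B = {(dom_of c \<times> dom_of d, map_prod (coord c) (coord d)) | c d. c \<in> A \<and> d \<in> B}"

definition smooth_map ::
  "('g::topological_space, 'a::euclidean_space) chart set \<Rightarrow>
   ('h::topological_space, 'b::euclidean_space) chart set \<Rightarrow> ('g \<Rightarrow> 'h) \<Rightarrow> bool" where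
  "smooth_map A B f \<longleftrightarrow> continuous_on UNIV f \<and>
     (\<forall>c\<in>A. \<forall>d\<in>B. smooth_on (coord c ` (dom_of c \<inter> f -` dom_of d)) (coord d \<circ> f \<circ> icoord c))"

text \<open>The differential of \<open>f\<close> at \<open>p\<close>, with tangent vectors represented in the charts \<open>c\<close> and \<open>d\<close>.\<close>

definition tangent_map ::
  "('g, 'a::euclidean_space) chart \<Rightarrow> ('h, 'b::euclidean_space) chart \<Rightarrow> ('g \<Rightarrow> 'h) \<Rightarrow> 'g \<Rightarrow> 'a \<Rightarrow> 'b" where
  "tangent_map c d f p = frechet_derivative (coord d \<circ> f \<circ> icoord c) (at (coord c p))"

definition smooth_curve_on ::
  "('g::topological_space, 'a::euclidean_space) chart set \<Rightarrow> real set \<Rightarrow> (real \<Rightarrow> 'g) \<Rightarrow> bool" where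
  "smooth_curve_on A I \<gamma> \<longleftrightarrow> continuous_on I \<gamma> \<and>
     (\<forall>c\<in>A. smooth_on (I \<inter> \<gamma> -` dom_of c) (coord c \<circ> \<gamma>))"

definition velocity :: "('g, 'a::euclidean_space) chart \<Rightarrow> (real \<Rightarrow> 'g) \<Rightarrow> real \<Rightarrow> 'a" where
  "velocity c \<gamma> t = vector_derivative (coord c \<circ> \<gamma>) (at t)"

section \<open>Pseudo-Riemannian metrics and geodesics\<close>

definition inner_product :: "('a::real_vector \<Rightarrow> 'a \<Rightarrow> real) \<Rightarrow> bool" where
  "inner_product b \<longleftrightarrow> (\<forall>x. linear (b x)) \<and> (\<forall>y. linear (\<lambda>x. b x y)) \<and> (\<forall>x y. b x y = b y x) \<and>
     (\<forall>x. (\<forall>y. b x y = 0) \<longrightarrow> x = 0)"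

text \<open>
  A metric tensor is given by its components: \<open>g c q\<close> is the bilinear form on the model space that
  represents the metric in the chart \<open>c\<close> at the point with coordinates \<open>q\<close>.  The last condition is
  the tensorial transformation rule under a change of charts.
\<close>

type_synonym ('g, 'a) metric = "('g, 'a) chart \<Rightarrow> 'a \<Rightarrow> 'a \<Rightarrow> 'a \<Rightarrow> real"

definition pseudo_riemannian_metric ::
  "('g::topological_space, 'a::euclidean_space) chart set \<Rightarrow> ('g, 'a) metric \<Rightarrow> bool" where
  "pseudo_riemannian_metric A g \<longleftrightarrow>
     (\<forall>c\<in>A. \<forall>q\<in>coord c ` dom_of c. inner_product (g c q)) \<and>
     (\<forall>c\<in>A. \<forall>v w. smooth_on (coord c ` dom_of c) (\<lambda>q. g c q v w)) \<and>
     (\<forall>c\<in>A. \<forall>d\<in>A. \<forall>p\<in>dom_of c \<inter> dom_of d. \<forall>v w.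
        g d (coord d p) (tangent_map c d id p v) (tangent_map c d id p w) = g c (coord c p) v w)"

text \<open>The vector representing the linear functional \<open>f\<close> with respect to the inner product \<open>b\<close>.\<close>

definition represent :: "('a \<Rightarrow> 'a \<Rightarrow> real) \<Rightarrow> ('a \<Rightarrow> real) \<Rightarrow> 'a" where
  "represent b f = (THE a. \<forall>w. b a w = f w)"

text \<open>
  The Christoffel symbols \<open>\<Gamma>(u,v)\<close> of the Levi-Civita connection, by the Koszul formula for
  coordinate fields: \<open>2 g(\<Gamma>(u,v),w) = \<partial>\<^sub>u g(v,w) + \<partial>\<^sub>v g(u,w) - \<partial>\<^sub>w g(u,v)\<close>.
\<close>

definition christoffel ::
  "('g, 'a::euclidean_space) metric \<Rightarrow> ('g, 'a) chart \<Rightarrow> 'a \<Rightarrow> 'a \<Rightarrow> 'a \<Rightarrow> 'a" where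
  "christoffel g c q u v = represent (g c q) (\<lambda>w.
     (frechet_derivative (\<lambda>q. g c q v w) (at q) u
      + frechet_derivative (\<lambda>q. g c q u w) (at q) v
      - frechet_derivative (\<lambda>q. g c q u v) (at q) w) / 2)"

definition covariant_acceleration ::
  "('g, 'a::euclidean_space) metric \<Rightarrow> ('g, 'a) chart \<Rightarrow> (real \<Rightarrow> 'g) \<Rightarrow> real \<Rightarrow> 'a" where
  "covariant_acceleration g c \<gamma> t =
     vector_derivative (velocity c \<gamma>) (at t)
     + christoffel g c (coord c (\<gamma> t)) (velocity c \<gamma> t) (velocity c \<gamma> t)"

definition geodesic_on ::
  "('g::topological_space, 'a::euclidean_space) chart set \<Rightarrow> ('g, 'a) metric \<Rightarrow>
   real set \<Rightarrow> (real \<Rightarrow> 'g) \<Rightarrow> bool" where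
  "geodesic_on A g I \<gamma> \<longleftrightarrow> smooth_curve_on A I \<gamma> \<and>
     (\<forall>t\<in>I. \<forall>c\<in>A. \<gamma> t \<in> dom_of c \<longrightarrow> covariant_acceleration g c \<gamma> t = 0)"

section \<open>Lie groups\<close>

locale lie_group = group G
  for G :: "'g::{t2_space, second_countable_topology} monoid" (structure) +
  fixes A :: "('g, 'a::euclidean_space) chart set"
  assumes carrier_UNIV: "carrier G = UNIV"
    and atlas: "smooth_atlas A"
    and smooth_mult: "smooth_map (prod_atlas A A) A (\<lambda>(p, q). p \<otimes> q)"
    and smooth_inverse: "smooth_map A A (\<lambda>p. inv p)"

definition left_translation :: "'g monoid \<Rightarrow> 'g \<Rightarrow> 'g \<Rightarrow> 'g" where
  "left_translation G p q = p \<otimes>\<^bsub>G\<^esub> q"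

text \<open>
  Throughout, \<open>c\<close> is a chart around the identity; it identifies the tangent space at the identity,
  and hence the Lie algebra, with the model space \<open>'a\<close>.

  \<open>left_invariant_field G c X\<close> is the left-invariant vector field with value \<open>X\<close> at the identity, in
  the coordinates \<open>c\<close>.  The bracket is the commutator of these vector fields at the identity; in
  coordinates the commutator of two fields is \<open>[X,Y] = DY(X) - DX(Y)\<close>.
\<close>

definition left_invariant_field ::
  "'g monoid \<Rightarrow> ('g, 'a::euclidean_space) chart \<Rightarrow> 'a \<Rightarrow> 'a \<Rightarrow> 'a" where
  "left_invariant_field G c X q = tangent_map c c (left_translation G (icoord c q)) \<one>\<^bsub>G\<^esub> X"

definition lie_bracket ::
  "'g monoid \<Rightarrow> ('g, 'a::euclidean_space) chart \<Rightarrow> 'a \<Rightarrow> 'a \<Rightarrow> 'a" where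
  "lie_bracket G c X Y =
     frechet_derivative (left_invariant_field G c Y) (at (coord c \<one>\<^bsub>G\<^esub>)) X
     - frechet_derivative (left_invariant_field G c X) (at (coord c \<one>\<^bsub>G\<^esub>)) Y"

text \<open>\<open>lie_exp G c X\<close> is \<open>\<sigma>(1)\<close> for the one-parameter subgroup \<open>\<sigma>\<close> with \<open>\<sigma>'(0) = X\<close>.\<close>

definition one_parameter_subgroup ::
  "'g::topological_space monoid \<Rightarrow> ('g, 'a::euclidean_space) chart \<Rightarrow> 'a \<Rightarrow> (real \<Rightarrow> 'g) \<Rightarrow> bool" where
  "one_parameter_subgroup G c X \<sigma> \<longleftrightarrow>
     continuous_on UNIV \<sigma> \<and> (\<forall>s t. \<sigma> (s + t) = \<sigma> s \<otimes>\<^bsub>G\<^esub> \<sigma> t) \<and>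
     ((coord c \<circ> \<sigma>) has_vector_derivative X) (at 0)"

definition lie_exp ::
  "'g::topological_space monoid \<Rightarrow> ('g, 'a::euclidean_space) chart \<Rightarrow> 'a \<Rightarrow> 'g" where
  "lie_exp G c X = (THE p. \<exists>\<sigma>. one_parameter_subgroup G c X \<sigma> \<and> p = \<sigma> 1)"

definition left_invariant_metric ::
  "'g monoid \<Rightarrow> ('g, 'a::euclidean_space) chart set \<Rightarrow> ('g, 'a) metric \<Rightarrow> bool" where
  "left_invariant_metric G A g \<longleftrightarrow>
     (\<forall>p q. \<forall>c\<in>A. \<forall>d\<in>A. q \<in> dom_of c \<longrightarrow> p \<otimes>\<^bsub>G\<^esub> q \<in> dom_of d \<longrightarrow>
       (\<forall>v w. g d (coord d (p \<otimes>\<^bsub>G\<^esub> q))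
                  (tangent_map c d (left_translation G p) q v)
                  (tangent_map c d (left_translation G p) q w) = g c (coord c q) v w))"

section \<open>Lie algebras with an inner product\<close>

definition lie_center :: "('a::zero \<Rightarrow> 'a \<Rightarrow> 'a) \<Rightarrow> 'a set" where
  "lie_center br = {x. \<forall>y. br x y = 0}"

definition two_step_nilpotent :: "('a::zero \<Rightarrow> 'a \<Rightarrow> 'a) \<Rightarrow> bool" where
  "two_step_nilpotent br \<longleftrightarrow> (\<forall>x y. br x y \<in> lie_center br)"

definition perp :: "('a \<Rightarrow> 'a \<Rightarrow> real) \<Rightarrow> 'a set \<Rightarrow> 'a set" where
  "perp ip S = {x. \<forall>y\<in>S. ip x y = 0}"

definition totally_null :: "('a \<Rightarrow> 'a \<Rightarrow> real) \<Rightarrow> 'a set \<Rightarrow> bool" where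
  "totally_null ip S \<longleftrightarrow> (\<forall>x\<in>S. \<forall>y\<in>S. ip x y = 0)"

definition dually_paired :: "('a::zero \<Rightarrow> 'a \<Rightarrow> real) \<Rightarrow> 'a set \<Rightarrow> 'a set \<Rightarrow> bool" where
  "dually_paired ip S T \<longleftrightarrow>
     (\<forall>x\<in>S. (\<forall>y\<in>T. ip x y = 0) \<longrightarrow> x = 0) \<and> (\<forall>y\<in>T. (\<forall>x\<in>S. ip x y = 0) \<longrightarrow> y = 0)"

text \<open>\<open>ad_adjoint ip br x\<close> is the adjoint of \<open>br x\<close> with respect to \<open>ip\<close>.\<close>

definition ad_adjoint ::
  "('a \<Rightarrow> 'a \<Rightarrow> real) \<Rightarrow> ('a \<Rightarrow> 'a \<Rightarrow> 'a) \<Rightarrow> 'a \<Rightarrow> 'a \<Rightarrow> 'a" where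
  "ad_adjoint ip br x y = represent ip (\<lambda>w. ip y (br x w))"

text \<open>The component in \<open>S\<close> of a vector, with respect to the direct sum \<open>S \<oplus> T\<close>.\<close>

definition component :: "'a::ab_group_add set \<Rightarrow> 'a set \<Rightarrow> 'a \<Rightarrow> 'a" where
  "component S T x = (THE s. s \<in> S \<and> x - s \<in> T)"

text \<open>\<open>exp_op t T\<close> is the operator \<open>e\<^sup>t\<^sup>T\<close>.\<close>

definition exp_op :: "real \<Rightarrow> ('a::real_normed_vector \<Rightarrow> 'a) \<Rightarrow> 'a \<Rightarrow> 'a" where
  "exp_op t T x = (\<Sum>n. (t ^ n / fact n) *\<^sub>R (T ^^ n) x)"

end

theory Submission
  imports Defs
begin

text \<open>
  Let \<open>w = \<gamma>\<^sup>-\<^sup>1 \<gamma>'\<close> be the logarithmic derivative of the geodesic.  In a chart the geodesic equation is the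
  Euler--Lagrange equation of the energy; tested against left-invariant fields it becomes the
  Euler--Arnold equation \<open>w' = ad\<^sup>\<dagger>\<^sub>w w\<close>.  The pairing of \<open>w\<close> with the centre is conserved and all
  brackets are central, so this equation is linear, and its solution is read off.  On the other hand the
  two-step Baker--Campbell--Hausdorff formula shows that the logarithmic derivative of \<open>exp(n(t))\<close> is
  \<open>n' - 1/2 [n, n']\<close>, which for \<open>n = u + z + x\<close> is the solution \<open>w\<close> again.  Two curves with the same
  logarithmic derivative differ by a left translation.
\<close>

section \<open>Calculus\<close>

text \<open>\<open>lie_exp\<close>, \<open>component\<close> and \<open>represent\<close> are
  definite descriptions, so existence has to be proved before any formula can be used. For
  \<open>lie_exp\<close> this means solving the flow equation of left-invariant fields for short
  vectors, extending the solutions to the whole line by group powers, and keeping a quadratic error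
  bound that yields the differential of \<open>lie_exp\<close> at 0. Since \<open>u0\<close> and
  \<open>e0\<close> are orthogonal to the centre, the conserved momentum is that of
  \<open>z0 + v0\<close>, and the linear equation is w' = \<open>K\<close> w for a fixed operator
  \<open>K\<close>. It kills the centre and takes values in the orthogonal complement of the centre,
  which is U + E. Hence the Z- and V-parts of w are constant, the V + E part evolves by itself, and
  the U-part is a plain integral. The forcing of the E-equation by \<open>v0\<close> splits along
  ker J and \<open>E2\<close>: the part \<open>y2\<close> is absorbed by the shift with
  \<open>Ji y2\<close>, while \<open>y1\<close> lies in the kernel, where nothing can absorb it, and
  produces the quadratic term of \<open>x\<close>.\<close>

lemma has_vector_derivative_zero_imp_eq:
  fixes f :: "real \<Rightarrow> 'a::real_normed_vector"
  assumes "convex T" "\<And>t. t \<in> T \<Longrightarrow> (f has_vector_derivative 0) (at t)" "s \<in> T" "t \<in> T"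
  shows "f s = f t"
proof -
  have "\<exists>k. \<forall>x\<in>T. f x = k"
  proof (rule has_vector_derivative_zero_constant[OF assms(1)])
    show "(f has_vector_derivative 0) (at x within T)" if "x \<in> T" for x
      using assms(2)[OF that] by (rule has_vector_derivative_at_within)
  qed auto
  then show ?thesis using assms(3,4) by auto
qed

lemma linear_expand:
  fixes l :: "'a::euclidean_space \<Rightarrow> 'b::real_vector"
  assumes "linear l" shows "l v = (\<Sum>b\<in>Basis. (v \<bullet> b) *\<^sub>R l b)"
  by (subst euclidean_representation[of v, symmetric])
     (simp only: linear_sum[OF assms] linear_scale[OF assms])

section \<open>Smooth functions, symmetry of second derivatives and product rules\<close>

lemma smooth_on_continuous_on: "smooth_on S f \<Longrightarrow> continuous_on S f"
  unfolding smooth_on_def by (metis Ck_on.simps(1))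

lemma smooth_on_differentiable: "smooth_on S f \<Longrightarrow> x \<in> S \<Longrightarrow> f differentiable (at x)"
  unfolding smooth_on_def by (metis Ck_on.simps(2))

lemma smooth_on_has_derivative:
  "smooth_on S f \<Longrightarrow> x \<in> S \<Longrightarrow> (f has_derivative frechet_derivative f (at x)) (at x)"
  using smooth_on_differentiable frechet_derivative_works by blast

lemma smooth_on_frechet_derivative:
  "smooth_on S f \<Longrightarrow> smooth_on S (\<lambda>x. frechet_derivative f (at x) v)"
  unfolding smooth_on_def by (metis Ck_on.simps(2))

lemma linear_frechet_derivative: "f differentiable (at x) \<Longrightarrow> linear (frechet_derivative f (at x))"
  by (metis frechet_derivative_works has_derivative_linear)

lemma has_derivative_eventually_nhds:
  assumes "(f has_derivative D) (at x)" "eventually (\<lambda>y. f y = g y) (nhds x)"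
  shows "(g has_derivative D) (at x)"
  using assms eventually_nhds_x_imp_x[OF assms(2)]
  by (intro has_derivative_transform_eventually[OF assms(1)]) (auto simp: eventually_at_filter elim: eventually_mono)

text \<open>The mean value theorem is used twice: along \<open>v\<close> for the difference of
  \<open>f\<close> at two points \<open>h *\<^sub>R w\<close> apart, then along \<open>w\<close> for
  the directional derivative \<open>f' _ v\<close>. The second difference is symmetric in
  \<open>v\<close> and \<open>w\<close> although the right-hand side is not.\<close>

lemma second_difference_mean_value:
  fixes f :: "'a::real_normed_vector \<Rightarrow> real"
  assumes f: "\<And>y. y \<in> ball x r \<Longrightarrow> (f has_derivative f' y) (at y)"
    and F: "\<And>y. y \<in> ball x r \<Longrightarrow> ((\<lambda>y. f' y v) has_derivative F y) (at y)"
    and h: "0 < h" "h * (norm v + norm w) < r"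
  obtains p where "dist p x \<le> h * (norm v + norm w)"
    "f (x + h *\<^sub>R v + h *\<^sub>R w) - f (x + h *\<^sub>R v) - f (x + h *\<^sub>R w) + f x = h\<^sup>2 * F p w"
proof -
  have mem: "x + s *\<^sub>R v + t *\<^sub>R w \<in> ball x r \<and> dist (x + s *\<^sub>R v + t *\<^sub>R w) x \<le> h * (norm v + norm w)"
    if "0 \<le> s" "s \<le> h" "0 \<le> t" "t \<le> h" for s t
  proof -
    have "norm (s *\<^sub>R v + t *\<^sub>R w) \<le> s * norm v + t * norm w"
      using norm_triangle_ineq[of "s *\<^sub>R v" "t *\<^sub>R w"] that by simp
    also have "\<dots> \<le> h * norm v + h * norm w"
      using that by (intro add_mono mult_right_mono) auto
    finally have "norm (s *\<^sub>R v + t *\<^sub>R w) \<le> h * (norm v + norm w)" by (simp add: algebra_simps)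
    then show ?thesis using h(2)
      by (smt (verit) add.assoc add_diff_cancel_left' dist_commute dist_norm mem_ball)
  qed
  have chain: "((\<lambda>s. k (a + s *\<^sub>R b)) has_real_derivative D b) (at s)"
    if "(k has_derivative D) (at (a + s *\<^sub>R b))" for k :: "'a \<Rightarrow> real" and D a b s
  proof -
    have "((\<lambda>s. k (a + s *\<^sub>R b)) has_derivative (\<lambda>h. D (h *\<^sub>R b))) (at s)"
      by (rule has_derivative_compose[where f="\<lambda>s. a + s *\<^sub>R b" and g=k, OF _ that]) (auto intro!: derivative_eq_intros)
    moreover have "(\<lambda>h. D (h *\<^sub>R b)) = (*) (D b)"
      using linear_scale[OF has_derivative_linear[OF that]] by (auto simp: fun_eq_iff)
    ultimately show ?thesis by (simp add: has_field_derivative_def)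
  qed
  have "\<exists>s>0. s < h \<and> (f (x + h *\<^sub>R w + h *\<^sub>R v) - f (x + h *\<^sub>R v)) - (f (x + h *\<^sub>R w + 0 *\<^sub>R v) - f (x + 0 *\<^sub>R v)) = (h - 0) * (f' (x + h *\<^sub>R w + s *\<^sub>R v) v - f' (x + s *\<^sub>R v) v)"
    using h(1) mem[of _ h] mem[of _ 0]
    by (intro MVT2[where f="\<lambda>s. f (x + h *\<^sub>R w + s *\<^sub>R v) - f (x + s *\<^sub>R v)"
          and f'="\<lambda>s. f' (x + h *\<^sub>R w + s *\<^sub>R v) v - f' (x + s *\<^sub>R v) v"] derivative_intros chain f)
      (auto simp: algebra_simps)
  then obtain s where s: "0 < s" "s < h" and 1: "f (x + h *\<^sub>R v + h *\<^sub>R w) - f (x + h *\<^sub>R v) - f (x + h *\<^sub>R w) + f x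
      = h * (f' (x + s *\<^sub>R v + h *\<^sub>R w) v - f' (x + s *\<^sub>R v) v)"
    by (auto simp: algebra_simps)
  have "\<exists>t>0. t < h \<and> f' (x + s *\<^sub>R v + h *\<^sub>R w) v - f' (x + s *\<^sub>R v + 0 *\<^sub>R w) v = (h - 0) * F (x + s *\<^sub>R v + t *\<^sub>R w) w"
    using h(1) s mem[of s]
    by (intro MVT2[where f="\<lambda>t. f' (x + s *\<^sub>R v + t *\<^sub>R w) v"] chain F) auto
  then obtain t where "0 < t" "t < h" "f' (x + s *\<^sub>R v + h *\<^sub>R w) v - f' (x + s *\<^sub>R v) v = h * F (x + s *\<^sub>R v + t *\<^sub>R w) w"
    by auto
  with 1 mem[of s t] s show ?thesis
    by (intro that[of "x + s *\<^sub>R v + t *\<^sub>R w"]) (auto simp: power2_eq_square)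
qed

text \<open>The same second difference is evaluated in both orders. After cancelling
  \<open>h\<^sup>2\<close> the two mixed derivatives agree at points \<open>p\<close> and
  \<open>q\<close> close to \<open>x\<close>, and continuity transfers this to
  \<open>x\<close>.\<close>

lemma second_derivative_symmetric_real:
  fixes f :: "'a::real_normed_vector \<Rightarrow> real"
  assumes S: "open S" "x \<in> S"
    and f: "\<And>y. y \<in> S \<Longrightarrow> (f has_derivative f' y) (at y)"
    and F: "\<And>y. y \<in> S \<Longrightarrow> ((\<lambda>y. f' y v) has_derivative F y) (at y)"
    and G: "\<And>y. y \<in> S \<Longrightarrow> ((\<lambda>y. f' y w) has_derivative G y) (at y)"
    and cF: "continuous_on S (\<lambda>y. F y w)" and cG: "continuous_on S (\<lambda>y. G y v)"
  shows "F x w = G x v"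
proof (rule ccontr)
  assume "F x w \<noteq> G x v"
  define e where "e = \<bar>F x w - G x v\<bar> / 2"
  have e: "e > 0" using \<open>F x w \<noteq> G x v\<close> by (simp add: e_def)
  obtain r where r: "r > 0" "ball x r \<subseteq> S" using S openE by blast
  have "isCont (\<lambda>y. F y w) x" "isCont (\<lambda>y. G y v) x"
    using cF cG S continuous_on_eq_continuous_at by blast+
  then have "\<exists>d>0. \<forall>y. dist y x < d \<longrightarrow> dist (F y w) (F x w) < e" "\<exists>d>0. \<forall>y. dist y x < d \<longrightarrow> dist (G y v) (G x v) < e"
    using e unfolding continuous_at_eps_delta by auto
  then obtain d1 d2 where d: "d1 > 0" "\<And>y. dist y x < d1 \<Longrightarrow> dist (F y w) (F x w) < e"
      "d2 > 0" "\<And>y. dist y x < d2 \<Longrightarrow> dist (G y v) (G x v) < e"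
    by auto
  define m where "m = min r (min d1 d2)"
  have m: "m > 0" using r d by (simp add: m_def)
  \<comment> \<open>The summand 1 keeps the denominator positive when both vectors vanish; the
    choice puts the mean value points within all three radii collected in \<open>m\<close>.\<close>
  define h where "h = m / (norm v + norm w + 1)"
  have np: "norm v + norm w + 1 > 0" by (smt (verit) norm_ge_zero)
  then have h: "h > 0" "h * (norm v + norm w) < m"
    using m by (auto simp: h_def field_simps)
  obtain p where p: "dist p x \<le> h * (norm v + norm w)"
    "f (x + h *\<^sub>R v + h *\<^sub>R w) - f (x + h *\<^sub>R v) - f (x + h *\<^sub>R w) + f x = h\<^sup>2 * F p w"
    using second_difference_mean_value[of x r f f' v F h w] f F r h unfolding m_def by (smt (verit) subsetD)
  obtain q where q: "dist q x \<le> h * (norm w + norm v)"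
    "f (x + h *\<^sub>R w + h *\<^sub>R v) - f (x + h *\<^sub>R w) - f (x + h *\<^sub>R v) + f x = h\<^sup>2 * G q v"
    using second_difference_mean_value[of x r f f' w G h v] f G r h unfolding m_def
    by (smt (verit) subsetD)
  have "h\<^sup>2 * F p w = h\<^sup>2 * G q v"
    using p(2) q(2) by (simp add: algebra_simps)
  then have "F p w = G q v" using h by simp
  moreover have "dist (F p w) (F x w) < e" "dist (G q v) (G x v) < e"
    using p(1) q(1) h(2) d unfolding m_def by (auto simp: add.commute)
  ultimately show False unfolding e_def dist_real_def by (smt (verit) field_sum_of_halves)
qed

text \<open>Taken coordinate by coordinate from the real case. This symmetry is what makes the
  second-order terms cancel in the derivative of \<open>Ad\<close> and in commutators of
  left-invariant fields.\<close>

lemma frechet_derivative_commute: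
  fixes f :: "'a::euclidean_space \<Rightarrow> 'b::euclidean_space"
  assumes S: "open S" "x \<in> S" and f: "smooth_on S f"
  shows "frechet_derivative (\<lambda>y. frechet_derivative f (at y) v) (at x) w
       = frechet_derivative (\<lambda>y. frechet_derivative f (at y) w) (at x) v"
proof (rule euclidean_eqI)
  fix b :: 'b assume "b \<in> Basis"
  let ?D = "\<lambda>v y. frechet_derivative f (at y) v"
  note s = smooth_on_frechet_derivative[OF f]
  show "frechet_derivative (?D v) (at x) w \<bullet> b = frechet_derivative (?D w) (at x) v \<bullet> b"
    by (rule second_derivative_symmetric_real[OF S, where f="\<lambda>x. f x \<bullet> b" and f'="\<lambda>y v. ?D v y \<bullet> b" 
         and F="\<lambda>y w. frechet_derivative (?D v) (at y) w \<bullet> b" and G="\<lambda>y v. frechet_derivative (?D w) (at y) v \<bullet> b"])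
     (auto intro!: has_derivative_inner_left smooth_on_has_derivative[OF f] smooth_on_has_derivative[OF s]
        continuous_on_inner continuous_on_const smooth_on_continuous_on[OF smooth_on_frechet_derivative[OF s]])
qed

text \<open>A product rule for fields and metrics that are differentiable only after evaluation at a
  fixed vector. Linearity near \<open>q\<close> reduces it to finitely many products by expanding in
  the standard basis.\<close>

lemma has_derivative_linear_family:
  fixes f :: "'p::real_normed_vector \<Rightarrow> 'b::euclidean_space \<Rightarrow> 'c::real_normed_vector"
  assumes lin: "eventually (\<lambda>q. linear (f q)) (nhds q)"
    and f: "\<And>b. ((\<lambda>q. f q b) has_derivative f' b) (at q)"
    and X: "(X has_derivative X') (at q)"
  shows "((\<lambda>q. f q (X q)) has_derivative (\<lambda>h. f q (X' h) + f' (X q) h)) (at q)"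
proof -
  note expand = linear_expand[where 'a='b and 'b='c]
  have linq: "linear (f q)" using lin eventually_nhds_x_imp_x by blast
  \<comment> \<open>Linearity of \<open>f' b\<close> in \<open>b\<close> is not assumed; uniqueness
    of derivatives supplies it for the one vector where it is wanted.\<close>
  have f'1: "f' (X q) = (\<lambda>h. \<Sum>b\<in>Basis. (X q \<bullet> b) *\<^sub>R f' b h)"
  proof (rule has_derivative_unique[OF f[of "X q"]])
    have "((\<lambda>p. \<Sum>b\<in>Basis. (X q \<bullet> b) *\<^sub>R f p b) has_derivative (\<lambda>h. \<Sum>b\<in>Basis. (X q \<bullet> b) *\<^sub>R f' b h)) (at q)"
      by (auto intro!: derivative_eq_intros f)
    moreover have "eventually (\<lambda>p. (\<Sum>b\<in>Basis. (X q \<bullet> b) *\<^sub>R f p b) = f p (X q)) (nhds q)"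
      using lin by eventually_elim (simp add: expand[symmetric])
    ultimately show "((\<lambda>p. f p (X q)) has_derivative (\<lambda>h. \<Sum>b\<in>Basis. (X q \<bullet> b) *\<^sub>R f' b h)) (at q)"
      by (rule has_derivative_eventually_nhds)
  qed
  have "((\<lambda>p. \<Sum>b\<in>Basis. (X p \<bullet> b) *\<^sub>R f p b) has_derivative
      (\<lambda>h. \<Sum>b\<in>Basis. (X q \<bullet> b) *\<^sub>R f' b h + (X' h \<bullet> b) *\<^sub>R f q b)) (at q)"
    by (auto intro!: derivative_eq_intros f X)
  moreover have "eventually (\<lambda>p. (\<Sum>b\<in>Basis. (X p \<bullet> b) *\<^sub>R f p b) = f p (X p)) (nhds q)"
    using lin by eventually_elim (simp add: expand[symmetric])
  ultimately have "((\<lambda>p. f p (X p)) has_derivative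
      (\<lambda>h. \<Sum>b\<in>Basis. (X q \<bullet> b) *\<^sub>R f' b h + (X' h \<bullet> b) *\<^sub>R f q b)) (at q)"
    by (rule has_derivative_eventually_nhds)
  moreover have "(\<lambda>h. \<Sum>b\<in>Basis. (X q \<bullet> b) *\<^sub>R f' b h + (X' h \<bullet> b) *\<^sub>R f q b) = (\<lambda>h. f q (X' h) + f' (X q) h)"
  proof
    fix h
    show "(\<Sum>b\<in>Basis. (X q \<bullet> b) *\<^sub>R f' b h + (X' h \<bullet> b) *\<^sub>R f q b) = f q (X' h) + f' (X q) h"
      by (subst expand[OF linq, of "X' h"]) (simp add: f'1 sum.distrib)
  qed
  ultimately show ?thesis by simp
qed

text \<open>The derivatives along the finitely many basis vectors are bounded on the compact ball.
  Their sum bounds the operator norm, and the ball is convex.\<close>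

lemma smooth_on_cball_lipschitz:
  fixes f :: "'a::euclidean_space \<Rightarrow> 'b::real_normed_vector"
  assumes f: "smooth_on S f" and S: "cball a r \<subseteq> S"
  obtains K where "0 \<le> K" "\<And>x y. x \<in> cball a r \<Longrightarrow> y \<in> cball a r \<Longrightarrow> norm (f x - f y) \<le> K * norm (x - y)"
proof -
  let ?D = "\<lambda>x. frechet_derivative f (at x)"
  have "\<exists>K. \<forall>x\<in>cball a r. norm (?D x b) \<le> K" for b
  proof -
    have "continuous_on (cball a r) (\<lambda>x. ?D x b)"
      using S f continuous_on_subset smooth_on_continuous_on smooth_on_frechet_derivative by blast
    then have "bounded ((\<lambda>x. ?D x b) ` cball a r)"
      by (intro compact_imp_bounded compact_continuous_image) auto
    then show ?thesis unfolding bounded_iff by auto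
  qed
  then obtain K where K: "\<And>b x. x \<in> cball a r \<Longrightarrow> norm (?D x b) \<le> K b" by metis
  define L where "L = (\<Sum>b\<in>Basis. \<bar>K b\<bar>)"
  have on: "norm (?D x v) \<le> L * norm v" if "x \<in> cball a r" for x v
  proof -
    have "linear (?D x)" using f S that linear_frechet_derivative smooth_on_differentiable by blast
    then have "?D x v = (\<Sum>b\<in>Basis. (v \<bullet> b) *\<^sub>R ?D x b)" by (rule linear_expand)
    also have "norm \<dots> \<le> (\<Sum>b\<in>Basis. \<bar>K b\<bar> * norm v)"
    proof (intro sum_norm_le)
      fix b :: 'a assume "b \<in> Basis"
      then have "\<bar>v \<bullet> b\<bar> * norm (?D x b) \<le> norm v * \<bar>K b\<bar>"
        using K[OF that, of b] by (intro mult_mono) (auto simp: Basis_le_norm intro: order_trans)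
      then show "norm ((v \<bullet> b) *\<^sub>R ?D x b) \<le> \<bar>K b\<bar> * norm v" by (simp add: mult.commute)
    qed
    finally show ?thesis by (simp add: L_def sum_distrib_right)
  qed
  show ?thesis
  proof (rule that[of L])
    show "0 \<le> L" by (simp add: L_def sum_nonneg)
    fix x y assume "x \<in> cball a r" "y \<in> cball a r"
    then show "norm (f x - f y) \<le> L * norm (x - y)"
      using S by (intro differentiable_bound[of "cball a r" f ?D])
        (auto intro!: has_derivative_at_withinI[OF smooth_on_has_derivative[OF f]] onorm_le on)
  qed
qed

section \<open>Ordinary differential equations and operator exponentials\<close>

lemma onorm_scaleR_le: "norm v \<le> K \<Longrightarrow> onorm (\<lambda>h::real. h *\<^sub>R v) \<le> K"
  by (intro onorm_le) (simp, metis mult.commute mult_right_mono abs_ge_zero)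

text \<open>The time interval is fixed and the smallness is put into the field:
  \<open>L \<le> 1/2\<close> makes the integral operator a contraction on unit time, and
  \<open>B \<le> r\<close> keeps the solution in the ball.\<close>

lemma picard_lindelof:
  fixes F :: "'a::euclidean_space \<Rightarrow> 'a"
  assumes r: "0 < r"
    and lip: "\<And>x y. x \<in> cball a r \<Longrightarrow> y \<in> cball a r \<Longrightarrow> norm (F x - F y) \<le> L * norm (x - y)"
    and L: "0 \<le> L" "L \<le> 1/2"
    and bound: "\<And>x. x \<in> cball a r \<Longrightarrow> norm (F x) \<le> B" and B: "B \<le> r"
  obtains q where "q 0 = a"
    "\<And>t. t \<in> {-1..1} \<Longrightarrow> norm (q t - a) \<le> B"
    "\<And>t. t \<in> {-1..1} \<Longrightarrow> (q has_vector_derivative F (q t)) (at t within {-1..1})"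
proof -
  \<comment> \<open>Projecting to the ball first makes the field bounded and Lipschitz everywhere,
    so the contraction can act on all bounded continuous curves. A fixed point stays within
    \<open>B\<close> of \<open>a\<close>, where the projection is the identity.\<close>
  define G where "G x = F (closest_point (cball a r) x)" for x
  have cp: "closest_point (cball a r) x \<in> cball a r" for x
    using r by (intro closest_point_in_set) auto
  have G_lip: "norm (G x - G y) \<le> L * norm (x - y)" for x y
  proof -
    have "norm (G x - G y) \<le> L * dist (closest_point (cball a r) x) (closest_point (cball a r) y)"
      unfolding G_def dist_norm by (intro lip cp)
    also have "\<dots> \<le> L * dist x y"
      using r L by (intro mult_left_mono closest_point_lipschitz) auto
    finally show ?thesis by (simp add: dist_norm)
  qed
  have G_bound: "norm (G x) \<le> B" for x unfolding G_def by (intro bound cp)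
  have B0: "0 \<le> B" using G_bound[of a] norm_ge_zero order_trans by blast
  have G_cont: "continuous_on UNIV G"
    unfolding continuous_on_iff
  proof (intro ballI allI impI)
    fix x :: 'a and e :: real assume "0 < e"
    moreover have "dist (G x') (G x) < e" if "dist x' x < e" for x'
      using G_lip[of x' x] that mult_right_mono[OF L(2) norm_ge_zero[of "x' - x"]] norm_ge_zero[of "x' - x"]
      unfolding dist_norm by linarith
    ultimately show "\<exists>d>0. \<forall>x'\<in>UNIV. dist x' x < d \<longrightarrow> dist (G x') (G x) < e" by blast
  qed
  \<comment> \<open>The initial time 0 is interior to the interval. Subtracting the integral from -1
    to 0 normalises the value there to \<open>a\<close> without oriented integrals.\<close>
  define I where "I \<phi> t = a + (integral {-1..t} (\<lambda>s. G (\<phi> s)) - integral {-1..0} (\<lambda>s. G (\<phi> s)))"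
    for \<phi> :: "real \<Rightarrow> 'a" and t
  have I': "(I \<phi> has_vector_derivative G (\<phi> t)) (at t within {-1..1})"
    if "continuous_on UNIV \<phi>" "t \<in> {-1..1}" for \<phi> t
  proof -
    have "continuous_on {-1..1} (\<lambda>s. G (\<phi> s))"
      using continuous_on_compose2[OF G_cont that(1)] continuous_on_subset by blast
    from integral_has_vector_derivative[OF this that(2)] show ?thesis
      unfolding I_def by (auto intro!: derivative_eq_intros)
  qed
  have I0: "I \<phi> 0 = a" for \<phi> by (simp add: I_def)
  have I_diff: "norm (I \<phi> t - I \<psi> t) \<le> K"
    if "continuous_on UNIV \<phi>" "continuous_on UNIV \<psi>" "t \<in> {-1..1}"
      "\<And>s. norm (G (\<phi> s) - G (\<psi> s)) \<le> K" for \<phi> \<psi> t K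
  proof -
    have "norm ((I \<phi> t - I \<psi> t) - (I \<phi> 0 - I \<psi> 0)) \<le> K * norm (t - 0)"
    proof (rule differentiable_bound[of "{-1..1}"])
      fix s :: real assume s: "s \<in> {-1..1}"
      show "((\<lambda>t. I \<phi> t - I \<psi> t) has_derivative (\<lambda>h. h *\<^sub>R (G (\<phi> s) - G (\<psi> s)))) (at s within {-1..1})"
        using has_vector_derivative_diff[OF I'[OF that(1) s] I'[OF that(2) s]]
        by (simp add: has_vector_derivative_def)
      show "onorm (\<lambda>h. h *\<^sub>R (G (\<phi> s) - G (\<psi> s))) \<le> K"
        using that(4)[of s] by (intro onorm_scaleR_le)
    qed (use that in auto)
    also have "\<dots> \<le> K * 1"
      using that(3) order_trans[OF norm_ge_zero that(4)] by (intro mult_left_mono) auto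
    finally show ?thesis by (simp add: I0)
  qed
  have I_dist: "norm (I \<phi> t - a) \<le> B" if "continuous_on UNIV \<phi>" "t \<in> {-1..1}" for \<phi> t
  proof -
    have "norm ((I \<phi> t) - (I \<phi> 0)) \<le> B * norm (t - 0)"
    proof (rule differentiable_bound[of "{-1..1}"])
      fix s :: real assume s: "s \<in> {-1..1}"
      show "(I \<phi> has_derivative (\<lambda>h. h *\<^sub>R G (\<phi> s))) (at s within {-1..1})"
        using I'[OF that(1) s] by (simp add: has_vector_derivative_def)
      show "onorm (\<lambda>h. h *\<^sub>R G (\<phi> s)) \<le> B"
        using G_bound[of "\<phi> s"] by (intro onorm_scaleR_le)
    qed (use that in auto)
    also have "\<dots> \<le> B * 1" using that(2) B0 by (intro mult_left_mono) auto
    finally show ?thesis by (simp add: I0)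
  qed
  \<comment> \<open>Clamping the time to [-1,1] makes the result a bounded continuous function on
    the whole line, as the complete space of such functions requires.\<close>
  define P where "P \<phi> = Bcontfun (\<lambda>t. I (apply_bcontfun \<phi>) (max (-1) (min 1 t)))" for \<phi>
  have P: "apply_bcontfun (P \<phi>) t = I (apply_bcontfun \<phi>) (max (-1) (min 1 t))" for \<phi> t
  proof -
    have "(\<lambda>t. I (apply_bcontfun \<phi>) (max (-1) (min 1 t))) \<in> bcontfun"
    proof (rule bcontfun_normI)
      have "continuous_on {-1..1} (I (apply_bcontfun \<phi>))"
        using I'[OF continuous_on_apply_bcontfun]
        by (meson continuous_on_eq_continuous_within has_vector_derivative_continuous)
      then show "continuous_on UNIV (\<lambda>t. I (apply_bcontfun \<phi>) (max (-1) (min 1 t)))"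
        by (rule continuous_on_compose2) (auto intro!: continuous_intros)
      show "norm (I (apply_bcontfun \<phi>) (max (-1) (min 1 t))) \<le> norm a + B" for t
        using I_dist[OF continuous_on_apply_bcontfun, of "max (-1) (min 1 t)" \<phi>]
          norm_triangle_ineq2[of "I (apply_bcontfun \<phi>) (max (-1) (min 1 t))" a] by auto
    qed
    then show ?thesis by (simp add: P_def Bcontfun_inverse)
  qed
  have "\<exists>!\<phi>. P \<phi> = \<phi>"
  proof (rule banach_fix_type)
    show "0 \<le> (1/2::real)" "(1/2::real) < 1" by auto
    show "\<forall>\<phi> \<psi>. dist (P \<phi>) (P \<psi>) \<le> 1/2 * dist \<phi> \<psi>"
    proof (intro allI dist_bound)
      fix \<phi> \<psi> :: "real \<Rightarrow>\<^sub>C 'a" and t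
      have "norm (G (\<phi> s) - G (\<psi> s)) \<le> 1/2 * dist \<phi> \<psi>" for s
        using G_lip[of "\<phi> s" "\<psi> s"] mult_mono[OF L(2) dist_bounded[of \<phi> s \<psi>]] L(1)
        by (auto simp: dist_norm intro: order_trans)
      then show "dist (apply_bcontfun (P \<phi>) t) (apply_bcontfun (P \<psi>) t) \<le> 1/2 * dist \<phi> \<psi>"
        unfolding P dist_norm by (intro I_diff) (auto simp: dist_norm)
    qed
  qed
  then obtain \<phi> where \<phi>: "P \<phi> = \<phi>" by auto
  have eq: "apply_bcontfun \<phi> t = I (apply_bcontfun \<phi>) t" if "t \<in> {-1..1}" for t
  proof -
    have "max (-1) (min 1 t) = t" using that by auto
    then show ?thesis using P[of \<phi> t] by (simp add: \<phi>)
  qed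
  have near: "norm (apply_bcontfun \<phi> t - a) \<le> B" if "t \<in> {-1..1}" for t
    using I_dist[OF continuous_on_apply_bcontfun that, of \<phi>] eq[OF that] by simp
  show ?thesis
  proof (rule that[of "apply_bcontfun \<phi>"])
    show "apply_bcontfun \<phi> 0 = a" using eq[of 0] I0 by simp
    fix t :: real assume t: "t \<in> {-1..1}"
    show "norm (apply_bcontfun \<phi> t - a) \<le> B" by (rule near[OF t])
    have "G (\<phi> t) = F (\<phi> t)"
      using near[OF t] B by (simp add: G_def closest_point_self dist_norm norm_minus_commute)
    moreover have "(apply_bcontfun \<phi> has_vector_derivative G (\<phi> t)) (at t within {-1..1})"
      using eq by (intro has_vector_derivative_transform[OF t _ I'[OF _ t]]) auto
    ultimately show "(apply_bcontfun \<phi> has_vector_derivative F (\<phi> t)) (at t within {-1..1})" by simp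
  qed
qed

text \<open>Size and Lipschitz constant of \<open>F X\<close> are proportional to
  \<open>norm X\<close>, so a bound on \<open>X\<close> alone gives existence for unit time. The
  quadratic error is later the differentiability of the exponential map at 0.\<close>

lemma linear_family_flow:
  fixes F :: "'a::euclidean_space \<Rightarrow> 'a \<Rightarrow> 'a"
  assumes S: "open S" "a \<in> S"
    and smooth: "\<And>X. smooth_on S (F X)"
    and lin: "\<And>q. q \<in> S \<Longrightarrow> linear (\<lambda>X. F X q)"
    and id: "\<And>X. F X a = X"
  obtains \<rho> C q where "0 < \<rho>" "\<And>X. q X 0 = a"
    "\<And>X t. norm X < \<rho> \<Longrightarrow> t \<in> {-1..1} \<Longrightarrow> q X t \<in> S"
    "\<And>X t. norm X < \<rho> \<Longrightarrow> t \<in> {-1..1} \<Longrightarrow> (q X has_vector_derivative F X (q X t)) (at t within {-1..1})"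
    "\<And>X t. norm X < \<rho> \<Longrightarrow> t \<in> {-1..1} \<Longrightarrow> norm (q X t - a - t *\<^sub>R X) \<le> C * (norm X)\<^sup>2"
proof -
  obtain r where r: "0 < r" "cball a r \<subseteq> S" using S open_contains_cball by blast
  have "\<exists>K. 0 \<le> K \<and> (\<forall>x\<in>cball a r. \<forall>y\<in>cball a r. norm (F b x - F b y) \<le> K * norm (x - y))" for b
    by (rule smooth_on_cball_lipschitz[OF smooth r(2)]) blast
  then obtain k where k: "\<And>b. 0 \<le> k b"
    "\<And>b x y. x \<in> cball a r \<Longrightarrow> y \<in> cball a r \<Longrightarrow> norm (F b x - F b y) \<le> k b * norm (x - y)" by metis
  define K where "K = (\<Sum>b\<in>Basis. k b)"
  have K0: "0 \<le> K" by (simp add: K_def k sum_nonneg)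
  have lip: "norm (F X x - F X y) \<le> K * norm X * norm (x - y)" if "x \<in> cball a r" "y \<in> cball a r" for X x y
  proof -
    have expand: "F X z = (\<Sum>b\<in>Basis. (X \<bullet> b) *\<^sub>R F b z)" if "z \<in> cball a r" for z
      by (rule linear_expand[OF lin]) (use that r in auto)
    have "F X x - F X y = (\<Sum>b\<in>Basis. (X \<bullet> b) *\<^sub>R (F b x - F b y))"
      by (simp add: expand[OF that(1)] expand[OF that(2)] scaleR_diff_right sum_subtractf)
    also have "norm \<dots> \<le> (\<Sum>b\<in>Basis. norm X * (k b * norm (x - y)))"
      by (intro sum_norm_le) (auto intro!: mult_mono k that simp: Basis_le_norm)
    also have "\<dots> = K * norm X * norm (x - y)"
      by (simp add: K_def sum_distrib_left sum_distrib_right mult_ac)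
    finally show ?thesis .
  qed
  have bound: "norm (F X x) \<le> (1 + K * r) * norm X" if "x \<in> cball a r" for X x
  proof -
    have "norm (F X x - F X a) \<le> K * norm X * norm (x - a)" using that r by (intro lip) auto
    also have "\<dots> \<le> K * norm X * r"
      using that K0 by (intro mult_left_mono) (auto simp: dist_norm norm_minus_commute)
    finally show ?thesis
      using norm_triangle_ineq2[of "F X x" X] by (simp add: id algebra_simps)
  qed
  \<comment> \<open>The first bound gives \<open>(1 + K * r) * norm X \<le> r\<close>, which
    confines the curve to the ball; the second gives the Lipschitz constant
    \<open>K * norm X \<le> 1/2\<close>.\<close>
  define \<rho> where "\<rho> = min (r / (1 + K * r)) (1 / (2 * (K + 1)))"
  have kr: "1 + K * r > 0" using K0 r by (simp add: add_pos_nonneg)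
  have \<rho>: "\<rho> > 0" using kr r K0 by (auto simp: \<rho>_def)
  \<comment> \<open>By \<open>id\<close> the derivative of \<open>q t - t *\<^sub>R X\<close> is
    \<open>F X (q t) - F X a\<close>. This is at most \<open>K * norm X\<close> times the distance
    \<open>(1 + K * r) * norm X\<close> from \<open>a\<close>, whence \<open>C\<close>.\<close>
  define C where "C = K * (1 + K * r)"
  have "\<exists>q. q 0 = a \<and> (norm X < \<rho> \<longrightarrow> (\<forall>t\<in>{-1..1}. q t \<in> S \<and>
      (q has_vector_derivative F X (q t)) (at t within {-1..1}) \<and> norm (q t - a - t *\<^sub>R X) \<le> C * (norm X)\<^sup>2))" for X
  proof (cases "norm X < \<rho>")
    case True
    have "norm X < 1 / (2 * (K + 1))" "norm X < r / (1 + K * r)" using True by (auto simp: \<rho>_def)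
    then have 1: "(1 + K * r) * norm X \<le> r" "(K + 1) * norm X \<le> 1/2"
      using K0 kr by (auto simp: field_simps)
    have 2: "K * norm X \<le> 1/2" using 1(2) norm_ge_zero[of X] by (simp add: algebra_simps del: norm_ge_zero)
    obtain q where q: "q 0 = a" "\<And>t. t \<in> {-1..1} \<Longrightarrow> norm (q t - a) \<le> (1 + K * r) * norm X"
      "\<And>t. t \<in> {-1..1} \<Longrightarrow> (q has_vector_derivative F X (q t)) (at t within {-1..1})"
      by (rule picard_lindelof[OF r(1) lip[of _ _ X] _ 2 bound[of _ X] 1(1)]) (use K0 in auto)
    have mem: "q t \<in> cball a r" if "t \<in> {-1..1}" for t
      using q(2)[OF that] 1(1) by (simp add: dist_norm norm_minus_commute)
    have "norm ((q t - t *\<^sub>R X) - (q 0 - 0 *\<^sub>R X)) \<le> (C * (norm X)\<^sup>2) * norm (t - 0 :: real)"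
      if t: "t \<in> {-1..1}" for t
    proof (rule differentiable_bound[of "{-1..1}"])
      fix s :: real assume s: "s \<in> {-1..1}"
      show "((\<lambda>t. q t - t *\<^sub>R X) has_derivative (\<lambda>h. h *\<^sub>R (F X (q s) - X))) (at s within {-1..1})"
        unfolding has_vector_derivative_def[symmetric] by (auto intro!: derivative_eq_intros q(3)[OF s])
      have "norm (F X (q s) - F X a) \<le> K * norm X * norm (q s - a)"
        using r by (intro lip mem s) auto
      also have "\<dots> \<le> K * norm X * ((1 + K * r) * norm X)"
        using K0 by (intro mult_left_mono q s) auto
      finally have "norm (F X (q s) - X) \<le> C * (norm X)\<^sup>2" by (simp add: id C_def power2_eq_square mult_ac)
      then show "onorm (\<lambda>h. h *\<^sub>R (F X (q s) - X)) \<le> C * (norm X)\<^sup>2"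
        by (intro onorm_scaleR_le)
    qed (use t in auto)
    moreover have "(C * (norm X)\<^sup>2) * norm (t - 0 :: real) \<le> (C * (norm X)\<^sup>2) * 1" if "t \<in> {-1..1}" for t
      using that K0 kr by (intro mult_left_mono) (auto simp: C_def)
    ultimately have "norm (q t - a - t *\<^sub>R X) \<le> C * (norm X)\<^sup>2" if "t \<in> {-1..1}" for t
      using that by (fastforce simp: q(1) algebra_simps)
    with q mem r show ?thesis by blast
  qed auto
  then obtain q where "\<And>X. q X 0 = a \<and> (norm X < \<rho> \<longrightarrow> (\<forall>t\<in>{-1..1}. q X t \<in> S \<and>
      (q X has_vector_derivative F X (q X t)) (at t within {-1..1}) \<and> norm (q X t - a - t *\<^sub>R X) \<le> C * (norm X)\<^sup>2))"
    by metis
  then show ?thesis using \<rho> by (intro that[of \<rho> q C]) auto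
qed

text \<open>Each coordinate is an everywhere convergent power series in \<open>t\<close>, so it may
  be differentiated term by term; the shift of coefficients amounts to one more application of
  \<open>J\<close> to \<open>y\<close>.\<close>

lemma
  fixes J :: "'a::euclidean_space \<Rightarrow> 'a"
  assumes J: "linear J"
  shows exp_op_has_vector_derivative: "((\<lambda>t. exp_op t J y) has_vector_derivative exp_op t J (J y)) (at t)"
    and exp_op_linear_image: "J (exp_op t J y) = exp_op t J (J y)"
    and exp_op_sums: "(\<lambda>n. (t ^ n / fact n) *\<^sub>R (J ^^ n) y) sums exp_op t J y"
proof -
  obtain K where K: "0 < K" "\<And>x. norm (J x) \<le> norm x * K"
    using linear_bounded_pos[OF J] by (auto simp: mult.commute)
  have pow: "norm ((J ^^ n) y) \<le> K ^ n * norm y" for n y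
    by (induction n) (auto intro!: order_trans[OF K(2)] simp: mult_ac K(1))
  have sm: "summable (\<lambda>n. (t ^ n / fact n) *\<^sub>R (J ^^ n) y)" for t y
  proof (rule summable_comparison_test'[where N=0])
    show "summable (\<lambda>n. norm y * (inverse (fact n) * (\<bar>t\<bar> * K) ^ n))"
      by (intro summable_mult summable_exp)
    show "norm ((t ^ n / fact n) *\<^sub>R (J ^^ n) y) \<le> norm y * (inverse (fact n) * (\<bar>t\<bar> * K) ^ n)" for n
      using mult_left_mono[OF pow[of n y], of "\<bar>t\<bar> ^ n / fact n"]
      by (simp add: power_mult_distrib field_simps power_abs)
  qed
  have sums: "(\<lambda>n. (t ^ n / fact n) *\<^sub>R (J ^^ n) y) sums exp_op t J y" for t y
    unfolding exp_op_def using sm by (rule summable_sums)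
  show "(\<lambda>n. (t ^ n / fact n) *\<^sub>R (J ^^ n) y) sums exp_op t J y" by (rule sums)
  have "(\<lambda>n. J ((t ^ n / fact n) *\<^sub>R (J ^^ n) y)) sums J (exp_op t J y)"
    by (rule bounded_linear.sums[OF _ sums]) (use J linear_conv_bounded_linear in auto)
  moreover have "J ((t ^ n / fact n) *\<^sub>R (J ^^ n) y) = (t ^ n / fact n) *\<^sub>R (J ^^ n) (J y)" for n
    by (simp add: linear_scale[OF J] funpow_swap1)
  ultimately show "J (exp_op t J y) = exp_op t J (J y)"
    using sums_unique2[OF _ sums[of t "J y"]] by simp
  show "((\<lambda>t. exp_op t J y) has_vector_derivative exp_op t J (J y)) (at t)"
    unfolding has_vector_derivative_def has_derivative_componentwise_within[of "\<lambda>t. exp_op t J y"]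
  proof
    fix b :: 'a assume "b \<in> Basis"
    define c where "c n = ((J ^^ n) y \<bullet> b) / fact n" for n
    have s: "(\<lambda>n. c n * t ^ n) sums (exp_op t J y \<bullet> b)" for t
      using bounded_linear.sums[OF bounded_linear_inner_left sums[of t y], of b]
      by (simp add: c_def mult.commute)
    have s': "(\<lambda>n. diffs c n * t ^ n) sums (exp_op t J (J y) \<bullet> b)" for t
    proof -
      have "diffs c n * t ^ n = (t ^ n / fact n) *\<^sub>R (J ^^ n) (J y) \<bullet> b" for n
        by (simp add: c_def diffs_def funpow_swap1 field_simps del: of_nat_Suc)
      then show ?thesis
        using bounded_linear.sums[OF bounded_linear_inner_left sums[of t "J y"], of b] by simp
    qed
    have "((\<lambda>t. \<Sum>n. c n * t ^ n) has_field_derivative (\<Sum>n. diffs c n * t ^ n)) (at t)"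
      using s by (intro termdiffs_strong_converges_everywhere) (auto simp: sums_iff)
    then show "((\<lambda>t. exp_op t J y \<bullet> b) has_derivative (\<lambda>x. x *\<^sub>R exp_op t J (J y) \<bullet> b)) (at t)"
      using s s' by (simp add: sums_iff has_field_derivative_def mult_commute_abs)
  qed
qed

lemma exp_op_0 [simp]: "exp_op 0 J y = y"
proof -
  have "(\<lambda>n. (0 ^ n / fact n) *\<^sub>R (J ^^ n) y) = (\<lambda>n. if n = 0 then y else 0)"
    by (auto simp: fun_eq_iff)
  then show ?thesis
    unfolding exp_op_def using sums_unique[OF sums_single[of 0 "\<lambda>_. y"]] by simp
qed

text \<open>A Gronwall argument in both time directions: \<open>exp (-2*K*t)\<close> times the
  squared length decreases for positive times, and with the opposite sign it increases for negative
  ones.\<close>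

lemma linear_ode_zero:
  fixes d :: "real \<Rightarrow> 'a::euclidean_space"
  assumes J: "linear J" and T: "is_interval T" "open T" "0 \<in> T"
    and d: "\<And>t. t \<in> T \<Longrightarrow> (d has_vector_derivative J (d t)) (at t)" and d0: "d 0 = 0" and t: "t \<in> T"
  shows "d t = 0"
proof -
  obtain K where K: "0 < K" "\<And>x. norm (J x) \<le> norm x * K"
    using linear_bounded_pos[OF J] by (auto simp: mult.commute)
  have inner: "\<bar>x \<bullet> J x\<bar> \<le> K * (x \<bullet> x)" for x
    using Cauchy_Schwarz_ineq2[of x "J x"] mult_left_mono[OF K(2)[of x], of "norm x"]
    by (simp add: dot_square_norm power2_eq_square mult_ac)
  have D: "((\<lambda>s. exp (k * s) * (d s \<bullet> d s)) has_real_derivative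
      exp (k * s) * (k * (d s \<bullet> d s) + 2 * (d s \<bullet> J (d s)))) (at s)" if "s \<in> T" for s k
  proof -
    have "((\<lambda>s. d s \<bullet> d s) has_vector_derivative 2 * (d s \<bullet> J (d s))) (at s)"
      using bounded_bilinear.has_vector_derivative[OF bounded_bilinear_inner d[OF that] d[OF that]]
      by (simp add: inner_commute)
    then show ?thesis
      unfolding has_real_derivative_iff_has_vector_derivative[symmetric]
      by (auto intro!: derivative_eq_intros simp: algebra_simps)
  qed
  have seg: "s \<in> T" if "min 0 t \<le> s" "s \<le> max 0 t" for s
    using T t that unfolding is_interval_1 by (smt (verit))
  have "d t \<bullet> d t \<le> 0"
  proof (cases "0 \<le> t")
    case True
    have "exp ((-2*K) * t) * (d t \<bullet> d t) \<le> exp ((-2*K) * 0) * (d 0 \<bullet> d 0)"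
    proof (rule DERIV_nonpos_imp_nonincreasing[OF True])
      fix s assume "0 \<le> s" "s \<le> t"
      then have "s \<in> T" using seg True by auto
      then show "\<exists>y. ((\<lambda>s. exp ((-2*K) * s) * (d s \<bullet> d s)) has_real_derivative y) (at s) \<and> y \<le> 0"
        using D[of s "-2*K"] inner[of "d s"] by (intro exI conjI) (auto simp: mult_le_0_iff)
    qed
    then show ?thesis by (simp add: d0 mult_le_0_iff)
  next
    case False
    have "exp ((2*K) * t) * (d t \<bullet> d t) \<le> exp ((2*K) * 0) * (d 0 \<bullet> d 0)"
    proof (rule DERIV_nonneg_imp_nondecreasing[where f="\<lambda>s. exp ((2*K) * s) * (d s \<bullet> d s)"])
      fix s assume "t \<le> s" "s \<le> 0"
      then have "s \<in> T" using seg False by auto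
      then show "\<exists>y. ((\<lambda>s. exp ((2*K) * s) * (d s \<bullet> d s)) has_real_derivative y) (at s) \<and> 0 \<le> y"
        using D[of s "2*K"] inner[of "d s"] by (intro exI conjI) (auto simp: zero_le_mult_iff)
    qed (use False in auto)
    then show ?thesis by (simp add: d0 mult_le_0_iff)
  qed
  then show ?thesis by (metis antisym inner_eq_zero_iff inner_ge_zero)
qed

section \<open>Inner products and the decomposition of the Lie algebra\<close>

locale scalar_product =
  fixes b :: "'a::euclidean_space \<Rightarrow> 'a \<Rightarrow> real"
  assumes inner_product: "inner_product b"
begin

lemma linear_right: "linear (b x)" and linear_left: "linear (\<lambda>x. b x y)" and commute: "b x y = b y x"
  and nondegenerate: "(\<And>y. b x y = 0) \<Longrightarrow> x = 0"
  using inner_product unfolding inner_product_def by (blast, blast, metis, metis)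

lemmas right_simps = linear_0[OF linear_right] linear_add[OF linear_right] linear_diff[OF linear_right]
  linear_neg[OF linear_right] linear_scale[OF linear_right]
lemmas left_simps = linear_0[OF linear_left] linear_add[OF linear_left] linear_diff[OF linear_left]
  linear_neg[OF linear_left] linear_scale[OF linear_left]

lemma bounded_bilinear: "bounded_bilinear b"
  using linear_left linear_right by (intro bilinear_conv_bounded_bilinear[THEN iffD1]) (simp add: bilinear_def)

lemma eqI: "(\<And>w. b x w = b y w) \<Longrightarrow> x = y"
  using nondegenerate[of "x - y"] by (simp add: left_simps)

text \<open>The map \<open>h\<close> carries \<open>b\<close> to the Euclidean inner product.
  Nondegeneracy makes it injective, hence surjective in finite dimension, and the Euclidean
  representative of \<open>f\<close> can be pulled back.\<close>

lemma represent_exists: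
  assumes f: "linear f" shows "\<exists>a. \<forall>w. b a w = f w"
proof -
  define h where "h a = (\<Sum>i\<in>Basis. b a i *\<^sub>R i)" for a
  have h_inner: "h a \<bullet> w = b a w" for a w
  proof -
    have "h a \<bullet> w = (\<Sum>i\<in>Basis. b a i * (i \<bullet> w))" by (simp add: h_def inner_sum_left)
    also have "\<dots> = b a (\<Sum>i\<in>Basis. (w \<bullet> i) *\<^sub>R i)"
      by (simp add: linear_sum[OF linear_right] right_simps inner_commute mult.commute)
    finally show ?thesis by (simp add: euclidean_representation)
  qed
  have lin: "linear h"
    by (rule linearI) (simp_all add: h_def left_simps scaleR_left_distrib sum.distrib scaleR_sum_right)
  have "inj h"
    unfolding linear_injective_0[OF lin]
  proof (intro allI impI)
    fix a assume "h a = 0"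
    then show "a = 0" using h_inner[of a] by (intro nondegenerate) simp
  qed
  then obtain a where a: "h a = (\<Sum>i\<in>Basis. f i *\<^sub>R i)"
    using linear_injective_imp_surjective[OF lin] by (metis surjD)
  have "b a w = f w" for w
  proof -
    have "b a w = (\<Sum>i\<in>Basis. f i * (i \<bullet> w))" by (simp add: h_inner[symmetric] a inner_sum_left)
    also have "\<dots> = f (\<Sum>i\<in>Basis. (w \<bullet> i) *\<^sub>R i)"
      by (simp add: linear_sum[OF f] linear_scale[OF f] inner_commute mult.commute)
    finally show ?thesis by (simp add: euclidean_representation)
  qed
  then show ?thesis by blast
qed

lemma represent: "linear f \<Longrightarrow> b (represent b f) w = f w"
proof -
  assume "linear f"
  then have "\<exists>!a. \<forall>w. b a w = f w" using represent_exists eqI by metis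
  then show ?thesis unfolding represent_def by (rule theI'[THEN spec])
qed

lemma subspace_perp: "subspace (perp b S)"
  unfolding perp_def by (rule subspaceI) (auto simp: left_simps)

text \<open>For an indefinite form nondegeneracy does not pass to subspaces, so it is required on
  \<open>S\<close> itself.\<close>

lemma perp_decomposition:
  assumes S: "subspace S" and nd: "\<And>x. x \<in> S \<Longrightarrow> (\<And>y. y \<in> S \<Longrightarrow> b x y = 0) \<Longrightarrow> x = 0"
  obtains s where "s \<in> S" "x - s \<in> perp b S"
proof -
  obtain B where B: "B \<subseteq> S" "pairwise orthogonal B" "\<And>x. x \<in> B \<Longrightarrow> norm x = 1" "independent B" "span B = S"
    using orthonormal_basis_subspace[OF S] by metis
  have fin: "finite B" using B(4) independent_imp_finite by blast
  \<comment> \<open>\<open>h\<close> replaces the Euclidean coordinates of \<open>x\<close> along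
    the orthonormal basis \<open>B\<close> by the numbers \<open>b x i\<close> and changes nothing
    else. As an endomorphism of the whole space it is onto once it is injective, and the preimage
    \<open>s\<close> taken below is the \<open>b\<close>-orthogonal projection.\<close>
  define h where "h x = x + (\<Sum>i\<in>B. (b x i - x \<bullet> i) *\<^sub>R i)" for x
  have ortho: "(\<Sum>i\<in>B. k i *\<^sub>R i) \<bullet> j = k j" if "j \<in> B" for k j
  proof -
    have "(\<Sum>i\<in>B. k i *\<^sub>R i) \<bullet> j = (\<Sum>i\<in>B. if i = j then k j else 0)"
      unfolding inner_sum_left
    proof (rule sum.cong)
      fix i assume "i \<in> B"
      then show "k i *\<^sub>R i \<bullet> j = (if i = j then k j else 0)"
        using B(2) B(3)[of j] that by (auto simp: pairwise_def orthogonal_def norm_eq_1)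
    qed simp
    then show ?thesis using fin that by simp
  qed
  have h_inner: "h x \<bullet> j = b x j" if "j \<in> B" for x j
    using ortho[OF that] by (simp add: h_def inner_add_left)
  have lin: "linear h"
    by (rule linearI)
       (auto simp: h_def left_simps inner_add_left scaleR_left_distrib scaleR_left_diff_distrib scaleR_right_distrib right_diff_distrib
          scaleR_diff_right scaleR_sum_right sum.distrib sum_subtractf)
  have in_S: "x \<in> S" if "h x \<in> S" for x
  proof -
    have "(\<Sum>i\<in>B. (b x i - x \<bullet> i) *\<^sub>R i) \<in> S"
      using B(1) S by (intro subspace_sum subspace_scale) auto
    then have "h x - (\<Sum>i\<in>B. (b x i - x \<bullet> i) *\<^sub>R i) \<in> S" using that S subspace_diff by blast
    then show ?thesis by (simp add: h_def)
  qed
  have perpI: "x \<in> perp b S" if "\<And>j. j \<in> B \<Longrightarrow> b x j = 0" for x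
  proof -
    have "b x y = 0" if "y \<in> span B" for y
      using that by (induction rule: span_induct) (auto simp: right_simps subspace_def \<open>\<And>j. j \<in> B \<Longrightarrow> b x j = 0\<close>)
    then show ?thesis using B(5) by (simp add: perp_def)
  qed
  have "inj h"
    unfolding linear_injective_0[OF lin]
  proof (intro allI impI)
    fix x assume "h x = 0"
    then have "x \<in> S" using in_S[of x] subspace_0[OF S] \<open>h x = 0\<close> by simp
    moreover have "x \<in> perp b S" using h_inner \<open>h x = 0\<close> by (intro perpI) (metis inner_zero_left)
    ultimately show "x = 0" using nd by (simp add: perp_def)
  qed
  then obtain s where s: "h s = (\<Sum>i\<in>B. b x i *\<^sub>R i)"
    using linear_injective_imp_surjective[OF lin] by (metis surjD)
  show ?thesis
  proof (rule that)
    have "h s \<in> S" unfolding s using B(1) by (intro subspace_sum subspace_scale S) auto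
    then show "s \<in> S" by (rule in_S)
    show "x - s \<in> perp b S"
    proof (rule perpI)
      fix j assume j: "j \<in> B"
      show "b (x - s) j = 0" using h_inner[OF j, of s] ortho[OF j, of "b x"] by (simp add: s left_simps)
    qed
  qed
qed

end

lemma component_unique:
  assumes "subspace S" "subspace T" "S \<inter> T = {0}" "s \<in> S" "x - s \<in> T"
  shows "component S T x = s"
  unfolding component_def
proof (rule the_equality)
  fix s' assume s': "s' \<in> S \<and> x - s' \<in> T"
  then have "(x - s) - (x - s') \<in> T" "s' - s \<in> S"
    using assms s' by (simp_all only: subspace_diff)
  moreover have "(x - s) - (x - s') = s' - s" by simp
  ultimately have "s' - s \<in> S \<inter> T" by simp
  then show "s' = s" unfolding assms(3) by simp
qed (use assms in auto)

locale component_pair =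
  fixes S T :: "'a::euclidean_space set"
  assumes S: "subspace S" and T: "subspace T" and trivial: "\<And>x. x \<in> S \<Longrightarrow> x \<in> T \<Longrightarrow> x = 0"
    and total: "\<And>x. \<exists>s\<in>S. x - s \<in> T"
begin

lemma component_eq: "s \<in> S \<Longrightarrow> x - s \<in> T \<Longrightarrow> component S T x = s"
  using S T trivial by (intro component_unique) (auto simp: subspace_0)

lemma component_mem: "component S T x \<in> S" "x - component S T x \<in> T"
  using total[of x] component_eq by auto

lemma component_left: "s \<in> S \<Longrightarrow> component S T s = s"
  using T subspace_0 by (intro component_eq) auto

lemma linear_component: "linear (component S T)"
proof (rule linearI; rule component_eq)
  fix x y :: 'a and r :: real
  note m = component_mem
  show "component S T x + component S T y \<in> S" "r *\<^sub>R component S T x \<in> S"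
    using S m subspace_add subspace_scale by blast+
  have "(x - component S T x) + (y - component S T y) \<in> T" "r *\<^sub>R (x - component S T x) \<in> T"
    using T m subspace_add subspace_scale by blast+
  then show "x + y - (component S T x + component S T y) \<in> T" "r *\<^sub>R x - r *\<^sub>R component S T x \<in> T"
    by (simp_all add: algebra_simps)
qed

end

text \<open>The linear algebra of the splitting sees the centre only as a subspace \<open>C\<close>,
  so the bracket stays out of it.\<close>

locale center_decomposition = scalar_product ip for ip :: "'a::euclidean_space \<Rightarrow> 'a \<Rightarrow> real" +
  fixes C U Z V E :: "'a set"
  assumes C: "subspace C"
    and U_def: "U = C \<inter> perp ip C"
    and V: "subspace V" "totally_null ip V" "dually_paired ip U V"
    and Z_def: "Z = C \<inter> perp ip U \<inter> perp ip V"
    and E_def: "E = perp ip Z \<inter> (perp ip U \<inter> perp ip V)"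
begin

lemma subspaces: "subspace U" "subspace Z" "subspace E"
  unfolding U_def Z_def E_def by (auto intro!: subspace_inter C subspace_perp)

lemma orthogonal:
  "u \<in> U \<Longrightarrow> x \<in> C \<Longrightarrow> ip u x = 0" "u \<in> U \<Longrightarrow> x \<in> C \<Longrightarrow> ip x u = 0"
  "e \<in> E \<Longrightarrow> x \<in> U \<union> Z \<union> V \<Longrightarrow> ip e x = 0" "e \<in> E \<Longrightarrow> x \<in> U \<union> Z \<union> V \<Longrightarrow> ip x e = 0"
  "z \<in> Z \<Longrightarrow> x \<in> U \<union> V \<Longrightarrow> ip z x = 0" "z \<in> Z \<Longrightarrow> x \<in> U \<union> V \<Longrightarrow> ip x z = 0"
  "v \<in> V \<Longrightarrow> v' \<in> V \<Longrightarrow> ip v v' = 0"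
proof -
  show U: "u \<in> U \<Longrightarrow> x \<in> C \<Longrightarrow> ip u x = 0" for u x by (simp add: U_def perp_def)
  show E: "e \<in> E \<Longrightarrow> x \<in> U \<union> Z \<union> V \<Longrightarrow> ip e x = 0" for e x by (auto simp: E_def perp_def)
  show Z: "z \<in> Z \<Longrightarrow> x \<in> U \<union> V \<Longrightarrow> ip z x = 0" for z x by (auto simp: Z_def perp_def)
  show "u \<in> U \<Longrightarrow> x \<in> C \<Longrightarrow> ip x u = 0" using U[of u x] by (simp only: commute[of x u])
  show "e \<in> E \<Longrightarrow> x \<in> U \<union> Z \<union> V \<Longrightarrow> ip x e = 0" using E[of e x] by (simp only: commute[of x e])
  show "z \<in> Z \<Longrightarrow> x \<in> U \<union> V \<Longrightarrow> ip x z = 0" using Z[of z x] by (simp only: commute[of x z])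
  show "v \<in> V \<Longrightarrow> v' \<in> V \<Longrightarrow> ip v v' = 0" using V(2) by (simp add: totally_null_def)
qed

lemma U_C: "U \<subseteq> C" and Z_C: "Z \<subseteq> C" unfolding U_def Z_def by auto

lemma U_null: "u \<in> U \<Longrightarrow> u' \<in> U \<Longrightarrow> ip u u' = 0"
  using orthogonal(1) U_C by blast

lemma paired: "u \<in> U \<Longrightarrow> (\<And>v. v \<in> V \<Longrightarrow> ip u v = 0) \<Longrightarrow> u = 0" "v \<in> V \<Longrightarrow> (\<And>u. u \<in> U \<Longrightarrow> ip u v = 0) \<Longrightarrow> v = 0"
  using V(3) unfolding dually_paired_def by auto

text \<open>\<open>U\<close> and \<open>V\<close> are totally null and dually paired, so the form on
  their sum is hyperbolic: pairing with \<open>U\<close> detects the \<open>V\<close>-part, then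
  pairing with \<open>V\<close> detects the \<open>U\<close>-part. Projection along a nondegenerate
  subspace applies.\<close>

lemma UV_decomposition: obtains u v where "u \<in> U" "v \<in> V" "x - (u + v) \<in> perp ip U \<inter> perp ip V"
proof -
  have UV: "span (U \<union> V) = {u + v | u v. u \<in> U \<and> v \<in> V}"
    using V(1) subspaces(1) by (simp add: span_Un span_eq_iff[THEN iffD2])
  obtain s where s: "s \<in> span (U \<union> V)" "x - s \<in> perp ip (span (U \<union> V))"
  proof (rule perp_decomposition[of "span (U \<union> V)"])
    fix x assume x: "x \<in> span (U \<union> V)" and 0: "\<And>y. y \<in> span (U \<union> V) \<Longrightarrow> ip x y = 0"
    obtain u v where uv: "x = u + v" "u \<in> U" "v \<in> V" using x UV by auto
    have "ip u' v = 0" if "u' \<in> U" for u'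
      using 0[of u'] that uv U_null[of u u'] by (simp add: span_base left_simps commute[of u'])
    then have "v = 0" using uv by (intro paired) auto
    have "ip u v' = 0" if "v' \<in> V" for v' using 0[of v'] that uv \<open>v = 0\<close> by (auto simp: span_base left_simps)
    then have "u = 0" using uv by (intro paired) auto
    then show "x = 0" using uv \<open>v = 0\<close> by simp
  qed auto
  obtain u v where uv: "s = u + v" "u \<in> U" "v \<in> V" using s(1) UV by auto
  have "x - s \<in> perp ip U \<inter> perp ip V" using s(2) by (auto simp: perp_def span_base)
  then show ?thesis using uv by (intro that) auto
qed

text \<open>The \<open>V\<close>-part of a vector of \<open>C\<close> is orthogonal to
  \<open>U\<close>, because \<open>U\<close> is orthogonal to all of \<open>C\<close>; by duality it
  vanishes.\<close>

lemma C_decomposition: assumes "x \<in> C" obtains u z where "u \<in> U" "z \<in> Z" "x = u + z"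
proof -
  obtain u v where uv: "u \<in> U" "v \<in> V" "x - (u + v) \<in> perp ip U \<inter> perp ip V" using UV_decomposition .
  have "ip u' v = 0" if "u' \<in> U" for u'
    using uv that orthogonal(2)[of u' x] U_null[of u u'] assms by (simp add: perp_def left_simps commute[of u'])
  then have "v = 0" using uv by (intro paired) auto
  then have "x - u \<in> Z" using uv assms U_C C subspace_diff unfolding Z_def by auto
  then show ?thesis using that uv(1) by force
qed

text \<open>A vector of \<open>Z\<close> orthogonal to \<open>Z\<close> is orthogonal to
  \<open>U + Z = C\<close>, so it lies in \<open>U\<close>. It is also orthogonal to
  \<open>V\<close>, which no nonzero vector of \<open>U\<close> is.\<close>

lemma Z_nondegenerate: "z \<in> Z \<Longrightarrow> (\<And>y. y \<in> Z \<Longrightarrow> ip z y = 0) \<Longrightarrow> z = 0"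
proof -
  assume z: "z \<in> Z" and 0: "\<And>y. y \<in> Z \<Longrightarrow> ip z y = 0"
  have "ip z y = 0" if "y \<in> C" for y
    using that 0 z orthogonal(5) by (elim C_decomposition) (auto simp: right_simps)
  then have "z \<in> U" using z Z_C by (auto simp: U_def perp_def)
  then show "z = 0" using z orthogonal(5) by (intro paired) auto
qed

lemma decomposition:
  obtains u z v e where "u \<in> U" "z \<in> Z" "v \<in> V" "e \<in> E" "x = u + z + v + e"
proof -
  obtain u v where uv: "u \<in> U" "v \<in> V" "x - (u + v) \<in> perp ip U \<inter> perp ip V" using UV_decomposition .
  obtain z where z: "z \<in> Z" "x - (u + v) - z \<in> perp ip Z"
    by (rule perp_decomposition[of Z "x - (u + v)"]) (use subspaces(2) Z_nondegenerate in auto)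
  have "z \<in> perp ip U \<inter> perp ip V" using z by (simp add: Z_def)
  then have "x - (u + v) - z \<in> perp ip U \<inter> perp ip V"
    using uv(3) subspace_inter[OF subspace_perp subspace_perp] subspace_diff by blast
  then have "x - (u + v) - z \<in> E" using z(2) by (simp add: E_def)
  then show ?thesis using that[of u z v "x - (u + v) - z"] uv z by simp
qed

text \<open>The parts are detected one after the other by pairing: \<open>v\<close> with
  \<open>U\<close>, then \<open>u\<close> with \<open>V\<close>, then \<open>z\<close> with
  \<open>Z\<close>; \<open>e\<close> is what remains.\<close>

lemma decomposition_zero:
  assumes "u \<in> U" "z \<in> Z" "v \<in> V" "e \<in> E" "u + z + v + e = 0"
  shows "u = 0" "z = 0" "v = 0" "e = 0"
proof -
  have eq: "ip (u + z + v + e) w = 0" for w using assms(5) by (simp add: left_simps)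
  have "ip u' v = 0" if "u' \<in> U" for u'
    using eq[of u'] assms(1-4) that U_null[of u u'] orthogonal(3)[of e u'] orthogonal(5)[of z u']
    by (simp add: left_simps commute[of u'])
  then show v: "v = 0" using assms by (intro paired) auto
  have "ip u v' = 0" if "v' \<in> V" for v'
    using eq[of v'] assms(1-4) that v orthogonal(3)[of e v'] orthogonal(5)[of z v'] by (auto simp: left_simps)
  then show u: "u = 0" using assms by (intro paired) auto
  have "ip z z' = 0" if "z' \<in> Z" for z'
    using eq[of z'] assms(1-4) that u v orthogonal(3)[of e z'] by (auto simp: left_simps)
  then show z: "z = 0" using assms by (intro Z_nondegenerate) auto
  show "e = 0" using u v z assms by simp
qed

lemma E_nondegenerate: "e \<in> E \<Longrightarrow> (\<And>y. y \<in> E \<Longrightarrow> ip e y = 0) \<Longrightarrow> e = 0"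
proof -
  assume e: "e \<in> E" and 0: "\<And>y. y \<in> E \<Longrightarrow> ip e y = 0"
  have "ip e y = 0" for y
    by (rule decomposition[of y]) (use e 0 orthogonal(3)[OF e] in \<open>auto simp: right_simps\<close>)
  then show "e = 0" by (rule nondegenerate)
qed

lemma span_sum3:
  assumes "subspace A" "subspace B" "subspace D"
  shows "span (A \<union> B \<union> D) = {a + b + d | a b d. a \<in> A \<and> b \<in> B \<and> d \<in> D}"
proof -
  have "span A = A" "span B = B" "span D = D" using assms by simp_all
  then show ?thesis unfolding span_Un by blast
qed

text \<open>This and the next two sublocales oppose one summand to the span of the other three, the
  form in which \<open>component\<close> projections enter the geodesic formulas.\<close>

sublocale cE: component_pair E "span (U \<union> Z \<union> V)"
proof
  show "x = 0" if x: "x \<in> E" "x \<in> span (U \<union> Z \<union> V)" for x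
  proof -
    obtain u z v where d: "x = u + z + v" "u \<in> U" "z \<in> Z" "v \<in> V" using x span_sum3[OF subspaces(1,2) V(1)] by auto
    have n: "- x \<in> E" using x subspaces subspace_neg by blast
    have "u + z + v + - x = 0" unfolding d(1) by (simp add: algebra_simps)
    from decomposition_zero(4)[OF d(2-4) n this] show ?thesis by simp
  qed
  show "\<exists>s\<in>E. x - s \<in> span (U \<union> Z \<union> V)" for x
  proof (rule decomposition[of x])
    fix u z v e assume "u \<in> U" "z \<in> Z" "v \<in> V" "e \<in> E" "x = u + z + v + e"
    then show ?thesis using span_sum3[OF subspaces(1,2) V(1)] by (intro bexI[of _ e]) auto
  qed
qed (use subspaces V(1) in auto)

sublocale cU: component_pair U "span (Z \<union> V \<union> E)"
proof
  show "x = 0" if x: "x \<in> U" "x \<in> span (Z \<union> V \<union> E)" for x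
  proof -
    obtain z v e where d: "x = z + v + e" "z \<in> Z" "v \<in> V" "e \<in> E" using x span_sum3[OF subspaces(2) V(1) subspaces(3)] by auto
    have n: "- x \<in> U" using x subspaces subspace_neg by blast
    have "- x + z + v + e = 0" unfolding d(1) by (simp add: algebra_simps)
    from decomposition_zero(1)[OF n d(2-4) this] show ?thesis by simp
  qed
  show "\<exists>s\<in>U. x - s \<in> span (Z \<union> V \<union> E)" for x
  proof (rule decomposition[of x])
    fix u z v e assume "u \<in> U" "z \<in> Z" "v \<in> V" "e \<in> E" "x = u + z + v + e"
    then show ?thesis using span_sum3[OF subspaces(2) V(1) subspaces(3)] by (intro bexI[of _ u]) auto
  qed
qed (use subspaces V(1) in auto)

sublocale cZ: component_pair Z "span (U \<union> V \<union> E)"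
proof
  show "x = 0" if x: "x \<in> Z" "x \<in> span (U \<union> V \<union> E)" for x
  proof -
    obtain u v e where d: "x = u + v + e" "u \<in> U" "v \<in> V" "e \<in> E" using x span_sum3[OF subspaces(1) V(1) subspaces(3)] by auto
    have n: "- x \<in> Z" using x subspaces subspace_neg by blast
    have "u + - x + v + e = 0" unfolding d(1) by (simp add: algebra_simps)
    from decomposition_zero(2)[OF d(2) n d(3,4) this] show ?thesis by simp
  qed
  show "\<exists>s\<in>Z. x - s \<in> span (U \<union> V \<union> E)" for x
  proof (rule decomposition[of x])
    fix u z v e assume "u \<in> U" "z \<in> Z" "v \<in> V" "e \<in> E" "x = u + z + v + e"
    then show ?thesis using span_sum3[OF subspaces(1) V(1) subspaces(3)] by (intro bexI[of _ z]) auto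
  qed
qed (use subspaces V(1) in auto)

text \<open>Pairing with \<open>U\<close> removes the \<open>V\<close>-part and pairing with
  \<open>Z\<close> then removes the \<open>Z\<close>-part, both subspaces lying in \<open>C\<close>.
  Applied later to the values of \<open>K\<close>, which are orthogonal to the centre.\<close>

lemma perp_C:
  assumes "\<And>y. y \<in> C \<Longrightarrow> ip x y = 0"
  shows "x = component U (span (Z \<union> V \<union> E)) x + component E (span (U \<union> Z \<union> V)) x"
proof (rule decomposition[of x])
  fix u z v e assume d: "u \<in> U" "z \<in> Z" "v \<in> V" "e \<in> E" "x = u + z + v + e"
  have "ip u' v = 0" if "u' \<in> U" for u'
    using assms[of u'] d that U_null[of u u'] orthogonal(3)[of e u'] orthogonal(5)[of z u'] subsetD[OF U_C that]
    by (simp add: left_simps commute[of u'])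
  then have v: "v = 0" using d by (intro paired) auto
  have "ip z z' = 0" if "z' \<in> Z" for z'
    using assms[of z'] d that v orthogonal(3)[of e z'] orthogonal(1)[of u z'] Z_C by (auto simp: left_simps)
  then have z: "z = 0" using d by (intro Z_nondegenerate) auto
  have "component U (span (Z \<union> V \<union> E)) x = u" using d v z by (intro cU.component_eq) (auto simp: span_base)
  moreover have "component E (span (U \<union> Z \<union> V)) x = e" using d v z by (intro cE.component_eq) (auto simp: span_base)
  ultimately show ?thesis using d v z by simp
qed

end

section \<open>Differentiation in charts\<close>

lemma frechet_derivative_transform_open:
  assumes "open S" "x \<in> S" "\<And>y. y \<in> S \<Longrightarrow> f y = g y"
  shows "frechet_derivative f (at x) = frechet_derivative g (at x)"
    and "f differentiable (at x) \<longleftrightarrow> g differentiable (at x)"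
proof -
  note in_S = eventually_nhds_in_open[OF assms(1,2)]
  have "eventually (\<lambda>y. f y = g y) (nhds x)" "eventually (\<lambda>y. g y = f y) (nhds x)"
    using in_S by (eventually_elim, simp add: assms(3))+
  then have "(f has_derivative D) (at x) \<longleftrightarrow> (g has_derivative D) (at x)" for D
    using has_derivative_eventually_nhds[of f D x g] has_derivative_eventually_nhds[of g D x f] by iprover
  then show "frechet_derivative f (at x) = frechet_derivative g (at x)"
    "f differentiable (at x) \<longleftrightarrow> g differentiable (at x)"
    unfolding frechet_derivative_def differentiable_def by auto
qed

lemma Ck_on_cong:
  assumes "open S" "\<And>y. y \<in> S \<Longrightarrow> f y = g y" "Ck_on k S f"
  shows "Ck_on k S g"
  using assms(2,3)
proof (induction k arbitrary: f g)
  case 0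
  then show ?case by (simp cong: continuous_on_cong)
next
  case (Suc k)
  note t = frechet_derivative_transform_open[OF assms(1) _ Suc.prems(1)]
  have "Ck_on k S (\<lambda>x. frechet_derivative g (at x) v)" for v
    by (rule Suc.IH[of "\<lambda>x. frechet_derivative f (at x) v"]) (use Suc.prems t(1) in auto)
  then show ?case using Suc.prems t(2) by auto
qed

lemma smooth_on_cong:
  "open S \<Longrightarrow> (\<And>y. y \<in> S \<Longrightarrow> f y = g y) \<Longrightarrow> smooth_on S f \<Longrightarrow> smooth_on S g"
  unfolding smooth_on_def using Ck_on_cong by blast

text \<open>A directional derivative of the composite is a directional derivative of
  \<open>h\<close> composed with the same affine map, so the induction generalises over
  \<open>h\<close>. Used to restrict the multiplication to slices.\<close>

lemma smooth_on_affine: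
  fixes h :: "'a::euclidean_space \<Rightarrow> 'b::real_normed_vector" and l :: "'c::euclidean_space \<Rightarrow> 'a"
  assumes "open S" and l: "linear l" and h: "smooth_on S h"
  shows "smooth_on {q. a + l q \<in> S} (\<lambda>q. h (a + l q))"
proof -
  have bl: "bounded_linear l" using l linear_conv_bounded_linear by blast
  have op: "open {q. a + l q \<in> S}"
    by (rule open_vimage[OF assms(1), of "\<lambda>q. a + l q", unfolded vimage_def])
      (intro continuous_intros linear_continuous_on bl)
  have D: "((\<lambda>q. h (a + l q)) has_derivative (\<lambda>v. frechet_derivative h (at (a + l q)) (l v))) (at q)"
    if "h differentiable (at (a + l q))" for h :: "'a \<Rightarrow> 'b" and q
  proof (rule has_derivative_compose[where f="\<lambda>q. a + l q" and g=h])
    show "((\<lambda>q. a + l q) has_derivative l) (at q)"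
      using bl by (auto intro!: derivative_eq_intros bounded_linear_imp_has_derivative)
    show "(h has_derivative frechet_derivative h (at (a + l q))) (at (a + l q))"
      using that frechet_derivative_works by blast
  qed
  have "Ck_on k {q. a + l q \<in> S} (\<lambda>q. h (a + l q))" if "Ck_on k S h" for k
    using that
  proof (induction k arbitrary: h)
    case 0
    have "continuous_on {q. a + l q \<in> S} (\<lambda>q. h (a + l q))"
      by (rule continuous_on_compose2[of S h])
        (use 0 in \<open>auto intro!: continuous_on_add continuous_on_const linear_continuous_on[OF bl]\<close>)
    then show ?case by simp
  next
    case (Suc k)
    have df: "h differentiable (at (a + l q))" if "a + l q \<in> S" for q using Suc.prems that by auto
    have "Ck_on k {q. a + l q \<in> S} (\<lambda>q. frechet_derivative (\<lambda>q. h (a + l q)) (at q) v)" for v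
      by (rule Ck_on_cong[OF op _ Suc.IH[of "\<lambda>x. frechet_derivative h (at x) (l v)"]])
        (use frechet_derivative_at[OF D[OF df]] Suc.prems in \<open>auto simp: fun_eq_iff\<close>)
    then show ?case using D[OF df] by (auto simp: differentiable_def)
  qed
  then show ?thesis using h by (simp add: smooth_on_def)
qed

lemma smooth_on_subset: 
  assumes "smooth_on S f" "R \<subseteq> S" shows "smooth_on R f"
proof -
  have "Ck_on k S f \<Longrightarrow> Ck_on k R f" for k
    using assms(2) by (induction k arbitrary: f) (auto intro: continuous_on_subset)
  then show ?thesis using assms(1) by (simp add: smooth_on_def)
qed

text \<open>Continuity at \<open>p\<close> is part of the notion because \<open>coord b\<close>
  carries no information off its domain: only continuity guarantees that \<open>f\<close> stays in
  that domain near \<open>p\<close>, as the chain rule needs.\<close>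

definition chart_diff ::
  "('g::t2_space, 'a::euclidean_space) chart \<Rightarrow> ('h::t2_space, 'b::euclidean_space) chart \<Rightarrow> ('g \<Rightarrow> 'h) \<Rightarrow> 'g \<Rightarrow> bool" where
  "chart_diff a b f p \<longleftrightarrow> p \<in> dom_of a \<and> f p \<in> dom_of b \<and> isCont f p \<and>
     (coord b \<circ> f \<circ> icoord a) differentiable (at (coord a p))"

lemma is_chartD:
  fixes a :: "('g::t2_space, 'a::euclidean_space) chart"
  assumes "is_chart a"
  shows "open (dom_of a)" "open (coord a ` dom_of a)"
    "p \<in> dom_of a \<Longrightarrow> icoord a (coord a p) = p"
    "q \<in> coord a ` dom_of a \<Longrightarrow> icoord a q \<in> dom_of a"
    "q \<in> coord a ` dom_of a \<Longrightarrow> coord a (icoord a q) = q"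
    "continuous_on (dom_of a) (coord a)" "continuous_on (coord a ` dom_of a) (icoord a)"
    "p \<in> dom_of a \<Longrightarrow> isCont (coord a) p"
    "q \<in> coord a ` dom_of a \<Longrightarrow> isCont (icoord a) q"
proof -
  note h = assms[unfolded is_chart_def]
  show 1: "open (dom_of a)" "open (coord a ` dom_of a)" using h by auto
  show "p \<in> dom_of a \<Longrightarrow> icoord a (coord a p) = p" using h by (meson homeomorphism_apply1)
  show "q \<in> coord a ` dom_of a \<Longrightarrow> icoord a q \<in> dom_of a" by (rule inv_into_into)
  show "q \<in> coord a ` dom_of a \<Longrightarrow> coord a (icoord a q) = q" by (rule f_inv_into_f)
  show 2: "continuous_on (dom_of a) (coord a)" "continuous_on (coord a ` dom_of a) (icoord a)"
    using h unfolding homeomorphism_def by auto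
  show "p \<in> dom_of a \<Longrightarrow> isCont (coord a) p" "q \<in> coord a ` dom_of a \<Longrightarrow> isCont (icoord a) q"
    using 1 2 by (auto simp: continuous_on_eq_continuous_at)
qed

lemma isCont_eventually_mem:
  assumes "isCont f p" "open S" "f p \<in> S"
  shows "eventually (\<lambda>x. f x \<in> S) (nhds p)"
  using assms topological_tendstoD[of f "f p" "nhds p" S] tendsto_at_iff_tendsto_nhds[of f p]
  by (simp add: isCont_def)

lemma tangent_map_has_derivative:
  "chart_diff a b f p \<Longrightarrow> ((coord b \<circ> f \<circ> icoord a) has_derivative tangent_map a b f p) (at (coord a p))"
  unfolding chart_diff_def tangent_map_def using frechet_derivative_works by blast

lemma linear_tangent_map: "chart_diff a b f p \<Longrightarrow> linear (tangent_map a b f p)"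
  using tangent_map_has_derivative has_derivative_linear by blast

lemma chart_diff_curve:
  assumes b: "is_chart b" and a: "is_chart a" and f: "chart_diff a b f (\<eta> t)" and \<eta>: "isCont \<eta> t"
    and d: "((coord a \<circ> \<eta>) has_vector_derivative v) (at t)"
  shows "((coord b \<circ> (f \<circ> \<eta>)) has_vector_derivative tangent_map a b f (\<eta> t) v) (at t)"
proof -
  have "((\<lambda>s. (coord b \<circ> f \<circ> icoord a) ((coord a \<circ> \<eta>) s)) has_derivative
      (\<lambda>h. tangent_map a b f (\<eta> t) (h *\<^sub>R v))) (at t)"
    by (rule has_derivative_compose[OF d[unfolded has_vector_derivative_def]])
      (simp only: comp_apply tangent_map_has_derivative[OF f, unfolded comp_def])
  moreover have "eventually (\<lambda>s. (coord b \<circ> f \<circ> icoord a) ((coord a \<circ> \<eta>) s) = (coord b \<circ> (f \<circ> \<eta>)) s) (nhds t)"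
  proof -
    have "eventually (\<lambda>s. \<eta> s \<in> dom_of a) (nhds t)"
      using f \<eta> is_chartD(1)[OF a] by (intro isCont_eventually_mem) (auto simp: chart_diff_def)
    then show ?thesis by eventually_elim (use is_chartD(3)[OF a] in auto)
  qed
  ultimately have "((coord b \<circ> (f \<circ> \<eta>)) has_derivative (\<lambda>h. tangent_map a b f (\<eta> t) (h *\<^sub>R v))) (at t)"
    by (rule has_derivative_eventually_nhds)
  then show ?thesis
    unfolding has_vector_derivative_def by (simp only: linear_scale[OF linear_tangent_map[OF f]])
qed

lemma chart_diff_compose:
  assumes a: "is_chart a" and b: "is_chart b" and f: "chart_diff a b f p" and h: "chart_diff b d h (f p)"
  shows "chart_diff a d (h \<circ> f) p"
    and "tangent_map a d (h \<circ> f) p = tangent_map b d h (f p) \<circ> tangent_map a b f p"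
proof -
  have pa: "p \<in> dom_of a" and fb: "f p \<in> dom_of b" and cf: "isCont f p" using f by (auto simp: chart_diff_def)
  have q: "coord a p \<in> coord a ` dom_of a" using pa by blast
  have [simp]: "icoord a (coord a p) = p" using pa is_chartD(3)[OF a] by auto
  have "((\<lambda>x. (coord d \<circ> h \<circ> icoord b) ((coord b \<circ> f \<circ> icoord a) x)) has_derivative
      (\<lambda>v. tangent_map b d h (f p) (tangent_map a b f p v))) (at (coord a p))"
    by (rule has_derivative_compose[OF tangent_map_has_derivative[OF f]])
      (use tangent_map_has_derivative[OF h] in \<open>simp add: comp_def\<close>)
  moreover have "eventually (\<lambda>x. (coord d \<circ> h \<circ> icoord b) ((coord b \<circ> f \<circ> icoord a) x) = (coord d \<circ> (h \<circ> f) \<circ> icoord a) x) (nhds (coord a p))"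
  proof -
    have "isCont (f \<circ> icoord a) (coord a p)"
      using isCont_o2[OF is_chartD(9)[OF a q], of f] cf by (simp add: comp_def)
    then have "eventually (\<lambda>x. (f \<circ> icoord a) x \<in> dom_of b) (nhds (coord a p))"
      by (rule isCont_eventually_mem) (use fb is_chartD(1)[OF b] in auto)
    then show ?thesis by eventually_elim (use is_chartD(3)[OF b] in auto)
  qed
  ultimately have D: "((coord d \<circ> (h \<circ> f) \<circ> icoord a) has_derivative
      (\<lambda>v. tangent_map b d h (f p) (tangent_map a b f p v))) (at (coord a p))"
    by (rule has_derivative_eventually_nhds)
  then show "tangent_map a d (h \<circ> f) p = tangent_map b d h (f p) \<circ> tangent_map a b f p"
    unfolding tangent_map_def[of a d] comp_def using frechet_derivative_at[OF D, symmetric] by (simp add: comp_def)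
  show "chart_diff a d (h \<circ> f) p"
    using D f h isCont_o2[of p f h] by (auto simp: chart_diff_def differentiable_def comp_def)
qed

lemma tangent_map_id:
  fixes a :: "('g::t2_space, 'a::euclidean_space) chart"
  assumes a: "is_chart a" and p: "p \<in> dom_of a" and f: "\<And>x. x \<in> dom_of a \<Longrightarrow> f x = x"
  shows "chart_diff a a f p" "tangent_map a a f p = id"
proof -
  have q: "coord a p \<in> coord a ` dom_of a" using p by blast
  have "((\<lambda>x. x) has_derivative (\<lambda>x. x)) (at (coord a p))" by simp
  moreover have "eventually (\<lambda>x. x = (coord a \<circ> f \<circ> icoord a) x) (nhds (coord a p))"
    using eventually_nhds_in_open[OF is_chartD(2)[OF a] q]
    by eventually_elim (simp add: f is_chartD(4,5)[OF a])
  ultimately have D: "((coord a \<circ> f \<circ> icoord a) has_derivative (\<lambda>x. x)) (at (coord a p))"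
    by (rule has_derivative_eventually_nhds)
  then show "tangent_map a a f p = id"
    unfolding tangent_map_def using frechet_derivative_at[OF D] by (simp add: id_def)
  have "isCont f p"
  proof -
    have "eventually (\<lambda>x. f x = x) (nhds p)" using eventually_nhds_in_open[OF is_chartD(1)[OF a] p] by eventually_elim (rule f)
    then show ?thesis by (simp add: isCont_cong)
  qed
  then show "chart_diff a a f p" using D p f[OF p] by (auto simp: chart_diff_def differentiable_def)
qed

section \<open>Multiplication and translations read in charts\<close>

context lie_group
begin

lemma closed [simp]: "x \<in> carrier G" using carrier_UNIV by simp

lemma chart: "a \<in> A \<Longrightarrow> is_chart a" using atlas unfolding smooth_atlas_def by blast

lemma chart_exists: obtains a where "a \<in> A" "p \<in> dom_of a"
  using atlas unfolding smooth_atlas_def by blast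

lemma continuous_group_mult: "continuous_on UNIV (\<lambda>x. fst x \<otimes> snd x)"
  using smooth_mult unfolding smooth_map_def by (simp add: case_prod_beta')

lemma continuous_group_inv: "continuous_on UNIV (\<lambda>x. inv x)"
  using smooth_inverse unfolding smooth_map_def by simp

lemma isCont_group_mult:
  fixes f h :: "'x::t2_space \<Rightarrow> 'g"
  assumes "isCont f x" "isCont h x" shows "isCont (\<lambda>x. f x \<otimes> h x) x"
  using isCont_o2[OF isCont_Pair[OF assms], of "\<lambda>x. fst x \<otimes> snd x"] continuous_group_mult
  by (simp add: continuous_on_eq_continuous_at)

lemma isCont_group_inv:
  fixes f :: "'x::t2_space \<Rightarrow> 'g"
  assumes "isCont f x" shows "isCont (\<lambda>x. inv (f x)) x"
  using isCont_o2[OF assms, of "\<lambda>x. inv x"] continuous_group_inv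
  by (simp add: continuous_on_eq_continuous_at)

text \<open>Three independent charts replace the product atlas, so that left and right translations
  become slices of the single map \<open>mult_coord\<close>, for which this is the domain.\<close>

definition mult_dom :: "('g, 'a) chart \<Rightarrow> ('g, 'a) chart \<Rightarrow> ('g, 'a) chart \<Rightarrow> ('a \<times> 'a) set" where
  "mult_dom a b d = {y \<in> coord a ` dom_of a \<times> coord b ` dom_of b. icoord a (fst y) \<otimes> icoord b (snd y) \<in> dom_of d}"

definition mult_coord :: "('g, 'a) chart \<Rightarrow> ('g, 'a) chart \<Rightarrow> ('g, 'a) chart \<Rightarrow> 'a \<times> 'a \<Rightarrow> 'a" where
  "mult_coord a b d y = coord d (icoord a (fst y) \<otimes> icoord b (snd y))"

lemma mult_dom_iff:
  assumes "a \<in> A" "b \<in> A" "p \<in> dom_of a" "p' \<in> dom_of b"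
  shows "(coord a p, coord b p') \<in> mult_dom a b d \<longleftrightarrow> p \<otimes> p' \<in> dom_of d"
    and "mult_coord a b d (coord a p, coord b p') = coord d (p \<otimes> p')"
  using assms is_chartD(3)[OF chart] by (auto simp: mult_dom_def mult_coord_def)

lemma open_mult_dom:
  assumes "a \<in> A" "b \<in> A" "d \<in> A"
  shows "open (mult_dom a b d)"
proof -
  have "continuous_on (coord a ` dom_of a \<times> coord b ` dom_of b) (\<lambda>y. icoord a (fst y) \<otimes> icoord b (snd y))"
    using is_chartD(7)[OF chart] assms
    by (intro continuous_on_compose2[OF continuous_group_mult, of _ "\<lambda>y. (icoord a (fst y), icoord b (snd y))", simplified]
        continuous_on_Pair continuous_on_compose2[of "coord a ` dom_of a" "icoord a" _ fst]
        continuous_on_compose2[of "coord b ` dom_of b" "icoord b" _ snd] continuous_intros) auto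
  then have "open ((\<lambda>y. icoord a (fst y) \<otimes> icoord b (snd y)) -` dom_of d \<inter> (coord a ` dom_of a \<times> coord b ` dom_of b))"
    by (subst (asm) continuous_on_open_vimage) (auto intro!: open_Times is_chartD(1,2)[OF chart] assms)
  moreover have "\<dots> = mult_dom a b d" by (auto simp: mult_dom_def)
  ultimately show ?thesis by simp
qed

text \<open>The inverse of the product chart \<open>e\<close> is an \<open>inv_into\<close>; it
  splits into the inverses of the factors only on the coordinate image, which contains
  \<open>mult_dom\<close>.\<close>

lemma smooth_mult_coord:
  assumes "a \<in> A" "b \<in> A" "d \<in> A"
  shows "smooth_on (mult_dom a b d) (mult_coord a b d)"
proof -
  define e where "e = (dom_of a \<times> dom_of b, map_prod (coord a) (coord b))"
  have inj: "inj_on (coord a) (dom_of a)" "inj_on (coord b) (dom_of b)"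
    using assms is_chartD(3)[OF chart] inj_on_inverseI by metis+
  have ic: "icoord e y = (icoord a (fst y), icoord b (snd y))" if "y \<in> coord a ` dom_of a \<times> coord b ` dom_of b" for y
    using that inj unfolding e_def by (auto intro!: inv_into_f_eq map_prod_inj_on simp: inv_into_into f_inv_into_f)
  have "e \<in> prod_atlas A A" using assms unfolding e_def prod_atlas_def by blast
  then have "smooth_on (coord e ` (dom_of e \<inter> (\<lambda>(p, q). p \<otimes> q) -` dom_of d)) (coord d \<circ> (\<lambda>(p, q). p \<otimes> q) \<circ> icoord e)"
    using smooth_mult assms(3) unfolding smooth_map_def by blast
  moreover have "mult_dom a b d \<subseteq> coord e ` (dom_of e \<inter> (\<lambda>(p, q). p \<otimes> q) -` dom_of d)"
  proof
    fix y assume y: "y \<in> mult_dom a b d"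
    then have "y = coord e (icoord a (fst y), icoord b (snd y))"
      by (auto simp: mult_dom_def e_def f_inv_into_f)
    moreover have "(icoord a (fst y), icoord b (snd y)) \<in> dom_of e \<inter> (\<lambda>(p, q). p \<otimes> q) -` dom_of d"
      using y by (auto simp: mult_dom_def e_def inv_into_into)
    ultimately show "y \<in> coord e ` (dom_of e \<inter> (\<lambda>(p, q). p \<otimes> q) -` dom_of d)" by blast
  qed
  ultimately have "smooth_on (mult_dom a b d) (coord d \<circ> (\<lambda>(p, q). p \<otimes> q) \<circ> icoord e)"
    by (rule smooth_on_subset)
  then show ?thesis
    by (rule smooth_on_cong[OF open_mult_dom[OF assms], rotated])
       (auto simp: mult_dom_def mult_coord_def ic)
qed

lemma mult_coord_deriv:
  assumes "a \<in> A" "b \<in> A" "d \<in> A" "p \<in> dom_of a" "p' \<in> dom_of b" "p \<otimes> p' \<in> dom_of d"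
  shows "(mult_coord a b d has_derivative frechet_derivative (mult_coord a b d) (at (coord a p, coord b p'))) (at (coord a p, coord b p'))"
  using assms mult_dom_iff(1) by (intro smooth_on_has_derivative[OF smooth_mult_coord]) auto

text \<open>The differential of a left translation is a partial derivative of the multiplication in
  its second argument. In this form it can itself be differentiated with respect to the translating
  element.\<close>

lemma left_translation_coord:
  assumes "a \<in> A" "b \<in> A" "d \<in> A" "p \<in> dom_of a" "p' \<in> dom_of b" "p \<otimes> p' \<in> dom_of d"
  shows "chart_diff b d (\<lambda>x. p \<otimes> x) p'"
    "tangent_map b d (\<lambda>x. p \<otimes> x) p' = (\<lambda>v. frechet_derivative (mult_coord a b d) (at (coord a p, coord b p')) (0, v))"
proof -
  let ?D = "frechet_derivative (mult_coord a b d) (at (coord a p, coord b p'))"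
  have "((\<lambda>s. mult_coord a b d (coord a p, s)) has_derivative (\<lambda>v. ?D (0, v))) (at (coord b p'))"
    by (rule has_derivative_compose[where g="mult_coord a b d" and f="\<lambda>s. (coord a p, s)", OF _ mult_coord_deriv[OF assms]])
       (auto intro!: derivative_eq_intros)
  moreover have "(\<lambda>s. mult_coord a b d (coord a p, s)) = coord d \<circ> (\<lambda>x. p \<otimes> x) \<circ> icoord b"
    using is_chartD(3)[OF chart] assms by (auto simp: mult_coord_def fun_eq_iff)
  ultimately have D: "((coord d \<circ> (\<lambda>x. p \<otimes> x) \<circ> icoord b) has_derivative (\<lambda>v. ?D (0, v))) (at (coord b p'))" by simp
  show "tangent_map b d (\<lambda>x. p \<otimes> x) p' = (\<lambda>v. ?D (0, v))"
    unfolding tangent_map_def using frechet_derivative_at[OF D] by simp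
  show "chart_diff b d (\<lambda>x. p \<otimes> x) p'"
    using D assms isCont_group_mult[of p' "\<lambda>x. p" "\<lambda>x. x"] continuous_const continuous_ident by (auto simp: chart_diff_def differentiable_def)
qed

lemma right_translation_coord:
  assumes "a \<in> A" "b \<in> A" "d \<in> A" "p \<in> dom_of a" "p' \<in> dom_of b" "p \<otimes> p' \<in> dom_of d"
  shows "chart_diff a d (\<lambda>x. x \<otimes> p') p"
    "tangent_map a d (\<lambda>x. x \<otimes> p') p = (\<lambda>v. frechet_derivative (mult_coord a b d) (at (coord a p, coord b p')) (v, 0))"
proof -
  let ?D = "frechet_derivative (mult_coord a b d) (at (coord a p, coord b p'))"
  have "((\<lambda>s. mult_coord a b d (s, coord b p')) has_derivative (\<lambda>v. ?D (v, 0))) (at (coord a p))"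
    by (rule has_derivative_compose[where g="mult_coord a b d" and f="\<lambda>s. (s, coord b p')", OF _ mult_coord_deriv[OF assms]])
       (auto intro!: derivative_eq_intros)
  moreover have "(\<lambda>s. mult_coord a b d (s, coord b p')) = coord d \<circ> (\<lambda>x. x \<otimes> p') \<circ> icoord a"
    using is_chartD(3)[OF chart] assms by (auto simp: mult_coord_def fun_eq_iff)
  ultimately have D: "((coord d \<circ> (\<lambda>x. x \<otimes> p') \<circ> icoord a) has_derivative (\<lambda>v. ?D (v, 0))) (at (coord a p))" by simp
  show "tangent_map a d (\<lambda>x. x \<otimes> p') p = (\<lambda>v. ?D (v, 0))"
    unfolding tangent_map_def using frechet_derivative_at[OF D] by simp
  show "chart_diff a d (\<lambda>x. x \<otimes> p') p"
    using D assms isCont_group_mult[of p "\<lambda>x. x" "\<lambda>x. p'"] continuous_const continuous_ident by (auto simp: chart_diff_def differentiable_def)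
qed

lemma chart_diff_left:
  assumes "b \<in> A" "d \<in> A" "p' \<in> dom_of b" "p \<otimes> p' \<in> dom_of d"
  shows "chart_diff b d (\<lambda>x. p \<otimes> x) p'"
  using chart_exists[of p] left_translation_coord(1) assms by metis

lemma chart_diff_right:
  assumes "a \<in> A" "d \<in> A" "p \<in> dom_of a" "p \<otimes> p' \<in> dom_of d"
  shows "chart_diff a d (\<lambda>x. x \<otimes> p') p"
  using chart_exists[of p'] right_translation_coord(1) assms by metis

end

section \<open>Logarithmic derivatives of curves\<close>

lemma has_vector_derivative_shift_0:
  "((\<lambda>h. f (t + h)) has_vector_derivative v) (at 0) \<longleftrightarrow> (f has_vector_derivative v) (at (t::real))"
proof
  assume "(f has_vector_derivative v) (at t)"
  then have "(f has_vector_derivative v) (at (t + 0))" by simp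
  moreover have "((\<lambda>h. t + h) has_vector_derivative 1) (at 0)" by (auto intro!: derivative_eq_intros)
  ultimately show "((\<lambda>h. f (t + h)) has_vector_derivative v) (at 0)"
    using vector_diff_chain_at[of "\<lambda>h. t + h" 1 0 f v] by (simp add: comp_def)
next
  assume "((\<lambda>h. f (t + h)) has_vector_derivative v) (at 0)"
  then have "((\<lambda>h. f (t + h)) has_vector_derivative v) (at (- t + t))" by simp
  moreover have "((\<lambda>h. - t + h) has_vector_derivative 1) (at t)" by (auto intro!: derivative_eq_intros)
  ultimately show "(f has_vector_derivative v) (at t)"
    using vector_diff_chain_at[of "\<lambda>h. - t + h" 1 t "\<lambda>h. f (t + h)" v] by (simp add: comp_def)
qed

lemma isCont_shift_0:
  fixes f :: "real \<Rightarrow> 'b::t2_space"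
  shows "isCont (\<lambda>h. f (t + h)) 0 \<longleftrightarrow> isCont f t"
proof
  assume "isCont f t"
  then show "isCont (\<lambda>h. f (t + h)) 0"
    using isCont_o2[of 0 "\<lambda>h. t + h" f] by simp
next
  assume "isCont (\<lambda>h. f (t + h)) 0"
  then show "isCont f t"
    using isCont_o2[of t "\<lambda>h. - t + h" "\<lambda>h. f (t + h)"] by simp
qed

lemma left_translation_eq: "left_translation G p = (\<lambda>x. p \<otimes>\<^bsub>G\<^esub> x)"
  by (simp add: fun_eq_iff left_translation_def)

locale lie_group_chart = lie_group G A
  for G :: "'g::{t2_space, second_countable_topology} monoid" (structure)
    and A :: "('g, 'a::euclidean_space) chart set" +
  fixes c :: "('g, 'a) chart"
  assumes c: "c \<in> A" and one_c: "\<one> \<in> dom_of c"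
begin

abbreviation "Exp \<equiv> lie_exp G c"
abbreviation "br \<equiv> lie_bracket G c"

lemma chart_c: "is_chart c" by (rule chart[OF c])

text \<open>The left-invariant field seen in an arbitrary chart \<open>d\<close>, while its label
  \<open>X\<close> is always a tangent vector at the identity in the coordinates \<open>c\<close>.
  The curves considered may leave the domain of \<open>c\<close>.\<close>

definition lfield :: "('g, 'a) chart \<Rightarrow> 'a \<Rightarrow> 'a \<Rightarrow> 'a" where
  "lfield d X q = tangent_map c d (\<lambda>x. icoord d q \<otimes> x) \<one> X"

lemma left_invariant_field_eq: "left_invariant_field G c = lfield c"
  by (simp add: fun_eq_iff left_invariant_field_def lfield_def left_translation_eq)

lemma chart_diff_left_one:
  assumes "d \<in> A" "p \<in> dom_of d" shows "chart_diff c d (\<lambda>x. p \<otimes> x) \<one>"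
  using assms c one_c by (intro chart_diff_left) auto

lemma lfield_eq_mult_coord:
  assumes "d \<in> A" "q \<in> coord d ` dom_of d"
  shows "lfield d X q = frechet_derivative (mult_coord d c d) (at (q, coord c \<one>)) (0, X)"
  using left_translation_coord(2)[of d c d "icoord d q" \<one>] assms is_chartD(4,5)[OF chart, of d q] c one_c
  by (simp add: lfield_def)

text \<open>In coordinates the field is a directional derivative of the smooth map
  \<open>mult_coord\<close>, restricted to the slice where the second factor is the
  identity.\<close>

lemma smooth_lfield:
  assumes "d \<in> A" shows "smooth_on (coord d ` dom_of d) (lfield d X)"
proof -
  let ?S = "{q. (0, coord c \<one>) + (q, 0) \<in> mult_dom d c d}"
  have "linear (\<lambda>q::'a. (q, 0::'a))" by (auto intro!: linearI)
  then have "smooth_on ?S (\<lambda>q. frechet_derivative (mult_coord d c d) (at ((0, coord c \<one>) + (q, 0))) (0, X))"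
    using assms c by (intro smooth_on_affine[where a="(0, coord c \<one>)" and l="\<lambda>q. (q, 0)"] open_mult_dom smooth_on_frechet_derivative smooth_mult_coord)
  then have "smooth_on (coord d ` dom_of d) (\<lambda>q. frechet_derivative (mult_coord d c d) (at ((0, coord c \<one>) + (q, 0))) (0, X))"
    by (rule smooth_on_subset) (use mult_dom_iff(1)[OF assms c _ one_c, where d=d] in auto)
  then show ?thesis
    by (rule smooth_on_cong[rotated 2]) (use assms is_chartD(2)[OF chart] lfield_eq_mult_coord in auto)
qed

lemma linear_lfield:
  assumes "d \<in> A" "q \<in> coord d ` dom_of d" shows "linear (\<lambda>X. lfield d X q)"
  unfolding lfield_def
  by (intro linear_tangent_map chart_diff_left_one is_chartD(4)[OF chart] assms)

lemma lfield_one: "lfield c X (coord c \<one>) = X"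
  using tangent_map_id(2)[OF chart_c one_c, of "\<lambda>x. \<one> \<otimes> x"] is_chartD(3)[OF chart_c one_c] by (simp add: lfield_def)

text \<open>Translating by \<open>x\<close> and then by \<open>p\<close> is translating by
  \<open>p \<otimes> x\<close>; the chain rule turns this into invariance of the field.\<close>

lemma lfield_left_translation:
  assumes "a \<in> A" "d \<in> A" "x \<in> dom_of a" "p \<otimes> x \<in> dom_of d"
  shows "lfield d X (coord d (p \<otimes> x)) = tangent_map a d (\<lambda>y. p \<otimes> y) x (lfield a X (coord a x))"
proof -
  have "tangent_map c d ((\<lambda>y. p \<otimes> y) \<circ> (\<lambda>y. x \<otimes> y)) \<one> = tangent_map a d (\<lambda>y. p \<otimes> y) (x \<otimes> \<one>) \<circ> tangent_map c a (\<lambda>y. x \<otimes> y) \<one>"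
    using assms by (intro chart_diff_compose chart_c chart chart_diff_left_one) (auto intro!: chart_diff_left)
  moreover have "(\<lambda>y. p \<otimes> y) \<circ> (\<lambda>y. x \<otimes> y) = (\<lambda>y. (p \<otimes> x) \<otimes> y)" by (auto simp: fun_eq_iff m_assoc)
  ultimately show ?thesis
    using assms is_chartD(3)[OF chart] by (simp add: lfield_def)
qed

definition curve_deriv :: "(real \<Rightarrow> 'g) \<Rightarrow> 'a \<Rightarrow> bool" where
  "curve_deriv \<eta> X \<longleftrightarrow> \<eta> 0 = \<one> \<and> isCont \<eta> 0 \<and> ((coord c \<circ> \<eta>) has_vector_derivative X) (at 0)"

text \<open>The point is moved back to the identity before differentiating, so the value never
  depends on a chart around \<open>\<eta> t\<close>.\<close>

definition log_deriv :: "(real \<Rightarrow> 'g) \<Rightarrow> real \<Rightarrow> 'a \<Rightarrow> bool" where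
  "log_deriv \<eta> t X \<longleftrightarrow> curve_deriv (\<lambda>h. inv (\<eta> t) \<otimes> \<eta> (t + h)) X"

lemma curve_deriv_unique: "curve_deriv \<eta> X \<Longrightarrow> curve_deriv \<eta> Y \<Longrightarrow> X = Y"
  unfolding curve_deriv_def using vector_derivative_unique_at by blast

lemma curve_deriv_const: "curve_deriv (\<lambda>h. \<one>) 0"
  by (simp add: curve_deriv_def comp_def)

lemma curve_deriv_map:
  assumes "chart_diff c c f \<one>" "f \<one> = \<one>" "curve_deriv \<eta> X"
  shows "curve_deriv (\<lambda>h. f (\<eta> h)) (tangent_map c c f \<one> X)"
  using assms chart_diff_curve[OF chart_c chart_c, of f \<eta> 0 X] isCont_o2[of 0 \<eta> f]
  by (auto simp: curve_deriv_def chart_diff_def comp_def)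

text \<open>The differential of multiplication at the pair of identities is addition, because
  multiplying by the identity on either side is the identity map.\<close>

lemma curve_deriv_mult:
  assumes "curve_deriv \<eta> X" "curve_deriv \<xi> Y"
  shows "curve_deriv (\<lambda>h. \<eta> h \<otimes> \<xi> h) (X + Y)"
proof -
  note h = assms[unfolded curve_deriv_def]
  let ?D = "frechet_derivative (mult_coord c c c) (at (coord c \<one>, coord c \<one>))"
  have M: "(mult_coord c c c has_derivative ?D) (at (coord c \<one>, coord c \<one>))"
    using c one_c by (intro mult_coord_deriv) auto
  have "?D (X, 0) = X"
    using right_translation_coord(2)[of c c c \<one> \<one>] tangent_map_id(2)[OF chart_c one_c, of "\<lambda>x. x \<otimes> \<one>"] c one_c by (metis closed id_apply one_closed r_one)
  moreover have "?D (0, Y) = Y"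
    using left_translation_coord(2)[of c c c \<one> \<one>] tangent_map_id(2)[OF chart_c one_c, of "\<lambda>x. \<one> \<otimes> x"] c one_c by (metis closed id_apply one_closed l_one)
  ultimately have XY: "?D (h *\<^sub>R X, h *\<^sub>R Y) = h *\<^sub>R (X + Y)" for h
    using linear_add[OF has_derivative_linear[OF M], of "(X, 0)" "(0, Y)"] linear_scale[OF has_derivative_linear[OF M], of h "(X, Y)"]
    by simp
  have "((\<lambda>s. mult_coord c c c ((coord c \<circ> \<eta>) s, (coord c \<circ> \<xi>) s)) has_derivative (\<lambda>h. ?D (h *\<^sub>R X, h *\<^sub>R Y))) (at 0)"
    by (rule has_derivative_compose[where f="\<lambda>s. ((coord c \<circ> \<eta>) s, (coord c \<circ> \<xi>) s)" and g="mult_coord c c c", OF has_derivative_Pair])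
      (use h M in \<open>auto simp: has_vector_derivative_def comp_def\<close>)
  moreover have "eventually (\<lambda>s. mult_coord c c c ((coord c \<circ> \<eta>) s, (coord c \<circ> \<xi>) s) = (coord c \<circ> (\<lambda>h. \<eta> h \<otimes> \<xi> h)) s) (nhds 0)"
  proof -
    have "eventually (\<lambda>s. \<eta> s \<in> dom_of c) (nhds 0)" "eventually (\<lambda>s. \<xi> s \<in> dom_of c) (nhds 0)"
      using h one_c is_chartD(1)[OF chart_c] by (auto intro: isCont_eventually_mem)
    then show ?thesis by eventually_elim (use mult_dom_iff(2)[OF c c] in auto)
  qed
  ultimately have "((coord c \<circ> (\<lambda>h. \<eta> h \<otimes> \<xi> h)) has_derivative (\<lambda>h. ?D (h *\<^sub>R X, h *\<^sub>R Y))) (at 0)"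
    by (rule has_derivative_eventually_nhds)
  then show ?thesis using h isCont_group_mult[of 0 \<eta> \<xi>] XY by (simp add: curve_deriv_def has_vector_derivative_def)
qed

text \<open>Inversion is differentiable at the identity; its differential is then forced by
  differentiating the constant product of \<open>\<eta>\<close> and its inverse.\<close>

lemma curve_deriv_inv:
  assumes "curve_deriv \<eta> X" shows "curve_deriv (\<lambda>h. inv (\<eta> h)) (- X)"
proof -
  have "smooth_on (coord c ` (dom_of c \<inter> (\<lambda>p. inv p) -` dom_of c)) (coord c \<circ> (\<lambda>p. inv p) \<circ> icoord c)"
    using smooth_inverse c unfolding smooth_map_def by blast
  then have "chart_diff c c (\<lambda>p. inv p) \<one>"
    using smooth_on_differentiable one_c isCont_group_inv[of \<one> "\<lambda>x. x"] by (fastforce simp: chart_diff_def)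
  from curve_deriv_map[OF this _ assms]
  have 1: "curve_deriv (\<lambda>h. inv (\<eta> h)) (tangent_map c c (\<lambda>p. inv p) \<one> X)" by simp
  from curve_deriv_mult[OF assms this] have "curve_deriv (\<lambda>h. \<one>) (X + tangent_map c c (\<lambda>p. inv p) \<one> X)"
    by simp
  from curve_deriv_unique[OF this curve_deriv_const] have "tangent_map c c (\<lambda>p. inv p) \<one> X = - X"
    by (simp add: eq_neg_iff_add_eq_0 add.commute)
  with 1 show ?thesis by simp
qed

definition Ad :: "'g \<Rightarrow> 'a \<Rightarrow> 'a" where "Ad p X = tangent_map c c (\<lambda>x. p \<otimes> x \<otimes> inv p) \<one> X"

text \<open>Conjugation passes from the identity through \<open>p\<close> and back, so it is split
  into a left and a right translation that meet in a chart \<open>d\<close> around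
  \<open>p\<close>.\<close>

lemma chart_diff_conj:
  assumes "d \<in> A" "p \<in> dom_of d"
  shows "chart_diff c c (\<lambda>x. p \<otimes> x \<otimes> inv p) \<one>"
    "Ad p X = tangent_map d c (\<lambda>x. x \<otimes> inv p) p (tangent_map c d (\<lambda>x. p \<otimes> x) \<one> X)"
proof -
  have *: "(\<lambda>x. p \<otimes> x \<otimes> inv p) = (\<lambda>x. x \<otimes> inv p) \<circ> (\<lambda>x. p \<otimes> x)" by auto
  have 1: "chart_diff d c (\<lambda>x. x \<otimes> inv p) (p \<otimes> \<one>)"
    using assms c one_c by (intro chart_diff_right) auto
  note 2 = chart_diff_compose[OF chart_c chart[OF assms(1)] chart_diff_left_one[OF assms] 1]
  show "chart_diff c c (\<lambda>x. p \<otimes> x \<otimes> inv p) \<one>" unfolding * by (rule 2)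
  show "Ad p X = tangent_map d c (\<lambda>x. x \<otimes> inv p) p (tangent_map c d (\<lambda>x. p \<otimes> x) \<one> X)"
    unfolding Ad_def * 2(2) by simp
qed

lemma chart_diff_conj': "chart_diff c c (\<lambda>x. p \<otimes> x \<otimes> inv p) \<one>"
  using chart_exists chart_diff_conj(1) by metis

lemma linear_Ad: "linear (Ad p)"
  unfolding Ad_def using linear_tangent_map[OF chart_diff_conj'] by (simp add: Ad_def[abs_def])

lemma Ad_mult: "Ad (p \<otimes> q) X = Ad p (Ad q X)"
proof -
  have "(\<lambda>x. (p \<otimes> q) \<otimes> x \<otimes> inv (p \<otimes> q)) = (\<lambda>x. p \<otimes> x \<otimes> inv p) \<circ> (\<lambda>x. q \<otimes> x \<otimes> inv q)"
    by (auto simp: fun_eq_iff inv_mult_group m_assoc)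
  moreover have "chart_diff c c (\<lambda>x. p \<otimes> x \<otimes> inv p) (q \<otimes> \<one> \<otimes> inv q)" using chart_diff_conj' by simp
  ultimately have "tangent_map c c (\<lambda>x. (p \<otimes> q) \<otimes> x \<otimes> inv (p \<otimes> q)) \<one>
      = tangent_map c c (\<lambda>x. p \<otimes> x \<otimes> inv p) (q \<otimes> \<one> \<otimes> inv q) \<circ> tangent_map c c (\<lambda>x. q \<otimes> x \<otimes> inv q) \<one>"
    using chart_diff_compose(2)[OF chart_c chart_c chart_diff_conj'[of q]] by metis
  then show ?thesis by (simp add: Ad_def)
qed

lemma Ad_one: "Ad \<one> X = X"
  using tangent_map_id(2)[OF chart_c one_c, of "\<lambda>x. \<one> \<otimes> x \<otimes> inv \<one>"] by (simp add: Ad_def)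

lemma curve_deriv_conj:
  "curve_deriv \<eta> X \<Longrightarrow> curve_deriv (\<lambda>h. p \<otimes> \<eta> h \<otimes> inv p) (Ad p X)"
  using curve_deriv_map[OF chart_diff_conj'] by (simp add: Ad_def)

lemma log_deriv_isCont: "log_deriv \<eta> t X \<Longrightarrow> isCont \<eta> t"
proof -
  assume "log_deriv \<eta> t X"
  then have "isCont (\<lambda>h. inv (\<eta> t) \<otimes> \<eta> (t + h)) 0" by (simp add: log_deriv_def curve_deriv_def)
  then have "isCont (\<lambda>h. \<eta> t \<otimes> (inv (\<eta> t) \<otimes> \<eta> (t + h))) 0"
    using isCont_group_mult[of 0 "\<lambda>h. \<eta> t"] by simp
  then show ?thesis using isCont_shift_0[of \<eta> t] by (simp add: m_assoc[symmetric])
qed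

lemma log_deriv_of_chart:
  assumes "d \<in> A" "\<eta> t \<in> dom_of d" "isCont \<eta> t" "((coord d \<circ> \<eta>) has_vector_derivative v) (at t)"
  shows "log_deriv \<eta> t (tangent_map d c (\<lambda>x. inv (\<eta> t) \<otimes> x) (\<eta> t) v)"
proof -
  have "chart_diff d c (\<lambda>x. inv (\<eta> t) \<otimes> x) (\<eta> t)" using assms c one_c by (intro chart_diff_left) auto
  from chart_diff_curve[OF chart_c chart[OF assms(1)] this assms(3,4)]
  have "((\<lambda>s. coord c (inv (\<eta> t) \<otimes> \<eta> s)) has_vector_derivative tangent_map d c (\<lambda>x. inv (\<eta> t) \<otimes> x) (\<eta> t) v) (at t)"
    by (simp add: comp_def)
  moreover have "isCont (\<lambda>s. inv (\<eta> t) \<otimes> \<eta> s) t" using isCont_group_mult[of t "\<lambda>s. inv (\<eta> t)" \<eta>] assms(3) by simp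
  ultimately show ?thesis
    using has_vector_derivative_shift_0[of "\<lambda>s. coord c (inv (\<eta> t) \<otimes> \<eta> s)" t] isCont_shift_0[of "\<lambda>s. inv (\<eta> t) \<otimes> \<eta> s" t]
    by (simp add: log_deriv_def curve_deriv_def comp_def)
qed

text \<open>The bridge between group and coordinates: a curve with logarithmic derivative
  \<open>X\<close> is one that follows the left-invariant field of \<open>X\<close>, in whichever
  chart it is observed.\<close>

lemma log_deriv_iff_chart:
  assumes d: "d \<in> A" "\<eta> t \<in> dom_of d"
  shows "log_deriv \<eta> t X \<longleftrightarrow> isCont \<eta> t \<and> ((coord d \<circ> \<eta>) has_vector_derivative lfield d X (coord d (\<eta> t))) (at t)"
proof
  assume l: "log_deriv \<eta> t X"
  have "((coord d \<circ> ((\<lambda>x. \<eta> t \<otimes> x) \<circ> (\<lambda>h. inv (\<eta> t) \<otimes> \<eta> (t + h)))) has_vector_derivative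
      tangent_map c d (\<lambda>x. \<eta> t \<otimes> x) (inv (\<eta> t) \<otimes> \<eta> (t + 0)) X) (at 0)"
    using l d chart_diff_left_one by (intro chart_diff_curve chart chart_c) (auto simp: log_deriv_def curve_deriv_def)
  moreover have "coord d \<circ> ((\<lambda>x. \<eta> t \<otimes> x) \<circ> (\<lambda>h. inv (\<eta> t) \<otimes> \<eta> (t + h))) = (\<lambda>h. (coord d \<circ> \<eta>) (t + h))"
    by (auto simp: fun_eq_iff m_assoc[symmetric])
  ultimately have "((\<lambda>h. (coord d \<circ> \<eta>) (t + h)) has_vector_derivative lfield d X (coord d (\<eta> t))) (at 0)"
    using d is_chartD(3)[OF chart] by (simp add: lfield_def)
  then show "isCont \<eta> t \<and> ((coord d \<circ> \<eta>) has_vector_derivative lfield d X (coord d (\<eta> t))) (at t)"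
    using log_deriv_isCont[OF l] has_vector_derivative_shift_0 by blast
next
  assume *: "isCont \<eta> t \<and> ((coord d \<circ> \<eta>) has_vector_derivative lfield d X (coord d (\<eta> t))) (at t)"
  moreover have "tangent_map d c (\<lambda>x. inv (\<eta> t) \<otimes> x) (\<eta> t) (lfield d X (coord d (\<eta> t))) = X"
    using lfield_left_translation[OF d(1) c d(2), of "inv (\<eta> t)" X] one_c lfield_one by simp
  ultimately show "log_deriv \<eta> t X" using log_deriv_of_chart[of d \<eta> t, OF d, of "lfield d X (coord d (\<eta> t))"] by simp
qed

text \<open>The increment of the quotient is the increment of \<open>\<eta>\<close> times the
  inverse increment of \<open>\<xi>\<close>, conjugated by \<open>\<xi> t\<close>. Its derivative is
  therefore \<open>Ad (\<xi> t)\<close> of \<open>X - X\<close>.\<close>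

lemma log_deriv_div:
  assumes "log_deriv \<eta> t X" "log_deriv \<xi> t X"
  shows "log_deriv (\<lambda>s. \<eta> s \<otimes> inv (\<xi> s)) t 0"
proof -
  have "curve_deriv (\<lambda>h. \<xi> t \<otimes> ((inv (\<eta> t) \<otimes> \<eta> (t + h)) \<otimes> inv (inv (\<xi> t) \<otimes> \<xi> (t + h))) \<otimes> inv (\<xi> t)) (Ad (\<xi> t) (X + - X))"
    using assms unfolding log_deriv_def by (intro curve_deriv_conj curve_deriv_mult curve_deriv_inv)
  moreover have "\<xi> t \<otimes> ((inv (\<eta> t) \<otimes> \<eta> (t + h)) \<otimes> inv (inv (\<xi> t) \<otimes> \<xi> (t + h))) \<otimes> inv (\<xi> t)
      = inv (\<eta> t \<otimes> inv (\<xi> t)) \<otimes> (\<eta> (t + h) \<otimes> inv (\<xi> (t + h)))" for h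
    by (simp add: inv_mult_group m_assoc)
  ultimately show ?thesis by (simp add: log_deriv_def linear_0[OF linear_Ad])
qed

text \<open>Within one chart domain the coordinates have zero derivative, so the curve is locally
  constant; connectedness of \<open>T\<close> does the rest.\<close>

lemma log_deriv_zero_constant:
  assumes T: "open T" "connected T" "s \<in> T" "t \<in> T" and 0: "\<And>t. t \<in> T \<Longrightarrow> log_deriv \<epsilon> t 0"
  shows "\<epsilon> s = \<epsilon> t"
proof (rule connected_local_const[OF T(2-4)])
  show "\<forall>a\<in>T. \<forall>\<^sub>F b in at a within T. \<epsilon> a = \<epsilon> b"
  proof
    fix a assume a: "a \<in> T"
    obtain d where d: "d \<in> A" "\<epsilon> a \<in> dom_of d" using chart_exists .
    have "eventually (\<lambda>s. \<epsilon> s \<in> dom_of d) (nhds a)"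
      using isCont_eventually_mem[OF log_deriv_isCont[OF 0[OF a]] is_chartD(1)[OF chart[OF d(1)]] d(2)] .
    then obtain S where S: "open S" "a \<in> S" "\<forall>s\<in>S. \<epsilon> s \<in> dom_of d" unfolding eventually_nhds by blast
    obtain r where r: "r > 0" "ball a r \<subseteq> S \<inter> T" using S T(1) a open_Int[of S T] openE[of "S \<inter> T" a] by blast
    have "\<epsilon> a = \<epsilon> b" if b: "b \<in> ball a r" for b
    proof -
      have "(coord d \<circ> \<epsilon>) a = (coord d \<circ> \<epsilon>) b"
      proof (rule has_vector_derivative_zero_imp_eq[of "ball a r"])
        fix x assume x: "x \<in> ball a r"
        then have xd: "\<epsilon> x \<in> dom_of d" "x \<in> T" using S r by auto
        have "((coord d \<circ> \<epsilon>) has_vector_derivative lfield d 0 (coord d (\<epsilon> x))) (at x)"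
          using 0[OF xd(2)] log_deriv_iff_chart[of d \<epsilon> x, OF d(1) xd(1)] by blast
        moreover have "lfield d 0 (coord d (\<epsilon> x)) = 0"
          using linear_0[OF linear_lfield[OF d(1), of "coord d (\<epsilon> x)"]] xd by auto
        ultimately show "((coord d \<circ> \<epsilon>) has_vector_derivative 0) (at x)" by simp
      qed (use b r in auto)
      then have "coord d (\<epsilon> a) = coord d (\<epsilon> b)" by simp
      moreover have "\<epsilon> b \<in> dom_of d" using S r b by auto
      ultimately show ?thesis using is_chartD(3)[OF chart[OF d(1)]] d(2) by metis
    qed
    then show "\<forall>\<^sub>F b in at a within T. \<epsilon> a = \<epsilon> b"
      unfolding eventually_at using r(1) by (intro exI[of _ r]) (auto simp: dist_commute)
  qed
qed

lemma log_deriv_eq_imp_eq: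
  assumes T: "open T" "connected T" "s \<in> T" "t \<in> T"
    and \<eta>: "\<And>t. t \<in> T \<Longrightarrow> log_deriv \<eta> t (w t)" and \<xi>: "\<And>t. t \<in> T \<Longrightarrow> log_deriv \<xi> t (w t)"
    and eq: "\<eta> s = \<xi> s"
  shows "\<eta> t = \<xi> t"
proof -
  have "\<eta> s \<otimes> inv (\<xi> s) = \<eta> t \<otimes> inv (\<xi> t)"
    by (rule log_deriv_zero_constant[OF T, where \<epsilon>="\<lambda>s. \<eta> s \<otimes> inv (\<xi> s)"]) (rule log_deriv_div[OF \<eta> \<xi>])
  then show ?thesis using eq by (metis closed inv_closed inv_equality inv_inv r_inv)
qed

section \<open>One-parameter subgroups and the values of \<open>lie_exp\<close>\<close>

lemma one_parameter_subgroup_zero: "one_parameter_subgroup G c X \<sigma> \<Longrightarrow> \<sigma> 0 = \<one>"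
  unfolding one_parameter_subgroup_def using l_cancel_one[of "\<sigma> 0" "\<sigma> 0"] by (metis add_0 closed)

lemma one_parameter_subgroup_curve_deriv: "one_parameter_subgroup G c X \<sigma> \<Longrightarrow> curve_deriv \<sigma> X"
  using one_parameter_subgroup_zero unfolding one_parameter_subgroup_def curve_deriv_def
  by (auto simp: continuous_on_eq_continuous_at)

lemma one_parameter_subgroup_log_deriv:
  assumes "one_parameter_subgroup G c X \<sigma>" shows "log_deriv \<sigma> t X"
proof -
  have "inv (\<sigma> t) \<otimes> \<sigma> (t + h) = \<sigma> h" for h
    using assms unfolding one_parameter_subgroup_def by (simp add: m_assoc[symmetric])
  then show ?thesis using one_parameter_subgroup_curve_deriv[OF assms] by (simp add: log_deriv_def)
qed

lemma one_parameter_subgroup_unique: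
  assumes "one_parameter_subgroup G c X \<sigma>" "one_parameter_subgroup G c X \<tau>"
  shows "\<sigma> t = \<tau> t"
  by (rule log_deriv_eq_imp_eq[of UNIV 0 t \<sigma> "\<lambda>_. X"])
     (use assms in \<open>auto simp: one_parameter_subgroup_zero one_parameter_subgroup_log_deriv\<close>)

lemma lie_exp_eq: "one_parameter_subgroup G c X \<sigma> \<Longrightarrow> Exp X = \<sigma> 1"
  unfolding lie_exp_def by (rule the_equality) (auto dest: one_parameter_subgroup_unique)

lemma one_parameter_subgroup_scale:
  assumes "one_parameter_subgroup G c X \<sigma>"
  shows "one_parameter_subgroup G c (r *\<^sub>R X) (\<lambda>t. \<sigma> (r * t))"
proof -
  note h = assms[unfolded one_parameter_subgroup_def]
  have "((\<lambda>t. r * t) has_vector_derivative r) (at 0)" by (auto intro!: derivative_eq_intros)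
  moreover have "((coord c \<circ> \<sigma>) has_vector_derivative X) (at (r * 0))" using h by simp
  ultimately have "((coord c \<circ> (\<lambda>t. \<sigma> (r * t))) has_vector_derivative r *\<^sub>R X) (at 0)"
    using vector_diff_chain_at[of "\<lambda>t. r * t" r 0 "coord c \<circ> \<sigma>" X] by (simp add: comp_def)
  moreover have "continuous_on UNIV (\<lambda>t. \<sigma> (r * t))"
    by (rule continuous_on_compose2[of UNIV \<sigma>]) (use h in \<open>auto intro!: continuous_on_mult_left continuous_on_id\<close>)
  ultimately show ?thesis using h by (simp add: one_parameter_subgroup_def distrib_left)
qed

lemma lie_exp_scale: "one_parameter_subgroup G c X \<sigma> \<Longrightarrow> Exp (r *\<^sub>R X) = \<sigma> r"
  using lie_exp_eq[OF one_parameter_subgroup_scale] by simp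

end

section \<open>The exponential map\<close>

context lie_group_chart
begin

lemma local_one_parameter_subgroup:
  obtains \<rho> C \<sigma> where "0 < \<rho>"
    "\<And>X. norm X < \<rho> \<Longrightarrow> \<sigma> X 0 = \<one>"
    "\<And>X t. norm X < \<rho> \<Longrightarrow> \<bar>t\<bar> < 1 \<Longrightarrow> log_deriv (\<sigma> X) t X"
    "\<And>X t. norm X < \<rho> \<Longrightarrow> \<bar>t\<bar> < 1 \<Longrightarrow> \<sigma> X t \<in> dom_of c"
    "\<And>X t. norm X < \<rho> \<Longrightarrow> \<bar>t\<bar> < 1 \<Longrightarrow> norm (coord c (\<sigma> X t) - coord c \<one> - t *\<^sub>R X) \<le> C * (norm X)\<^sup>2"
proof -
  let ?S = "coord c ` dom_of c"
  have oS: "open ?S" "coord c \<one> \<in> ?S" using is_chartD(2)[OF chart_c] one_c by auto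
  obtain \<rho> C q where q: "0 < \<rho>" "\<And>X. q X 0 = coord c \<one>"
    "\<And>X t. norm X < \<rho> \<Longrightarrow> t \<in> {-1..1} \<Longrightarrow> q X t \<in> ?S"
    "\<And>X t. norm X < \<rho> \<Longrightarrow> t \<in> {-1..1} \<Longrightarrow> (q X has_vector_derivative lfield c X (q X t)) (at t within {-1..1})"
    "\<And>X t. norm X < \<rho> \<Longrightarrow> t \<in> {-1..1} \<Longrightarrow> norm (q X t - coord c \<one> - t *\<^sub>R X) \<le> C * (norm X)\<^sup>2"
    by (rule linear_family_flow[OF oS smooth_lfield[OF c] linear_lfield[OF c] lfield_one]) (assumption, rule that)
  define \<sigma> where "\<sigma> X t = icoord c (q X t)" for X t
  have mem: "\<sigma> X t \<in> dom_of c" and coord: "coord c (\<sigma> X t) = q X t" if "norm X < \<rho>" "\<bar>t\<bar> < 1" for X t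
    using q(3)[OF that(1), of t] that(2) is_chartD(4,5)[OF chart_c] by (auto simp: \<sigma>_def abs_less_iff)
  have log: "log_deriv (\<sigma> X) t X" if X: "norm X < \<rho>" and t: "\<bar>t\<bar> < 1" for X t
  proof -
    have t': "t \<in> {-1<..<1}" using t by auto
    have D: "(q X has_vector_derivative lfield c X (q X t)) (at t)"
      using has_vector_derivative_within_subset[OF q(4)[OF X], of t "{-1<..<1}"] t' at_within_open[OF t'] by force
    have "isCont (q X) t" using has_vector_derivative_continuous[OF D] by simp
    then have "isCont (\<sigma> X) t"
      using isCont_o2[of t "q X" "icoord c"] is_chartD(9)[OF chart_c] q(3)[OF X, of t] t' by (simp add: \<sigma>_def[abs_def])
    moreover have "((coord c \<circ> \<sigma> X) has_vector_derivative lfield c X (q X t)) (at t)"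
      by (rule has_vector_derivative_transform_within_open[OF D _ t']) (auto simp: coord X)
    ultimately show ?thesis using log_deriv_iff_chart[where \<eta>="\<sigma> X" and t=t, OF c mem[OF X t]] coord[OF X t] by simp
  qed
  show ?thesis
  proof (rule that[of \<rho> \<sigma> C])
    show "\<sigma> X 0 = \<one>" for X using is_chartD(3)[OF chart_c one_c] by (simp add: \<sigma>_def q(2))
    show "norm (coord c (\<sigma> X t) - coord c \<one> - t *\<^sub>R X) \<le> C * (norm X)\<^sup>2" if "norm X < \<rho>" "\<bar>t\<bar> < 1" for X t
      using q(5)[OF that(1), of t] that by (simp add: coord abs_less_iff)
  qed (use q(1) mem log in auto)
qed

text \<open>A constant logarithmic derivative makes \<open>\<sigma>\<close> additive wherever this
  makes sense, since uniqueness identifies \<open>\<sigma> (s + t)\<close> with the translate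
  \<open>\<sigma> s \<otimes> \<sigma> t\<close>. A local homomorphism of the line then extends by
  powers of its values at small times.\<close>

lemma one_parameter_subgroup_extend:
  assumes \<sigma>0: "\<sigma> 0 = \<one>" and \<sigma>: "\<And>t. \<bar>t\<bar> < 1 \<Longrightarrow> log_deriv \<sigma> t X"
  obtains \<tau> where "one_parameter_subgroup G c X \<tau>" "\<And>t. \<bar>t\<bar> < 1 \<Longrightarrow> \<tau> t = \<sigma> t"
proof -
  have add: "\<sigma> (s + t) = \<sigma> s \<otimes> \<sigma> t" if "\<bar>s\<bar> < 1" "\<bar>t\<bar> < 1" "\<bar>s + t\<bar> < 1" for s t
  proof -
    \<comment> \<open>The times \<open>r\<close> for which both \<open>r\<close> and
      \<open>s + r\<close> stay in the open unit interval around 0; an intersection of intervals,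
      hence connected.\<close>
    let ?T = "{-1<..<1} \<inter> {-1-s<..<1-s}"
    have T: "open ?T" "connected ?T" by (auto simp: Int_greaterThanLessThan)
    have "log_deriv (\<lambda>t. \<sigma> s \<otimes> \<sigma> t) r X" if "r \<in> ?T" for r
    proof -
      have "inv (\<sigma> s \<otimes> \<sigma> r) \<otimes> (\<sigma> s \<otimes> \<sigma> (r + h)) = inv (\<sigma> r) \<otimes> \<sigma> (r + h)" for h
        by (simp add: inv_mult_group m_assoc) (simp add: m_assoc[symmetric])
      then show ?thesis using \<sigma>[of r] that by (simp add: log_deriv_def abs_less_iff)
    qed
    moreover have "log_deriv (\<lambda>t. \<sigma> (s + t)) r X" if "r \<in> ?T" for r
      using \<sigma>[of "s + r"] that by (simp add: log_deriv_def add.assoc abs_less_iff)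
    ultimately show ?thesis
      using log_deriv_eq_imp_eq[OF T, of 0 t "\<lambda>t. \<sigma> (s + t)" "\<lambda>_. X" "\<lambda>t. \<sigma> s \<otimes> \<sigma> t"] that \<sigma>0
      by (simp add: abs_less_iff)
  qed
  have mult: "\<sigma> (real n * s) = \<sigma> s [^] n" if "real n * \<bar>s\<bar> < 1" for n s
    using that
  proof (induction n)
    case 0
    then show ?case by (simp add: \<sigma>0)
  next
    case (Suc n)
    have "real n * \<bar>s\<bar> + \<bar>s\<bar> < 1" using Suc.prems by (simp add: algebra_simps)
    then have b: "real n * \<bar>s\<bar> < 1" "\<bar>s\<bar> < 1" using abs_ge_zero[of s] by (smt (verit) mult_nonneg_nonneg of_nat_0_le_iff)+
    have "\<bar>real n * s + s\<bar> \<le> real n * \<bar>s\<bar> + \<bar>s\<bar>" using abs_triangle_ineq[of "real n * s" s] by (simp add: abs_mult)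
    then have "\<sigma> (real n * s + s) = \<sigma> (real n * s) \<otimes> \<sigma> s"
      using b Suc.prems by (intro add) (auto simp: abs_mult algebra_simps)
    then show ?case using Suc.IH[OF b(1)] by (simp add: algebra_simps)
  qed
  \<comment> \<open>Two subdivisions into \<open>N\<close> and \<open>M\<close> parts are compared
    through the common refinement into \<open>N * M\<close> parts.\<close>
  have indep: "\<sigma> (t / real N) [^] N = \<sigma> (t / real M) [^] M" if "\<bar>t\<bar> < real N" "\<bar>t\<bar> < real M" for t N M
  proof -
    have *: "\<sigma> (t / real N) [^] N = \<sigma> (t / real (N * M)) [^] (M * N)" if NM: "\<bar>t\<bar> < real N" "\<bar>t\<bar> < real M" for N M
    proof -
      have pos: "real N > 0" "real M > 0" using NM by auto
      have "\<sigma> (real M * (t / real (N * M))) = \<sigma> (t / real (N * M)) [^] M"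
        using NM(1) pos by (intro mult) (auto simp: abs_mult divide_simps)
      moreover have "real M * (t / real (N * M)) = t / real N" using pos by auto
      ultimately show ?thesis by (simp add: nat_pow_pow)
    qed
    from *[OF that] *[OF that(2,1)] show ?thesis by (simp add: mult.commute)
  qed
  \<comment> \<open>The number of parts is one admissible choice, strictly larger than
    \<open>\<bar>t\<bar>\<close>. By \<open>indep\<close> it may be replaced by any other, so a
    single number can serve several times at once.\<close>
  define \<tau> where "\<tau> t = \<sigma> (t / real (Suc (nat \<lceil>\<bar>t\<bar>\<rceil>))) [^] Suc (nat \<lceil>\<bar>t\<bar>\<rceil>)" for t
  have ceil: "\<bar>t\<bar> < real (Suc (nat \<lceil>\<bar>t\<bar>\<rceil>))" for t :: real by linarith
  have \<tau>: "\<tau> t = \<sigma> (t / real N) [^] N" if "\<bar>t\<bar> < real N" for t N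
    unfolding \<tau>_def using that ceil by (rule indep[rotated])
  have \<tau>1: "\<tau> t = \<sigma> t" if "\<bar>t\<bar> < 1" for t
    using \<tau>[of t 1] that nat_pow_Suc[of "\<sigma> t" 0] by simp
  have hom: "\<tau> (s + t) = \<tau> s \<otimes> \<tau> t" for s t
  proof -
    obtain N :: nat where N: "\<bar>s\<bar> + \<bar>t\<bar> < real N" using reals_Archimedean2 by blast
    then have pos: "real N > 0" by linarith
    have small: "\<bar>s / real N\<bar> < 1" "\<bar>t / real N\<bar> < 1" "\<bar>s / real N + t / real N\<bar> < 1"
      using N pos abs_triangle_ineq[of s t] by (auto simp: field_simps abs_divide simp flip: add_divide_distrib)
    have "\<tau> (s + t) = \<sigma> ((s + t) / real N) [^] N" using N by (intro \<tau>) linarith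
    also have "(s + t) / real N = s / real N + t / real N" by (simp add: add_divide_distrib)
    also have "\<sigma> (s / real N + t / real N) = \<sigma> (s / real N) \<otimes> \<sigma> (t / real N)" using small by (intro add)
    also have "\<dots> [^] N = \<sigma> (s / real N) [^] N \<otimes> \<sigma> (t / real N) [^] N"
    proof (rule pow_mult_distrib)
      show "\<sigma> (s / real N) \<otimes> \<sigma> (t / real N) = \<sigma> (t / real N) \<otimes> \<sigma> (s / real N)"
        using small add[of "s / real N" "t / real N"] add[of "t / real N" "s / real N"] by (simp add: add.commute)
    qed auto
    also have "\<dots> = \<tau> s \<otimes> \<tau> t" using N \<tau>[of s N] \<tau>[of t N] by auto
    finally show ?thesis .
  qed
  have pow_cont: "isCont (\<lambda>x. f x [^] n) x" if "isCont f x" for f :: "real \<Rightarrow> 'g" and n :: nat and x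
    using that by (induction n) (auto intro: isCont_group_mult)
  have "isCont \<tau> t" for t
  proof -
    obtain N :: nat where N: "\<bar>t\<bar> < real N" using reals_Archimedean2 by blast
    then have "isCont \<sigma> (t / real N)" by (intro log_deriv_isCont[OF \<sigma>]) (auto simp: abs_divide)
    then have "isCont (\<lambda>t. \<sigma> (t / real N) [^] N) t" 
      using N by (intro pow_cont isCont_o2[of t "\<lambda>t. t / real N" \<sigma>]) (auto intro!: continuous_intros)
    moreover have "eventually (\<lambda>s. s \<in> {- real N<..<real N}) (nhds t)"
      using N by (intro eventually_nhds_in_open) (auto simp: abs_less_iff)
    then have "eventually (\<lambda>s. \<sigma> (s / real N) [^] N = \<tau> s) (nhds t)"
      by eventually_elim (rule \<tau>[symmetric], auto simp: abs_less_iff)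
    note isCont_cong[OF this]
    ultimately show ?thesis by blast
  qed
  moreover have "((coord c \<circ> \<tau>) has_vector_derivative X) (at 0)"
  proof (rule has_vector_derivative_transform_within_open[where S="{-1<..<1}"])
    show "((coord c \<circ> \<sigma>) has_vector_derivative X) (at 0)"
      using \<sigma>[of 0] log_deriv_iff_chart[OF c, of \<sigma> 0] one_c \<sigma>0 lfield_one by simp
  qed (auto simp: \<tau>1)
  ultimately have "one_parameter_subgroup G c X \<tau>"
    using hom by (simp add: one_parameter_subgroup_def continuous_on_eq_continuous_at)
  then show ?thesis using \<tau>1 that by blast
qed

lemma one_parameter_subgroup_exists: "one_parameter_subgroup G c X (\<lambda>t. Exp (t *\<^sub>R X))"
proof -
  obtain \<rho> C \<sigma> where \<sigma>: "0 < \<rho>"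
    "\<And>X. norm X < \<rho> \<Longrightarrow> \<sigma> X 0 = \<one>"
    "\<And>X t. norm X < \<rho> \<Longrightarrow> \<bar>t\<bar> < 1 \<Longrightarrow> log_deriv (\<sigma> X) t X"
    by (rule local_one_parameter_subgroup) blast
  \<comment> \<open>Shrinks \<open>X\<close> below the radius of the local solutions; the subgroup
    found for \<open>r *\<^sub>R X\<close> is afterwards run at speed \<open>1 / r\<close>.\<close>
  define r where "r = \<rho> / (norm X + 1)"
  have np: "norm X + 1 > 0" using norm_ge_zero[of X] by linarith
  then have r: "r > 0" using \<sigma>(1) by (auto simp: r_def)
  have "norm (r *\<^sub>R X) < \<rho>" using r np \<sigma>(1) by (auto simp: r_def field_simps)
  then obtain \<tau> where "one_parameter_subgroup G c (r *\<^sub>R X) \<tau>"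
    using one_parameter_subgroup_extend[of "\<sigma> (r *\<^sub>R X)"] \<sigma> by metis
  from one_parameter_subgroup_scale[OF this, of "1 / r"] r
  have 1: "one_parameter_subgroup G c X (\<lambda>t. \<tau> (1 / r * t))" by simp
  then show ?thesis using lie_exp_scale[OF 1] by simp
qed

lemma lie_exp_add_scale: "Exp ((s + t) *\<^sub>R X) = Exp (s *\<^sub>R X) \<otimes> Exp (t *\<^sub>R X)"
  using one_parameter_subgroup_exists[of X] by (simp add: one_parameter_subgroup_def)

lemma lie_exp_zero: "Exp 0 = \<one>"
  using one_parameter_subgroup_zero[OF one_parameter_subgroup_exists] by simp

lemma lie_exp_minus: "Exp (- X) = inv (Exp X)"
  using lie_exp_add_scale[of "-1" 1 X] by (simp add: lie_exp_zero inv_equality)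

text \<open>The quadratic error bound of the flow says directly that the coordinates of
  \<open>Exp X\<close> differ from those of the identity by \<open>X\<close> up to second
  order.\<close>

lemma lie_exp_derivative:
  shows "((\<lambda>X. coord c (Exp X)) has_derivative (\<lambda>X. X)) (at 0)"
    and "isCont Exp 0"
proof -
  obtain \<rho> C \<sigma> where \<sigma>: "0 < \<rho>"
    "\<And>X. norm X < \<rho> \<Longrightarrow> \<sigma> X 0 = \<one>"
    "\<And>X t. norm X < \<rho> \<Longrightarrow> \<bar>t\<bar> < 1 \<Longrightarrow> log_deriv (\<sigma> X) t X"
    "\<And>X t. norm X < \<rho> \<Longrightarrow> \<bar>t\<bar> < 1 \<Longrightarrow> \<sigma> X t \<in> dom_of c"
    "\<And>X t. norm X < \<rho> \<Longrightarrow> \<bar>t\<bar> < 1 \<Longrightarrow> norm (coord c (\<sigma> X t) - coord c \<one> - t *\<^sub>R X) \<le> C * (norm X)\<^sup>2"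
    using local_one_parameter_subgroup by metis
  \<comment> \<open>The local solution is controlled for times of modulus below 1 only, so the
    exponential is read off at time 1/2 along the doubled vector. This turns the constant
    \<open>C\<close> into \<open>4 * C\<close>.\<close>
  have eq: "Exp X = \<sigma> (2 *\<^sub>R X) (1/2)" if "norm X < \<rho> / 2" for X
  proof -
    have X: "norm (2 *\<^sub>R X) < \<rho>" using that by simp
    obtain \<tau> where \<tau>: "one_parameter_subgroup G c (2 *\<^sub>R X) \<tau>" "\<And>t. \<bar>t\<bar> < 1 \<Longrightarrow> \<tau> t = \<sigma> (2 *\<^sub>R X) t"
      by (rule one_parameter_subgroup_extend[of "\<sigma> (2 *\<^sub>R X)" "2 *\<^sub>R X", OF \<sigma>(2)[OF X] \<sigma>(3)[OF X]]) (assumption, rule that)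
    show ?thesis using lie_exp_scale[OF \<tau>(1), of "1/2"] \<tau>(2)[of "1/2"] by simp
  qed
  have mem: "Exp X \<in> dom_of c" if "norm X < \<rho> / 2" for X
    using eq[OF that] \<sigma>(4)[of "2 *\<^sub>R X" "1/2"] that by simp
  have est: "norm (coord c (Exp X) - coord c \<one> - X) \<le> 4 * C * (norm X)\<^sup>2" if "norm X < \<rho> / 2" for X
    using eq[OF that] \<sigma>(5)[of "2 *\<^sub>R X" "1/2"] that by (simp add: power_mult_distrib mult_ac)
  show D: "((\<lambda>X. coord c (Exp X)) has_derivative (\<lambda>X. X)) (at 0)"
    unfolding has_derivative_at_alt
  proof (intro conjI allI impI)
    fix e :: real assume e: "0 < e"
    define d where "d = min (\<rho> / 2) (e / (4 * \<bar>C\<bar> + 1))"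
    have d: "d > 0" using e \<sigma>(1) by (simp add: d_def)
    have "norm (coord c (Exp y) - coord c (Exp 0) - (y - 0)) \<le> e * norm (y - 0)" if "norm (y - 0) < d" for y
    proof -
      have y: "norm y < \<rho> / 2" "norm y * (4 * \<bar>C\<bar> + 1) \<le> e" using that by (auto simp: d_def field_simps)
      have "4 * C * (norm y)\<^sup>2 \<le> (4 * \<bar>C\<bar> + 1) * norm y * norm y"
        unfolding power2_eq_square mult.assoc[symmetric] by (intro mult_right_mono) auto
      also have "\<dots> \<le> e * norm y" using y(2) by (intro mult_right_mono) (auto simp: mult.commute)
      finally show ?thesis using est[OF y(1)] by (simp add: lie_exp_zero)
    qed
    then show "\<exists>d>0. \<forall>y. norm (y - 0) < d \<longrightarrow> norm (coord c (Exp y) - coord c (Exp 0) - (y - 0)) \<le> e * norm (y - 0)"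
      using d by blast
  qed simp
  have "isCont (\<lambda>X. icoord c (coord c (Exp X))) 0"
    using isCont_o2[OF has_derivative_continuous[OF D], of "icoord c"] is_chartD(9)[OF chart_c, of "coord c \<one>"] one_c
    by (simp add: lie_exp_zero)
  moreover have "eventually (\<lambda>X. X \<in> ball 0 (\<rho> / 2)) (nhds (0::'a))"
    using \<sigma>(1) by (intro eventually_nhds_in_open) auto
  then have "eventually (\<lambda>X. icoord c (coord c (Exp X)) = Exp X) (nhds 0)"
    by eventually_elim (use mem is_chartD(3)[OF chart_c] in auto)
  note isCont_cong[OF this]
  ultimately show "isCont Exp 0" by blast
qed

lemma curve_deriv_lie_exp:
  assumes "m 0 = 0" "(m has_vector_derivative X) (at 0)"
  shows "curve_deriv (\<lambda>h. Exp (m h)) X"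
proof -
  have "isCont m 0" using has_vector_derivative_continuous[OF assms(2)] by simp
  then have "isCont (\<lambda>h. Exp (m h)) 0"
    using isCont_o2[of 0 m "Exp"] lie_exp_derivative(2) assms(1) by simp
  moreover have "((\<lambda>h. coord c (Exp (m h))) has_derivative (\<lambda>h. h *\<^sub>R X)) (at 0)"
    by (rule has_derivative_compose[where f=m and g="\<lambda>X. coord c (Exp X)", of "\<lambda>h. h *\<^sub>R X" 0 UNIV "\<lambda>x. x"])
      (use assms lie_exp_derivative(1) in \<open>auto simp: has_vector_derivative_def\<close>)
  ultimately show ?thesis
    by (simp add: curve_deriv_def assms(1) lie_exp_zero comp_def has_vector_derivative_def)
qed

text \<open>For a homomorphism, continuity at 0 spreads to every time by translation, so
  \<open>curve_deriv\<close> at 0 is all there is to check.\<close>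

lemma one_parameter_subgroup_iff:
  "one_parameter_subgroup G c X \<sigma> \<longleftrightarrow> (\<forall>s t. \<sigma> (s + t) = \<sigma> s \<otimes> \<sigma> t) \<and> curve_deriv \<sigma> X"
proof
  assume "one_parameter_subgroup G c X \<sigma>"
  then show "(\<forall>s t. \<sigma> (s + t) = \<sigma> s \<otimes> \<sigma> t) \<and> curve_deriv \<sigma> X"
    using one_parameter_subgroup_curve_deriv by (auto simp: one_parameter_subgroup_def)
next
  assume *: "(\<forall>s t. \<sigma> (s + t) = \<sigma> s \<otimes> \<sigma> t) \<and> curve_deriv \<sigma> X"
  have "isCont \<sigma> t" for t
  proof -
    have "isCont (\<lambda>h. \<sigma> t \<otimes> \<sigma> h) 0"
      using * isCont_group_mult[of 0 "\<lambda>_. \<sigma> t" \<sigma>] by (simp add: curve_deriv_def)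
    then have "isCont (\<lambda>h. \<sigma> (t + h)) 0" using * by simp
    then show ?thesis by (simp only: isCont_shift_0)
  qed
  then show "one_parameter_subgroup G c X \<sigma>"
    using * by (simp add: one_parameter_subgroup_def curve_deriv_def continuous_on_eq_continuous_at)
qed

text \<open>Conjugating a one-parameter subgroup gives another one, whose initial velocity is
  transformed by \<open>Ad p\<close>.\<close>

lemma lie_exp_conj: "p \<otimes> Exp X \<otimes> inv p = Exp (Ad p X)"
proof -
  have "one_parameter_subgroup G c (Ad p X) (\<lambda>t. p \<otimes> Exp (t *\<^sub>R X) \<otimes> inv p)"
    unfolding one_parameter_subgroup_iff
  proof (intro conjI allI curve_deriv_conj)
    show "curve_deriv (\<lambda>t. Exp (t *\<^sub>R X)) X"
      by (intro one_parameter_subgroup_curve_deriv one_parameter_subgroup_exists)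
    fix s t
    have "inv p \<otimes> (p \<otimes> y) = y" for y by (simp add: m_assoc[symmetric])
    then show "p \<otimes> Exp ((s + t) *\<^sub>R X) \<otimes> inv p
        = (p \<otimes> Exp (s *\<^sub>R X) \<otimes> inv p) \<otimes> (p \<otimes> Exp (t *\<^sub>R X) \<otimes> inv p)"
      by (simp add: lie_exp_add_scale m_assoc)
  qed
  from lie_exp_eq[OF this] show ?thesis by simp
qed

lemma lie_exp_add_commute:
  assumes "\<And>s t. Exp (s *\<^sub>R X) \<otimes> Exp (t *\<^sub>R Y) = Exp (t *\<^sub>R Y) \<otimes> Exp (s *\<^sub>R X)"
  shows "Exp (X + Y) = Exp X \<otimes> Exp Y"
proof -
  have "one_parameter_subgroup G c (X + Y) (\<lambda>t. Exp (t *\<^sub>R X) \<otimes> Exp (t *\<^sub>R Y))"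
    unfolding one_parameter_subgroup_iff
  proof (intro conjI allI curve_deriv_mult one_parameter_subgroup_curve_deriv one_parameter_subgroup_exists)
    fix s t
    have "Exp (t *\<^sub>R X) \<otimes> (Exp (s *\<^sub>R Y) \<otimes> z) = Exp (s *\<^sub>R Y) \<otimes> (Exp (t *\<^sub>R X) \<otimes> z)" for z
      using assms[of t s] by (simp add: m_assoc[symmetric])
    then show "Exp ((s + t) *\<^sub>R X) \<otimes> Exp ((s + t) *\<^sub>R Y)
        = Exp (s *\<^sub>R X) \<otimes> Exp (s *\<^sub>R Y) \<otimes> (Exp (t *\<^sub>R X) \<otimes> Exp (t *\<^sub>R Y))"
      by (simp add: lie_exp_add_scale m_assoc)
  qed
  from lie_exp_eq[OF this] show ?thesis by simp
qed

end

section \<open>The adjoint representation\<close>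

context lie_group_chart
begin

lemma one_image: "coord c \<one> \<in> coord c ` dom_of c" using one_c by blast

lemma lie_bracket_eq:
  "br X Y = frechet_derivative (lfield c Y) (at (coord c \<one>)) X - frechet_derivative (lfield c X) (at (coord c \<one>)) Y"
  by (simp add: lie_bracket_def left_invariant_field_eq)

lemma lie_bracket_antisym: "br X Y = - br Y X"
  by (simp add: lie_bracket_eq)

lemma lie_bracket_self: "br X X = 0"
  by (simp add: lie_bracket_eq)

lemma lfield_has_derivative: "(lfield c X has_derivative frechet_derivative (lfield c X) (at (coord c \<one>))) (at (coord c \<one>))"
  by (intro smooth_on_has_derivative[OF smooth_lfield[OF c]] one_image)

text \<open>The field depends linearly on its label only at points of the chart domain; openness of
  the coordinate image lets this linearity pass to the derivative. It yields bilinearity of the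
  bracket.\<close>

lemma linear_frechet_derivative_lfield:
  "linear (\<lambda>X. frechet_derivative (lfield c X) (at (coord c \<one>)) Y)"
proof (rule linearI)
  note o = is_chartD(2)[OF chart_c] one_image
  note D = lfield_has_derivative
  note l = linear_lfield[OF c]
  show "frechet_derivative (lfield c (X + X')) (at (coord c \<one>)) Y
      = frechet_derivative (lfield c X) (at (coord c \<one>)) Y + frechet_derivative (lfield c X') (at (coord c \<one>)) Y" for X X'
  proof -
    have "frechet_derivative (lfield c (X + X')) (at (coord c \<one>)) = frechet_derivative (\<lambda>q. lfield c X q + lfield c X' q) (at (coord c \<one>))"
      by (rule frechet_derivative_transform_open(1)[OF o]) (rule linear_add[OF l])
    then show ?thesis using fun_cong[OF frechet_derivative_at[OF has_derivative_add[OF D[of X] D[of X']]], of Y] by simp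
  qed
  show "frechet_derivative (lfield c (r *\<^sub>R X)) (at (coord c \<one>)) Y
      = r *\<^sub>R frechet_derivative (lfield c X) (at (coord c \<one>)) Y" for r X
  proof -
    have "frechet_derivative (lfield c (r *\<^sub>R X)) (at (coord c \<one>)) = frechet_derivative (\<lambda>q. r *\<^sub>R lfield c X q) (at (coord c \<one>))"
      by (rule frechet_derivative_transform_open(1)[OF o]) (rule linear_scale[OF l])
    then show ?thesis using fun_cong[OF frechet_derivative_at[OF has_derivative_scaleR_right[OF D[of X], of r]], of Y] by simp
  qed
qed

lemma linear_lie_bracket_left: "linear (\<lambda>X. br X Y)"
  unfolding lie_bracket_eq
  by (intro linear_compose_sub linear_frechet_derivative_lfield has_derivative_linear[OF lfield_has_derivative, unfolded eta_contract_eq])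

lemma linear_lie_bracket_right: "linear (br X)"
  using linear_compose_neg[OF linear_lie_bracket_left[of X]] by (simp add: lie_bracket_antisym[symmetric])

lemma bounded_bilinear_lie_bracket: "bounded_bilinear br"
  using linear_lie_bracket_left linear_lie_bracket_right
  by (intro bilinear_conv_bounded_bilinear[THEN iffD1]) (simp add: bilinear_def)

lemma frechet_derivative_slice:
  assumes q: "q \<in> coord c ` dom_of c" 
  shows "frechet_derivative (\<lambda>q. frechet_derivative (mult_coord c c c) (at (q, coord c \<one>)) v) (at q) w
    = frechet_derivative (\<lambda>y. frechet_derivative (mult_coord c c c) (at y) v) (at (q, coord c \<one>)) (w, 0)"
proof -
  let ?h = "\<lambda>y. frechet_derivative (mult_coord c c c) (at y) v"
  have "(q, coord c \<one>) \<in> mult_dom c c c" using q c one_c mult_dom_iff(1)[OF c c _ one_c, where d=c] by auto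
  then have "(?h has_derivative frechet_derivative ?h (at (q, coord c \<one>))) (at (q, coord c \<one>))"
    by (intro smooth_on_has_derivative[OF smooth_on_frechet_derivative[OF smooth_mult_coord[OF c c c]]])
  then have "((\<lambda>q. ?h (q, coord c \<one>)) has_derivative (\<lambda>w. frechet_derivative ?h (at (q, coord c \<one>)) (w, 0))) (at q)"
    by (rule has_derivative_compose[where g="?h" and f="\<lambda>q. (q, coord c \<one>)", rotated]) (auto intro!: derivative_eq_intros)
  from frechet_derivative_at[OF this] show ?thesis by metis
qed

text \<open>Near 0, \<open>Ad (\<eta> s) X\<close> is the differential of multiplication in its
  first argument, at \<open>\<eta> s\<close> and its inverse, applied to the left-invariant field of
  \<open>X\<close>. The product rule gives the derivative of that field along \<open>Y\<close> plus
  a second derivative of the multiplication, which is identified as minus the derivative of the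
  field of \<open>Y\<close> along \<open>X\<close>.\<close>

lemma Ad_curve_derivative:
  assumes \<eta>: "curve_deriv \<eta> Y"
  shows "((\<lambda>s. Ad (\<eta> s) X) has_vector_derivative br Y X) (at 0)"
proof -
  let ?M = "mult_coord c c c" and ?o = "coord c \<one>"
  let ?D = "\<lambda>v y. frechet_derivative ?M (at y) v"
  let ?\<psi> = "\<lambda>s. (coord c (\<eta> s), coord c (inv (\<eta> s)))"
  note h = \<eta>[unfolded curve_deriv_def] curve_deriv_inv[OF \<eta>, unfolded curve_deriv_def]
  have oM: "(?o, ?o) \<in> mult_dom c c c" using mult_dom_iff(1)[OF c c one_c one_c] one_c by auto
  have DM: "(?D v has_derivative frechet_derivative (?D v) (at (?o, ?o))) (at (?o, ?o))" for v
    by (intro smooth_on_has_derivative[OF smooth_on_frechet_derivative[OF smooth_mult_coord[OF c c c]] oM])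
  have ev: "eventually (\<lambda>s. \<eta> s \<in> dom_of c \<and> inv (\<eta> s) \<in> dom_of c) (nhds 0)"
    using h one_c is_chartD(1)[OF chart_c] by (intro eventually_conj isCont_eventually_mem) auto
  have \<psi>: "(?\<psi> has_derivative (\<lambda>h. (h *\<^sub>R Y, h *\<^sub>R (- Y)))) (at 0)"
    using h by (intro has_derivative_Pair) (auto simp: has_vector_derivative_def comp_def)
  have lin: "eventually (\<lambda>s. linear (\<lambda>b. ?D (b, 0) (?\<psi> s))) (nhds 0)"
    using ev
  proof eventually_elim
    case (elim s)
    then have "?\<psi> s \<in> mult_dom c c c" using mult_dom_iff(1)[OF c c, of "\<eta> s" "inv (\<eta> s)"] one_c by auto
    then have "linear (frechet_derivative ?M (at (?\<psi> s)))"
      using smooth_on_differentiable[OF smooth_mult_coord[OF c c c]] linear_frechet_derivative by blast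
    moreover have "linear (\<lambda>b::'a. (b, 0::'a))" by (rule linearI) auto
    ultimately show ?case using linear_compose[of "\<lambda>b. (b, 0)" "frechet_derivative ?M (at (?\<psi> s))"] by (simp add: comp_def)
  qed
  have f': "((\<lambda>s. ?D (b, 0) (?\<psi> s)) has_derivative (\<lambda>h. frechet_derivative (?D (b, 0)) (at (?o, ?o)) (h *\<^sub>R Y, h *\<^sub>R (- Y)))) (at 0)" for b
    by (rule has_derivative_compose[OF \<psi>, where g="?D (b, 0)"]) (use DM h in auto)
  have X': "((\<lambda>s. lfield c X (coord c (\<eta> s))) has_derivative (\<lambda>h. frechet_derivative (lfield c X) (at ?o) (h *\<^sub>R Y))) (at 0)"
    by (rule has_derivative_compose[where f="\<lambda>s. coord c (\<eta> s)" and g="lfield c X"])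
      (use h lfield_has_derivative in \<open>auto simp: has_vector_derivative_def comp_def\<close>)
  have D1: "((\<lambda>s. ?D (lfield c X (coord c (\<eta> s)), 0) (?\<psi> s)) has_derivative
     (\<lambda>h. ?D (frechet_derivative (lfield c X) (at ?o) (h *\<^sub>R Y), 0) (?\<psi> 0) + 
       frechet_derivative (?D (lfield c X (coord c (\<eta> 0)), 0)) (at (?o, ?o)) (h *\<^sub>R Y, h *\<^sub>R (- Y)))) (at 0)"
    by (rule has_derivative_linear_family[OF lin f' X'])
  have "eventually (\<lambda>s. ?D (lfield c X (coord c (\<eta> s)), 0) (?\<psi> s) = Ad (\<eta> s) X) (nhds 0)"
    using ev
  proof eventually_elim
    case (elim s)
    then show ?case
      using chart_diff_conj(2)[OF c, of "\<eta> s" X] right_translation_coord(2)[OF c c c, of "\<eta> s" "inv (\<eta> s)"] one_c is_chartD(3)[OF chart_c, of "\<eta> s"]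
      by (simp add: lfield_def)
  qed
  then have D2: "((\<lambda>s. Ad (\<eta> s) X) has_derivative
     (\<lambda>h. ?D (frechet_derivative (lfield c X) (at ?o) (h *\<^sub>R Y), 0) (?\<psi> 0) + 
       frechet_derivative (?D (lfield c X (coord c (\<eta> 0)), 0)) (at (?o, ?o)) (h *\<^sub>R Y, h *\<^sub>R (- Y)))) (at 0)"
    by (rule has_derivative_eventually_nhds[OF D1])
  \<comment> \<open>Right multiplication by the identity is the identity map. Hence the differential
    in the first argument is constant along this slice, and its derivative in the direction
    \<open>(Y, 0)\<close> vanishes.\<close>
  have right: "?D (v, 0) (q, ?o) = v" if q: "q \<in> coord c ` dom_of c" for v q
  proof -
    obtain p where p: "p \<in> dom_of c" "q = coord c p" using q by blast
    then show ?thesis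
      using right_translation_coord(2)[OF c c c p(1) one_c] tangent_map_id(2)[OF chart_c p(1), of "\<lambda>x. x \<otimes> \<one>"]
      by (metis closed id_apply r_one)
  qed
  have "frechet_derivative (?D (X, 0)) (at (?o, ?o)) (Y, 0) = frechet_derivative (\<lambda>q. ?D (X, 0) (q, ?o)) (at ?o) Y"
    using frechet_derivative_slice[OF one_image] by simp
  also have "\<dots> = frechet_derivative (\<lambda>q. X) (at ?o) Y"
    by (subst frechet_derivative_transform_open(1)[OF is_chartD(2)[OF chart_c] one_image, where g="\<lambda>q. X"]) (auto simp: right)
  finally have XY: "frechet_derivative (?D (X, 0)) (at (?o, ?o)) (Y, 0) = 0" by simp
  \<comment> \<open>Symmetry of second derivatives exchanges the two arguments; the differential in
    the second argument along the slice is the left-invariant field of \<open>Y\<close>.\<close>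
  have "frechet_derivative (?D (X, 0)) (at (?o, ?o)) (0, Y) = frechet_derivative (?D (0, Y)) (at (?o, ?o)) (X, 0)"
    by (rule frechet_derivative_commute[OF open_mult_dom[OF c c c] oM smooth_mult_coord[OF c c c]])
  also have "\<dots> = frechet_derivative (\<lambda>q. ?D (0, Y) (q, ?o)) (at ?o) X"
    using frechet_derivative_slice[OF one_image] by simp
  also have "\<dots> = frechet_derivative (lfield c Y) (at ?o) X"
    by (subst frechet_derivative_transform_open(1)[OF is_chartD(2)[OF chart_c] one_image, where g="lfield c Y"])
      (auto simp: lfield_eq_mult_coord[OF c])
  finally have YX: "frechet_derivative (?D (X, 0)) (at (?o, ?o)) (0, Y) = frechet_derivative (lfield c Y) (at ?o) X" .
  note l = has_derivative_linear[OF DM[of "(X, 0)"]]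
  have sec: "frechet_derivative (?D (X, 0)) (at (?o, ?o)) (h *\<^sub>R Y, h *\<^sub>R (- Y)) = h *\<^sub>R (- frechet_derivative (lfield c Y) (at ?o) X)" for h
  proof -
    have "frechet_derivative (?D (X, 0)) (at (?o, ?o)) (Y, - Y) = - frechet_derivative (lfield c Y) (at ?o) X"
      using linear_diff[OF l, of "(Y, 0)" "(0, Y)"] XY YX by simp
    moreover have "(h *\<^sub>R Y, h *\<^sub>R (- Y)) = h *\<^sub>R (Y, - Y)" by simp
    ultimately show ?thesis using linear_scale[OF l, of h "(Y, - Y)"] by metis
  qed
  have "(\<lambda>h. ?D (frechet_derivative (lfield c X) (at ?o) (h *\<^sub>R Y), 0) (?\<psi> 0) + 
       frechet_derivative (?D (lfield c X (coord c (\<eta> 0)), 0)) (at (?o, ?o)) (h *\<^sub>R Y, h *\<^sub>R (- Y)))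
     = (\<lambda>h. h *\<^sub>R br Y X)"
    using h right[OF one_image] sec linear_scale[OF has_derivative_linear[OF lfield_has_derivative[of X]]]
    by (simp add: lfield_one lie_bracket_eq algebra_simps)
  with D2 show ?thesis by (simp add: has_vector_derivative_def)
qed

text \<open>Left translation by \<open>p\<close>, read in the charts as \<open>\<Phi>\<close>,
  carries fields around the identity to fields around \<open>p\<close>. Differentiating this
  relation produces a second derivative of \<open>\<Phi>\<close>, which is symmetric and drops out
  of the commutator.\<close>

lemma lfield_commutator:
  assumes d: "d \<in> A" "p \<in> dom_of d"
  shows "frechet_derivative (lfield d X) (at (coord d p)) (lfield d Y (coord d p))
       - frechet_derivative (lfield d Y) (at (coord d p)) (lfield d X (coord d p)) = lfield d (br Y X) (coord d p)"
proof -
  let ?q = "coord d p" and ?o = "coord c \<one>"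
  define \<Phi> where "\<Phi> r = mult_coord d c d ((?q, 0) + (0, r))" for r
  define S where "S = {r. (?q, 0) + (0, r) \<in> mult_dom d c d}"
  have lin0: "linear (\<lambda>r::'a. (0::'a, r))" by (auto intro!: linearI)
  have \<Phi>: "smooth_on S \<Phi>"
    unfolding \<Phi>_def S_def by (intro smooth_on_affine open_mult_dom smooth_mult_coord lin0 d c)
  have "continuous_on UNIV (\<lambda>r::'a. (?q, 0) + (0::'a, r))" by (intro continuous_intros)
  then have S: "open S"
    unfolding S_def using open_vimage[OF open_mult_dom[OF d(1) c d(1)]] by (simp only: vimage_def)
  have oS: "?o \<in> S" using mult_dom_iff(1)[OF d(1) c d(2) one_c] d by (simp add: S_def)
  have \<Phi>_eq: "\<Phi> = coord d \<circ> (\<lambda>x. p \<otimes> x) \<circ> icoord c"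
    using d is_chartD(3)[OF chart] by (auto simp: \<Phi>_def mult_coord_def fun_eq_iff)
  have \<Phi>o: "\<Phi> ?o = ?q" using is_chartD(3)[OF chart_c one_c] by (simp add: \<Phi>_eq)
  have rel: "lfield d X (\<Phi> r) = frechet_derivative \<Phi> (at r) (lfield c X r)" if r: "r \<in> S" for r X
  proof -
    have *: "r \<in> coord c ` dom_of c" "p \<otimes> icoord c r \<in> dom_of d"
      using r d is_chartD(3)[OF chart] by (auto simp: S_def mult_dom_def)
    then show ?thesis
      using lfield_left_translation[OF c d(1) is_chartD(4)[OF chart_c *(1)], of p X] is_chartD(5)[OF chart_c *(1)]
      by (simp add: \<Phi>_eq tangent_map_def)
  qed
  have \<Phi>': "frechet_derivative \<Phi> (at ?o) Y = lfield d Y ?q" for Y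
    using rel[OF oS, of Y] lfield_one \<Phi>o by simp
  have main: "frechet_derivative (lfield d X) (at ?q) (lfield d Y ?q)
      = frechet_derivative \<Phi> (at ?o) (frechet_derivative (lfield c X) (at ?o) Y)
      + frechet_derivative (\<lambda>r. frechet_derivative \<Phi> (at r) X) (at ?o) Y" for X Y
  proof -
    have l: "eventually (\<lambda>r. linear (frechet_derivative \<Phi> (at r))) (nhds ?o)"
      using eventually_nhds_in_open[OF S oS]
      by eventually_elim (intro linear_frechet_derivative smooth_on_differentiable[OF \<Phi>])
    have "((\<lambda>r. frechet_derivative \<Phi> (at r) (lfield c X r)) has_derivative
       (\<lambda>h. frechet_derivative \<Phi> (at ?o) (frechet_derivative (lfield c X) (at ?o) h) +
         frechet_derivative (\<lambda>r. frechet_derivative \<Phi> (at r) (lfield c X ?o)) (at ?o) h)) (at ?o)"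
      by (rule has_derivative_linear_family[OF l _ lfield_has_derivative])
        (intro smooth_on_has_derivative[OF smooth_on_frechet_derivative[OF \<Phi>] oS])
    moreover have "eventually (\<lambda>r. frechet_derivative \<Phi> (at r) (lfield c X r) = lfield d X (\<Phi> r)) (nhds ?o)"
      using eventually_nhds_in_open[OF S oS] by eventually_elim (simp add: rel)
    ultimately have 1: "((\<lambda>r. lfield d X (\<Phi> r)) has_derivative
       (\<lambda>h. frechet_derivative \<Phi> (at ?o) (frechet_derivative (lfield c X) (at ?o) h) +
         frechet_derivative (\<lambda>r. frechet_derivative \<Phi> (at r) (lfield c X ?o)) (at ?o) h)) (at ?o)"
      by (rule has_derivative_eventually_nhds)
    have "(lfield d X has_derivative frechet_derivative (lfield d X) (at ?q)) (at (\<Phi> ?o))"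
      unfolding \<Phi>o using d by (intro smooth_on_has_derivative[OF smooth_lfield]) auto
    then have 2: "((\<lambda>r. lfield d X (\<Phi> r)) has_derivative (\<lambda>h. frechet_derivative (lfield d X) (at ?q) (frechet_derivative \<Phi> (at ?o) h))) (at ?o)"
      by (rule has_derivative_compose[OF smooth_on_has_derivative[OF \<Phi> oS]])
    show ?thesis
      using fun_cong[OF has_derivative_unique[OF 2 1], of Y] by (simp add: \<Phi>' lfield_one)
  qed
  have "linear (frechet_derivative \<Phi> (at ?o))"
    by (intro linear_frechet_derivative smooth_on_differentiable[OF \<Phi>] oS)
  then show ?thesis
    using frechet_derivative_commute[OF S oS \<Phi>, of X Y] unfolding main
    by (simp add: lie_bracket_eq linear_diff \<Phi>'[symmetric])
qed

lemma Ad_lie_exp_derivative: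
  "((\<lambda>s. Ad (Exp (s *\<^sub>R Z)) X) has_vector_derivative Ad (Exp (s *\<^sub>R Z)) (br Z X)) (at s)"
proof -
  have "((\<lambda>h. Ad (Exp (h *\<^sub>R Z)) X) has_vector_derivative br Z X) (at 0)"
    by (intro Ad_curve_derivative one_parameter_subgroup_curve_deriv one_parameter_subgroup_exists)
  then have "((\<lambda>h. Ad (Exp (s *\<^sub>R Z)) (Ad (Exp (h *\<^sub>R Z)) X)) has_vector_derivative
      Ad (Exp (s *\<^sub>R Z)) (br Z X)) (at 0)"
    using linear_Ad linear_conv_bounded_linear bounded_linear.has_vector_derivative by blast
  then have "((\<lambda>h. Ad (Exp ((s + h) *\<^sub>R Z)) X) has_vector_derivative
      Ad (Exp (s *\<^sub>R Z)) (br Z X)) (at 0)"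
    by (simp only: lie_exp_add_scale Ad_mult)
  then show ?thesis by (rule has_vector_derivative_shift_0[THEN iffD1])
qed

lemma Ad_lie_exp_central:
  assumes "br Z X = 0"
  shows "Ad (Exp (s *\<^sub>R Z)) X = X"
proof -
  have "((\<lambda>s. Ad (Exp (s *\<^sub>R Z)) X) has_vector_derivative 0) (at s)" for s
    using Ad_lie_exp_derivative[of Z X s] by (simp add: assms linear_0[OF linear_Ad])
  then have "Ad (Exp (s *\<^sub>R Z)) X = Ad (Exp (0 *\<^sub>R Z)) X"
    by (intro has_vector_derivative_zero_imp_eq[of UNIV "\<lambda>s. Ad (Exp (s *\<^sub>R Z)) X"]) auto
  then show ?thesis by (simp add: lie_exp_zero Ad_one)
qed

text \<open>The derivative in \<open>s\<close> is \<open>Ad\<close> applied to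
  \<open>br Z X\<close>; this vector is fixed by the subgroup of \<open>Z\<close>, so the curve is
  affine.\<close>

lemma Ad_lie_exp_two_step:
  assumes "br Z (br Z X) = 0"
  shows "Ad (Exp (s *\<^sub>R Z)) X = X + s *\<^sub>R br Z X"
proof -
  let ?f = "\<lambda>s. Ad (Exp (s *\<^sub>R Z)) X - s *\<^sub>R br Z X"
  have "(?f has_vector_derivative 0) (at s)" for s
    using has_vector_derivative_diff[OF Ad_lie_exp_derivative[of Z X s]
        bounded_linear.has_vector_derivative[OF bounded_linear_scaleR_left[of "br Z X"] has_vector_derivative_id]]
    by (simp add: Ad_lie_exp_central[OF assms])
  then have "?f s = ?f 0" by (intro has_vector_derivative_zero_imp_eq[of UNIV ?f]) auto
  then show ?thesis by (simp add: lie_exp_zero Ad_one algebra_simps)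
qed

end

section \<open>The Baker--Campbell--Hausdorff formula\<close>

context lie_group_chart
begin

lemma lie_exp_swap:
  assumes "br Y (br Y X) = 0"
  shows "Exp Y \<otimes> Exp X = Exp (X + br Y X) \<otimes> Exp Y"
proof -
  have "Exp Y \<otimes> Exp X \<otimes> inv (Exp Y) = Exp (X + br Y X)"
    using Ad_lie_exp_two_step[OF assms, of 1] by (simp add: lie_exp_conj)
  then show ?thesis by (metis closed inv_solve_right')
qed

lemma lie_exp_commute:
  assumes "br Y X = 0"
  shows "Exp Y \<otimes> Exp X = Exp X \<otimes> Exp Y"
  using lie_exp_swap[of Y X] assms linear_0[OF linear_lie_bracket_right] by simp

lemma lie_exp_add_of_bracket_zero:
  assumes "br X Y = 0"
  shows "Exp (X + Y) = Exp X \<otimes> Exp Y"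
proof (rule lie_exp_add_commute, rule lie_exp_commute)
  show "br (s *\<^sub>R X) (t *\<^sub>R Y) = 0" for s t
    using assms bounded_bilinear.scaleR_left[OF bounded_bilinear_lie_bracket]
      bounded_bilinear.scaleR_right[OF bounded_bilinear_lie_bracket] by simp
qed

text \<open>
  By \<open>lie_exp_swap\<close> the curve \<open>s \<mapsto> exp(-s\<^sup>2/2 [X,Y]) exp(sX) exp(sY)\<close> is a one-parameter subgroup.
\<close>

theorem baker_campbell_hausdorff_two_step:
  assumes nil: "two_step_nilpotent br"
  shows "Exp X \<otimes> Exp Y = Exp (X + Y + (1/2) *\<^sub>R br X Y)"
proof -
  note bb = bounded_bilinear_lie_bracket
  let ?E = "Exp"
  let ?C = "br X Y"
  have C: "br ?C W = 0" "br W ?C = 0" for W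
    using nil lie_bracket_antisym[of W ?C] unfolding two_step_nilpotent_def lie_center_def by auto
  define z where "z k = ?E (k *\<^sub>R ?C)" for k
  have z_add: "z a \<otimes> z b = z (a + b)" for a b by (simp add: z_def lie_exp_add_scale)
  then have z_add': "z a \<otimes> (z b \<otimes> w) = z (a + b) \<otimes> w" for a b w by (simp add: m_assoc[symmetric])
  have z_comm: "?E W \<otimes> z k = z k \<otimes> ?E W" for W k
    unfolding z_def by (intro lie_exp_commute) (simp add: C bounded_bilinear.scaleR_right[OF bb])
  then have z_comm': "?E W \<otimes> (z k \<otimes> w) = z k \<otimes> (?E W \<otimes> w)" for W k w by (simp add: m_assoc[symmetric])
  \<comment> \<open>Moving an exponential of \<open>Y\<close> to the right past one of
    \<open>X\<close> costs a central factor. The trailing \<open>w\<close> lets this act as a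
    rewrite rule inside right-nested products.\<close>
  have swap: "?E (s *\<^sub>R Y) \<otimes> (?E (t *\<^sub>R X) \<otimes> w) = z (- (s * t)) \<otimes> (?E (t *\<^sub>R X) \<otimes> (?E (s *\<^sub>R Y) \<otimes> w))" for s t w
  proof -
    have br: "br (s *\<^sub>R Y) (t *\<^sub>R X) = (- (s * t)) *\<^sub>R ?C"
      using lie_bracket_antisym[of Y X] by (simp add: bounded_bilinear.scaleR_left[OF bb] bounded_bilinear.scaleR_right[OF bb])
    have "?E (s *\<^sub>R Y) \<otimes> ?E (t *\<^sub>R X) = ?E (t *\<^sub>R X + br (s *\<^sub>R Y) (t *\<^sub>R X)) \<otimes> ?E (s *\<^sub>R Y)"
      by (rule lie_exp_swap) (subst br, simp only: bounded_bilinear.scaleR_right[OF bb] C scaleR_zero_right)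
    also have "?E (t *\<^sub>R X + br (s *\<^sub>R Y) (t *\<^sub>R X)) = ?E (t *\<^sub>R X) \<otimes> z (- (s * t))"
      unfolding br z_def by (intro lie_exp_add_of_bracket_zero) (simp only: bounded_bilinear.scaleR_right[OF bb] C scaleR_zero_right)
    finally have "?E (s *\<^sub>R Y) \<otimes> ?E (t *\<^sub>R X) = z (- (s * t)) \<otimes> (?E (t *\<^sub>R X) \<otimes> ?E (s *\<^sub>R Y))"
      by (simp add: z_comm m_assoc)
    from arg_cong[OF this, of "\<lambda>u. u \<otimes> w"] show ?thesis by (simp add: m_assoc)
  qed
  define \<sigma> where "\<sigma> s = z (- (s\<^sup>2 / 2)) \<otimes> (?E (s *\<^sub>R X) \<otimes> ?E (s *\<^sub>R Y))" for s
  have "one_parameter_subgroup G c (X + Y) \<sigma>"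
    unfolding one_parameter_subgroup_iff
  proof (intro conjI allI)
    fix s t
    have "\<sigma> s \<otimes> \<sigma> t = z (- (s\<^sup>2 / 2) + - (t\<^sup>2 / 2) + - (s * t)) \<otimes> (?E (s *\<^sub>R X) \<otimes> (?E (t *\<^sub>R X) \<otimes> (?E (s *\<^sub>R Y) \<otimes> ?E (t *\<^sub>R Y))))"
      by (simp only: \<sigma>_def m_assoc closed z_comm' z_add' swap add.assoc)
    \<comment> \<open>The central cost \<open>- (s * t)\<close> of reordering completes the square;
      this is the reason for the exponent of the correcting factor in
      \<open>\<sigma>\<close>.\<close>
    also have "- (s\<^sup>2 / 2) + - (t\<^sup>2 / 2) + - (s * t) = - ((s + t)\<^sup>2 / 2)"
      by (simp add: power2_sum field_simps)
    finally show "\<sigma> (s + t) = \<sigma> s \<otimes> \<sigma> t"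
      by (simp only: \<sigma>_def m_assoc closed lie_exp_add_scale)
  next
    have "curve_deriv (\<lambda>s. z (- (s\<^sup>2 / 2))) 0"
      unfolding z_def by (rule curve_deriv_lie_exp) (auto intro!: derivative_eq_intros)
    from curve_deriv_mult[OF this curve_deriv_mult[OF
        one_parameter_subgroup_exists[of X, THEN one_parameter_subgroup_curve_deriv]
        one_parameter_subgroup_exists[of Y, THEN one_parameter_subgroup_curve_deriv]]]
    show "curve_deriv \<sigma> (X + Y)" by (simp add: \<sigma>_def[abs_def])
  qed
  from lie_exp_eq[OF this] have "?E (X + Y) = z (- (1/2)) \<otimes> (?E X \<otimes> ?E Y)" by (simp add: \<sigma>_def)
  then have "z (1/2) \<otimes> ?E (X + Y) = z 0 \<otimes> (?E X \<otimes> ?E Y)" by (simp add: z_add')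
  also have "z 0 = \<one>" by (simp add: z_def lie_exp_zero)
  finally have "?E X \<otimes> ?E Y = ?E (X + Y) \<otimes> ?E ((1/2) *\<^sub>R ?C)" using z_comm[of "X + Y" "1/2"] by (simp add: z_def)
  also have "\<dots> = ?E (X + Y + (1/2) *\<^sub>R ?C)"
    by (rule lie_exp_add_of_bracket_zero[symmetric]) (simp only: bounded_bilinear.scaleR_right[OF bb] C scaleR_zero_right)
  finally show ?thesis .
qed

text \<open>Baker--Campbell--Hausdorff for \<open>- n t\<close> and \<open>n (t + h)\<close> writes
  the increment exactly as the exponential of \<open>m h\<close> with \<open>m 0 = 0\<close>. Only
  the differential of the exponential map at 0 is then needed.\<close>

lemma log_deriv_lie_exp:
  assumes nil: "two_step_nilpotent br" and n: "(n has_vector_derivative n') (at t)"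
  shows "log_deriv (\<lambda>s. Exp (n s)) t (n' - (1/2) *\<^sub>R br (n t) n')"
  unfolding log_deriv_def
proof -
  note bb = bounded_bilinear_lie_bracket
  define m where "m h = - n t + n (t + h) - (1/2) *\<^sub>R br (n t) (n (t + h))" for h
  have "inv (Exp (n t)) \<otimes> Exp (n (t + h)) = Exp (m h)" for h
    using baker_campbell_hausdorff_two_step[OF nil, of "- n t" "n (t + h)"]
    by (simp add: lie_exp_minus[symmetric] m_def bounded_bilinear.minus_left[OF bb])
  moreover have "curve_deriv (\<lambda>h. Exp (m h)) (n' - (1/2) *\<^sub>R br (n t) n')"
  proof (rule curve_deriv_lie_exp)
    show "m 0 = 0" by (simp add: m_def lie_bracket_self)
    have n0: "((\<lambda>h. n (t + h)) has_vector_derivative n') (at 0)" using n by (simp only: has_vector_derivative_shift_0)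
    have "((\<lambda>h. br (n t) (n (t + h))) has_vector_derivative br (n t) n') (at 0)"
      by (rule bounded_linear.has_vector_derivative[OF bounded_bilinear.bounded_linear_right[OF bb] n0])
    with n0 show "(m has_vector_derivative n' - (1/2) *\<^sub>R br (n t) n') (at 0)"
      unfolding m_def by (auto intro!: derivative_eq_intros)
  qed
  ultimately show "curve_deriv (\<lambda>h. inv (Exp (n t)) \<otimes> Exp (n (t + h))) (n' - (1/2) *\<^sub>R br (n t) n')"
    by simp
qed

end

section \<open>Geodesics of left-invariant metrics\<close>

lemma has_vector_derivative_frechet_derivative:
  assumes "f differentiable (at t)"
  shows "(f has_vector_derivative frechet_derivative f (at t) 1) (at t)"
    and "vector_derivative f (at t) = frechet_derivative f (at t) 1"
proof -
  have D: "(f has_derivative frechet_derivative f (at t)) (at t)" using frechet_derivative_works[THEN iffD1, OF assms] .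
  have "(\<lambda>h. h *\<^sub>R frechet_derivative f (at t) 1) = frechet_derivative f (at t)"
    by (rule ext, subst linear_scale[OF has_derivative_linear[OF D], symmetric]) simp
  with D show 1: "(f has_vector_derivative frechet_derivative f (at t) 1) (at t)"
    by (simp add: has_vector_derivative_def)
  show "vector_derivative f (at t) = frechet_derivative f (at t) 1" by (rule vector_derivative_at[OF 1])
qed

locale left_invariant_geodesic = lie_group_chart G A c
  for G :: "'g::{t2_space, second_countable_topology} monoid" (structure)
    and A :: "('g, 'a::euclidean_space) chart set" and c :: "('g, 'a) chart" +
  fixes g :: "('g, 'a) metric" and T :: "real set" and \<gamma> :: "real \<Rightarrow> 'g"
  assumes metric: "pseudo_riemannian_metric A g" and invariant: "left_invariant_metric G A g"
    and T: "open T" and geodesic: "geodesic_on A g T \<gamma>"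
begin

abbreviation "ip \<equiv> g c (coord c \<one>)"

lemma inner_product_g: "d \<in> A \<Longrightarrow> q \<in> coord d ` dom_of d \<Longrightarrow> scalar_product (g d q)"
  using metric unfolding pseudo_riemannian_metric_def scalar_product_def by blast

lemma scalar_product_ip: "scalar_product ip" using inner_product_g[OF c one_image] .

lemma smooth_g: "d \<in> A \<Longrightarrow> smooth_on (coord d ` dom_of d) (\<lambda>q. g d q v w)"
  using metric unfolding pseudo_riemannian_metric_def by blast

lemma g_lfield:
  assumes "d \<in> A" "q \<in> coord d ` dom_of d"
  shows "g d q (lfield d X q) (lfield d Y q) = ip X Y"
proof -
  have m: "icoord d q \<in> dom_of d" "coord d (icoord d q) = q" using is_chartD(4,5)[OF chart] assms by auto
  have "icoord d q \<otimes> \<one> \<in> dom_of d" using m by simp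
  then have "g d (coord d (icoord d q \<otimes> \<one>)) (tangent_map c d (left_translation G (icoord d q)) \<one> X)
      (tangent_map c d (left_translation G (icoord d q)) \<one> Y) = ip X Y"
    using invariant assms c one_c unfolding left_invariant_metric_def by blast
  then show ?thesis using m by (simp add: lfield_def left_translation_eq)
qed

text \<open>The product rule for linear families, applied once to each argument of the metric while
  the base point moves as well.\<close>

lemma metric_has_derivative:
  fixes Q X Y :: "'p::real_normed_vector \<Rightarrow> 'a"
  assumes d: "d \<in> A" "Q p \<in> coord d ` dom_of d"
    and Q: "(Q has_derivative Q') (at p)" and X: "(X has_derivative X') (at p)" and Y: "(Y has_derivative Y') (at p)"
  shows "((\<lambda>p. g d (Q p) (X p) (Y p)) has_derivative (\<lambda>h. g d (Q p) (X' h) (Y p) + (g d (Q p) (X p) (Y' h)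
     + frechet_derivative (\<lambda>q. g d q (X p) (Y p)) (at (Q p)) (Q' h)))) (at p)"
proof -
  have "isCont Q p" using has_derivative_continuous[OF Q] by simp
  then have "((\<lambda>x. Q x) \<longlongrightarrow> Q p) (nhds p)" using tendsto_at_iff_tendsto_nhds[of Q p] by (simp add: isCont_def)
  then have ev: "eventually (\<lambda>x. Q x \<in> coord d ` dom_of d) (nhds p)"
    using topological_tendstoD is_chartD(2)[OF chart[OF d(1)]] d(2) by blast
  have 1: "((\<lambda>p. g d (Q p) v w) has_derivative (\<lambda>h. frechet_derivative (\<lambda>q. g d q v w) (at (Q p)) (Q' h))) (at p)" for v w
    by (rule has_derivative_compose[OF Q, where g="\<lambda>q. g d q v w"]) (rule smooth_on_has_derivative[OF smooth_g[OF d(1)] d(2)])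
  have "eventually (\<lambda>x. linear (\<lambda>w. g d (Q x) v w)) (nhds p)" for v
    using ev by eventually_elim (use scalar_product.linear_right inner_product_g[OF d(1)] in auto)
  then have 2: "((\<lambda>p. g d (Q p) v (Y p)) has_derivative
      (\<lambda>h. g d (Q p) v (Y' h) + frechet_derivative (\<lambda>q. g d q v (Y p)) (at (Q p)) (Q' h))) (at p)" for v
    by (rule has_derivative_linear_family[OF _ 1 Y])
  have "eventually (\<lambda>x. linear (\<lambda>v. g d (Q x) v (Y x))) (nhds p)"
    using ev by eventually_elim (use scalar_product.linear_left inner_product_g[OF d(1)] in auto)
  then show ?thesis by (rule has_derivative_linear_family[OF _ 2 X])
qed

lemma linear_metric_derivative:
  assumes d: "d \<in> A" "q \<in> coord d ` dom_of d"
  shows "linear (\<lambda>w. frechet_derivative (\<lambda>q. g d q v w) (at q) h)"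
proof (rule linearI)
  note o = is_chartD(2)[OF chart[OF d(1)]] d(2)
  note D = smooth_on_has_derivative[OF smooth_g[OF d(1)] d(2)]
  note sp = inner_product_g[OF d(1)]
  fix w w' :: 'a and r :: real
  have "frechet_derivative (\<lambda>q. g d q v (w + w')) (at q) = frechet_derivative (\<lambda>q. g d q v w + g d q v w') (at q)"
    by (rule frechet_derivative_transform_open(1)[OF o]) (rule linear_add[OF scalar_product.linear_right[OF sp]])
  then show "frechet_derivative (\<lambda>q. g d q v (w + w')) (at q) h
      = frechet_derivative (\<lambda>q. g d q v w) (at q) h + frechet_derivative (\<lambda>q. g d q v w') (at q) h"
    using fun_cong[OF frechet_derivative_at[OF has_derivative_add[OF D[of v w] D[of v w']]], of h] by simp
  have "frechet_derivative (\<lambda>q. g d q v (r *\<^sub>R w)) (at q) = frechet_derivative (\<lambda>q. r *\<^sub>R g d q v w) (at q)"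
    by (rule frechet_derivative_transform_open(1)[OF o]) (rule linear_scale[OF scalar_product.linear_right[OF sp]])
  then show "frechet_derivative (\<lambda>q. g d q v (r *\<^sub>R w)) (at q) h
      = r *\<^sub>R frechet_derivative (\<lambda>q. g d q v w) (at q) h"
    using fun_cong[OF frechet_derivative_at[OF has_derivative_scaleR_right[OF D[of v w], of r]], of h] by simp
qed

lemma christoffel:
  assumes d: "d \<in> A" "q \<in> coord d ` dom_of d"
  shows "g d q (christoffel g d q v v) w = frechet_derivative (\<lambda>q. g d q v w) (at q) v
    - frechet_derivative (\<lambda>q. g d q v v) (at q) w / 2"
proof -
  interpret scalar_product "g d q" by (rule inner_product_g[OF d])
  have "(\<lambda>w. (frechet_derivative (\<lambda>q. g d q v w) (at q) v + frechet_derivative (\<lambda>q. g d q v w) (at q) v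
      - frechet_derivative (\<lambda>q. g d q v v) (at q) w) / 2)
    = (\<lambda>w. frechet_derivative (\<lambda>q. g d q v w) (at q) v - (1/2) *\<^sub>R frechet_derivative (\<lambda>q. g d q v v) (at q) w)"
    by (auto simp: field_simps)
  moreover have "linear (\<lambda>w. frechet_derivative (\<lambda>q. g d q v w) (at q) v - (1/2) *\<^sub>R frechet_derivative (\<lambda>q. g d q v v) (at q) w)"
    by (intro linear_compose_sub linear_metric_derivative[OF d] linear_compose_scale_right
        linear_frechet_derivative smooth_on_differentiable[OF smooth_g[OF d(1)] d(2)])
  ultimately show ?thesis by (simp add: christoffel_def represent)
qed

lemma curve_smooth: "d \<in> A \<Longrightarrow> smooth_on (T \<inter> \<gamma> -` dom_of d) (coord d \<circ> \<gamma>)"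
  and isCont_curve: "t \<in> T \<Longrightarrow> isCont \<gamma> t"
  using geodesic T unfolding geodesic_on_def smooth_curve_on_def by (auto simp: continuous_on_eq_continuous_at)

lemma open_curve_dom: "d \<in> A \<Longrightarrow> open (T \<inter> \<gamma> -` dom_of d)"
  using geodesic T is_chartD(1)[OF chart] unfolding geodesic_on_def smooth_curve_on_def
  by (metis Int_commute continuous_on_open_vimage)

lemma velocity_derivative:
  assumes "d \<in> A" "t \<in> T" "\<gamma> t \<in> dom_of d"
  shows "((coord d \<circ> \<gamma>) has_vector_derivative velocity d \<gamma> t) (at t)"
    and "(velocity d \<gamma> has_vector_derivative vector_derivative (velocity d \<gamma>) (at t)) (at t)"
proof -
  let ?S = "T \<inter> \<gamma> -` dom_of d"
  have t: "t \<in> ?S" using assms by auto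
  have vel: "velocity d \<gamma> s = frechet_derivative (coord d \<circ> \<gamma>) (at s) 1" if "s \<in> ?S" for s
    unfolding velocity_def using has_vector_derivative_frechet_derivative(2)[OF smooth_on_differentiable[OF curve_smooth[OF assms(1)] that]] .
  show "((coord d \<circ> \<gamma>) has_vector_derivative velocity d \<gamma> t) (at t)"
    unfolding vel[OF t] by (rule has_vector_derivative_frechet_derivative(1)[OF smooth_on_differentiable[OF curve_smooth[OF assms(1)] t]])
  have "velocity d \<gamma> differentiable (at t) \<longleftrightarrow> (\<lambda>s. frechet_derivative (coord d \<circ> \<gamma>) (at s) 1) differentiable (at t)"
    by (rule frechet_derivative_transform_open(2)[OF open_curve_dom[OF assms(1)] t vel])
  then have "velocity d \<gamma> differentiable (at t)"
    using smooth_on_differentiable[OF smooth_on_frechet_derivative[OF curve_smooth[OF assms(1)]] t] by simp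
  then show "(velocity d \<gamma> has_vector_derivative vector_derivative (velocity d \<gamma>) (at t)) (at t)"
    by (simp add: vector_derivative_works[symmetric])
qed

text \<open>In a chart, \<open>ip (w s) Y\<close> is the metric pairing of the velocity with the
  left-invariant field of \<open>Y\<close>. The geodesic equation replaces the acceleration by
  derivatives of the metric; all of these cancel against the product rule and the energy identity,
  and the commutator of two left-invariant fields is left.\<close>

lemma geodesic_momentum_derivative:
  assumes w: "\<And>t. t \<in> T \<Longrightarrow> log_deriv \<gamma> t (w t)" and t: "t \<in> T"
  shows "((\<lambda>t. ip (w t) Y) has_real_derivative ip (w t) (br (w t) Y)) (at t)"
proof -
  obtain d where d: "d \<in> A" "\<gamma> t \<in> dom_of d" using chart_exists .
  let ?Q = "\<lambda>t. coord d (\<gamma> t)" and ?V = "velocity d \<gamma>" and ?W = "w t" and ?L = "lfield d Y"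
  let ?S = "T \<inter> \<gamma> -` dom_of d"
  define q where "q = ?Q t"
  define v where "v = ?V t"
  have S: "open ?S" "t \<in> ?S" using open_curve_dom d t by auto
  have q: "q \<in> coord d ` dom_of d" using d by (simp add: q_def)
  interpret scalar_product "g d q" by (rule inner_product_g[OF d(1) q])
  have V: "?V s = lfield d (w s) (?Q s)" if s: "s \<in> ?S" for s
  proof -
    have s': "s \<in> T" "\<gamma> s \<in> dom_of d" using s by auto
    have "((coord d \<circ> \<gamma>) has_vector_derivative lfield d (w s) (coord d (\<gamma> s))) (at s)"
      using log_deriv_iff_chart[where \<eta>=\<gamma> and t=s, OF d(1) s'(2)] w[OF s'(1)] by simp
    from vector_derivative_unique_at[OF velocity_derivative(1)[OF d(1) s'] this] show ?thesis .
  qed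
  have v: "v = lfield d ?W q" using V[OF S(2)] by (simp add: v_def q_def)
  have ip_eq: "g d (?Q s) (?V s) (?L (?Q s)) = ip (w s) Y" if "s \<in> ?S" for s
    using g_lfield[OF d(1), of "?Q s" "w s" Y] V[OF that] that by auto
  have QD: "(?Q has_derivative (\<lambda>h. h *\<^sub>R v)) (at t)"
    using velocity_derivative(1)[OF d(1) t d(2)] by (simp add: has_vector_derivative_def v_def comp_def)
  have VD: "(?V has_derivative (\<lambda>h. h *\<^sub>R vector_derivative ?V (at t))) (at t)"
    using velocity_derivative(2)[OF d(1) t d(2)] by (simp add: has_vector_derivative_def)
  have LD: "(lfield d X has_derivative frechet_derivative (lfield d X) (at q)) (at q)" for X
    by (rule smooth_on_has_derivative[OF smooth_lfield[OF d(1)] q])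
  have LQ: "((\<lambda>t. ?L (?Q t)) has_derivative (\<lambda>h. frechet_derivative ?L (at q) (h *\<^sub>R v))) (at t)"
    by (rule has_derivative_compose[OF QD LD[of Y, unfolded q_def], folded q_def])
  let ?G = "\<lambda>v w. frechet_derivative (\<lambda>q. g d q v w) (at q)"
  have lin: "linear (?G v w)" for v w
    by (intro linear_frechet_derivative smooth_on_differentiable[OF smooth_g[OF d(1)] q])
  have "((\<lambda>t. g d (?Q t) (?V t) (?L (?Q t))) has_derivative (\<lambda>h. g d q (h *\<^sub>R vector_derivative ?V (at t)) (?L q)
      + (g d q v (frechet_derivative ?L (at q) (h *\<^sub>R v)) + ?G v (?L q) (h *\<^sub>R v)))) (at t)"
    using metric_has_derivative[where Q="?Q" and X="?V" and Y="\<lambda>t. ?L (?Q t)" and p=t, OF d(1) q[unfolded q_def] QD VD LQ]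
    unfolding q_def[symmetric] v_def[symmetric] .
  moreover have "eventually (\<lambda>s. g d (?Q s) (?V s) (?L (?Q s)) = ip (w s) Y) (nhds t)"
    using eventually_nhds_in_open[OF S] by eventually_elim (rule ip_eq)
  ultimately have D: "((\<lambda>s. ip (w s) Y) has_derivative (\<lambda>h. g d q (h *\<^sub>R vector_derivative ?V (at t)) (?L q)
      + (g d q v (frechet_derivative ?L (at q) (h *\<^sub>R v)) + ?G v (?L q) (h *\<^sub>R v)))) (at t)"
    by (rule has_derivative_eventually_nhds)
  have "vector_derivative ?V (at t) = - christoffel g d q v v"
    using geodesic t d unfolding geodesic_on_def covariant_acceleration_def q_def v_def by (auto simp: eq_neg_iff_add_eq_0)
  then have acc: "g d q (vector_derivative ?V (at t)) (?L q) = - ?G v (?L q) v + ?G v v (?L q) / 2"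
    using christoffel[OF d(1) q, of v "?L q"] by (simp add: left_simps)
  \<comment> \<open>With the label frozen at \<open>?W = w t\<close>, the left-invariant field has
    constant energy near \<open>q\<close>. Its derivative along \<open>?L q\<close> trades the
    remaining derivative of the metric for a derivative of the field.\<close>
  have "((\<lambda>q. g d q (lfield d ?W q) (lfield d ?W q)) has_derivative
      (\<lambda>h. g d q (frechet_derivative (lfield d ?W) (at q) h) v + (g d q v (frechet_derivative (lfield d ?W) (at q) h)
        + ?G v v h))) (at q)"
    using metric_has_derivative[OF d(1), of "\<lambda>q. q" q, OF q _ LD[of ?W] LD[of ?W]] by (simp add: v)
  moreover have "eventually (\<lambda>q. g d q (lfield d ?W q) (lfield d ?W q) = ip ?W ?W) (nhds q)"
    using eventually_nhds_in_open[OF is_chartD(2)[OF chart[OF d(1)]] q] by eventually_elim (rule g_lfield[OF d(1)])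
  ultimately have "((\<lambda>q. ip ?W ?W) has_derivative
      (\<lambda>h. g d q (frechet_derivative (lfield d ?W) (at q) h) v + (g d q v (frechet_derivative (lfield d ?W) (at q) h)
        + ?G v v h))) (at q)"
    by (rule has_derivative_eventually_nhds)
  from fun_cong[OF has_derivative_unique[OF this has_derivative_const], of "?L q"]
  have energy: "?G v v (?L q) / 2 = - g d q v (frechet_derivative (lfield d ?W) (at q) (?L q))"
    by (simp add: commute[of _ v])
  have "g d q v (frechet_derivative ?L (at q) v) - g d q v (frechet_derivative (lfield d ?W) (at q) (?L q)) = ip ?W (br ?W Y)"
  proof -
    have "frechet_derivative ?L (at q) v - frechet_derivative (lfield d ?W) (at q) (?L q) = lfield d (br ?W Y) q"
      using lfield_commutator[OF d, of Y ?W] by (simp add: v q_def)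
    then have "g d q v (frechet_derivative ?L (at q) v - frechet_derivative (lfield d ?W) (at q) (?L q)) = ip ?W (br ?W Y)"
      using g_lfield[OF d(1) q, of ?W "br ?W Y"] by (simp add: v)
    then show ?thesis by (simp add: right_simps)
  qed
  then have "g d q (vector_derivative ?V (at t)) (?L q) + (g d q v (frechet_derivative ?L (at q) v) + ?G v (?L q) v) = ip ?W (br ?W Y)"
    using acc energy by simp
  moreover have "g d q (h *\<^sub>R vector_derivative ?V (at t)) (?L q)
      + (g d q v (frechet_derivative ?L (at q) (h *\<^sub>R v)) + ?G v (?L q) (h *\<^sub>R v))
      = h * (g d q (vector_derivative ?V (at t)) (?L q) + (g d q v (frechet_derivative ?L (at q) v) + ?G v (?L q) v))" for h
    by (simp add: left_simps right_simps linear_scale[OF lin] linear_scale[OF has_derivative_linear[OF LD]] algebra_simps)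
  ultimately show ?thesis using D by (simp add: has_field_derivative_def mult.commute[of "ip ?W (br ?W Y)"] mult_commute_abs)
qed

text \<open>The vectors \<open>e i\<close> are dual to the standard basis with respect to
  \<open>ip\<close>, so the scalar equations for the pairings with them reassemble the derivative of
  \<open>w\<close>.\<close>

theorem geodesic_euler_arnold:
  obtains w where "\<And>t. t \<in> T \<Longrightarrow> log_deriv \<gamma> t (w t)"
    "\<And>t. t \<in> T \<Longrightarrow> (w has_vector_derivative ad_adjoint ip br (w t) (w t)) (at t)"
proof -
  interpret scalar_product ip by (rule scalar_product_ip)
  have "\<exists>X. log_deriv \<gamma> t X" if "t \<in> T" for t
  proof -
    obtain d where d: "d \<in> A" "\<gamma> t \<in> dom_of d" using chart_exists .
    show ?thesis
      using log_deriv_of_chart[of d \<gamma> t, OF d isCont_curve[OF that] velocity_derivative(1)[OF d(1) that d(2)]] by blast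
  qed
  then obtain w where w: "\<And>t. t \<in> T \<Longrightarrow> log_deriv \<gamma> t (w t)" by metis
  define e where "e i = represent ip (\<lambda>w. w \<bullet> i)" for i
  have "ip (e i) X = X \<bullet> i" for i X
    unfolding e_def by (rule represent) (intro bounded_linear.linear bounded_linear_inner_left)
  then have expand: "X = (\<Sum>i\<in>Basis. ip X (e i) *\<^sub>R i)" for X
    by (simp add: commute[of X] euclidean_representation)
  have adj: "ip (ad_adjoint ip br X X) Y = ip X (br X Y)" for X Y
    unfolding ad_adjoint_def using represent[OF linear_compose[OF linear_lie_bracket_right linear_right, unfolded comp_def]] .
  have "(w has_vector_derivative ad_adjoint ip br (w t) (w t)) (at t)" if t: "t \<in> T" for t
  proof -
    have "((\<lambda>t. \<Sum>i\<in>Basis. ip (w t) (e i) *\<^sub>R i) has_vector_derivative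
      (\<Sum>i\<in>Basis. ip (w t) (br (w t) (e i)) *\<^sub>R i)) (at t)"
      using geodesic_momentum_derivative[OF w t]
      by (intro has_vector_derivative_sum) (auto simp: has_real_derivative_iff_has_vector_derivative
          intro!: bounded_linear.has_vector_derivative[OF bounded_linear_scaleR_left])
    then show ?thesis unfolding expand[symmetric] adj[symmetric] .
  qed
  then show ?thesis using that w by blast
qed

end

section \<open>Integration of the Euler--Arnold equation\<close>

lemma LBINT_has_vector_derivative:
  fixes f :: "real \<Rightarrow> 'a::euclidean_space"
  assumes "continuous_on UNIV f"
  shows "((\<lambda>t. LBINT s=0..t. f s) has_vector_derivative f t) (at t)"
proof -
  have "((\<lambda>u. LBINT s=ereal 0..u. f s) has_vector_derivative f t) (at t within {-\<bar>t\<bar>-1..\<bar>t\<bar>+1})"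
    by (rule interval_integral_FTC2) (auto intro: continuous_on_subset[OF assms])
  moreover have "at t within {-\<bar>t\<bar>-1..\<bar>t\<bar>+1} = at t" by (rule at_within_interior) auto
  ultimately show ?thesis unfolding zero_ereal_def by simp
qed

text \<open>With \<open>p\<close> a projection, the integral of a curve in its range stays in the
  range: \<open>p\<close> of the integral minus the integral has derivative 0 and vanishes at
  0.\<close>

lemma LBINT_linear_invariant:
  fixes f :: "real \<Rightarrow> 'a::euclidean_space" and t :: real
  assumes f: "continuous_on UNIV f" and p: "linear p" "\<And>s. p (f s) = f s"
  shows "p (LBINT s=0..t. f s) = (LBINT s=0..t. f s)"
proof -
  let ?F = "\<lambda>t::real. LBINT s=0..t. f s"
  have "((\<lambda>t. p (?F t) - ?F t) has_vector_derivative p (f t) - f t) (at t)" for t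
    by (intro has_vector_derivative_diff LBINT_has_vector_derivative[OF f]
        bounded_linear.has_vector_derivative[OF linear_conv_bounded_linear[THEN iffD1, OF p(1)]])
  then have "p (?F t) - ?F t = p (?F 0) - ?F 0"
    by (intro has_vector_derivative_zero_imp_eq[where T=UNIV and f="\<lambda>t. p (?F t) - ?F t"]) (simp_all add: p(2))
  then show ?thesis by (simp add: linear_0[OF p(1)] zero_ereal_def[symmetric])
qed

lemma funpow_cong_on:
  assumes "\<And>y. y \<in> S \<Longrightarrow> f y = g y" "\<And>y. y \<in> S \<Longrightarrow> g y \<in> S" "y \<in> S"
  shows "(f ^^ n) y = (g ^^ n) y \<and> (g ^^ n) y \<in> S"
  by (induction n) (use assms in auto)

lemma exp_op_mem:
  fixes J :: "'a::euclidean_space \<Rightarrow> 'a"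
  assumes "linear J" "subspace S" "\<And>y. y \<in> S \<Longrightarrow> J y \<in> S" "y \<in> S"
  shows "exp_op t J y \<in> S"
proof (rule closed_sequentially)
  show "closed S" by (rule closed_subspace[OF assms(2)])
  have "(J ^^ n) y \<in> S" for n by (induction n) (use assms in auto)
  then show "(\<Sum>i<n. (t ^ i / fact i) *\<^sub>R (J ^^ i) y) \<in> S" for n
    using assms(2) by (intro subspace_sum subspace_scale) auto
  show "(\<lambda>n. \<Sum>i<n. (t ^ i / fact i) *\<^sub>R (J ^^ i) y) \<longlonglongrightarrow> exp_op t J y"
    using exp_op_sums[OF assms(1)] by (simp add: sums_def)
qed

lemma subspace_lie_center: "bounded_bilinear br \<Longrightarrow> subspace (lie_center br)"
  unfolding lie_center_def
  by (rule subspaceI) (auto simp: bounded_bilinear.zero_left bounded_bilinear.add_left bounded_bilinear.scaleR_left)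

text \<open>The part of the data that does not mention the group. With \<open>br\<close> and
  \<open>ip\<close> abstract, integrating the equation is linear algebra and one-variable
  calculus.\<close>

locale two_step_geodesic_data = center_decomposition ip "lie_center br" U Z V E
  for ip br and U Z V E :: "'a::euclidean_space set" +
  fixes E1 E2 :: "'a set" and u0 z0 v0 e0 e1 e2 y1 y2 x1 x2 :: 'a
    and JE JU J Ji :: "'a \<Rightarrow> 'a" and x z u \<I> :: "real \<Rightarrow> 'a"
  assumes br: "bounded_bilinear br" and alternating: "\<And>a. br a a = 0" and nilpotent: "two_step_nilpotent br"
    and in_parts: "u0 \<in> U" "z0 \<in> Z" "v0 \<in> V" "e0 \<in> E"
    and JE: "JE = restrict (\<lambda>y. component E (span (U \<union> Z \<union> V)) (ad_adjoint ip br y (z0 + v0))) (span (V \<union> E))"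
    and JU: "JU = restrict (\<lambda>y. component U (span (Z \<union> V \<union> E)) (ad_adjoint ip br y (z0 + v0))) (span (V \<union> E))"
    and J: "J = restrict JE E"
    and E1: "E1 = {y \<in> E. J y = 0}"
    and E2: "subspace E2" "E = span (E1 \<union> E2)" "E1 \<inter> E2 = {0}" "\<forall>a\<in>E1. \<forall>b\<in>E2. ip a b = 0"
    and Ji: "Ji = inv_into E2 J"
    and y12: "JE v0 = y1 + y2" "y1 \<in> E1" "y2 \<in> E2"
    and e12: "e0 = e1 + e2" "e1 \<in> E1" "e2 \<in> E2"
    and x1: "x1 = e1 + v0 - Ji y2"
    and x2: "x2 = e2 + Ji y2"
    and x: "x = (\<lambda>t. t *\<^sub>R x1 + (exp_op t J (Ji x2) - Ji x2) + (t\<^sup>2 / 2) *\<^sub>R y1)"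
    and \<I>: "\<I> = (\<lambda>t. - (1/2) *\<^sub>R (LBINT s=0..t. br (vector_derivative x (at s)) (x s)))"
    and z: "z = (\<lambda>t. t *\<^sub>R z0 + component Z (span (U \<union> V \<union> E)) (\<I> t))"
    and u: "u = (\<lambda>t. t *\<^sub>R u0 + component U (span (Z \<union> V \<union> E)) (\<I> t)
                 + (LBINT s=0..t. (LBINT r=0..s. JU (vector_derivative x (at r)))))"
begin

abbreviation "pE \<equiv> component E (span (U \<union> Z \<union> V))"
abbreviation "pU \<equiv> component U (span (Z \<union> V \<union> E))"
abbreviation "pZ \<equiv> component Z (span (U \<union> V \<union> E))"

text \<open>The operator of the linearised equation: the second argument of the adjoint is frozen at
  the conserved momentum.\<close>

definition K :: "'a \<Rightarrow> 'a" where "K y = ad_adjoint ip br y (z0 + v0)"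
text \<open>A linear map on the whole space that agrees with \<open>J\<close> on \<open>E\<close>
  and with \<open>JE\<close> on \<open>span (V \<union> E)\<close>; those two are
  \<open>undefined\<close> elsewhere and so are not linear maps.\<close>

definition Je :: "'a \<Rightarrow> 'a" where "Je y = pE (K y)"

lemmas br_simps = bounded_bilinear.add_left[OF br] bounded_bilinear.add_right[OF br]
  bounded_bilinear.diff_left[OF br] bounded_bilinear.diff_right[OF br]
  bounded_bilinear.minus_left[OF br] bounded_bilinear.minus_right[OF br]
  bounded_bilinear.scaleR_left[OF br] bounded_bilinear.scaleR_right[OF br]
  bounded_bilinear.zero_left[OF br] bounded_bilinear.zero_right[OF br]

section \<open>The operators \<open>K\<close> and \<open>Je\<close>, and invertibility of
  \<open>J\<close> on \<open>E2\<close>\<close>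

lemma antisym: "br a b = - br b a"
  using alternating[of "a + b"] alternating[of a] alternating[of b] by (simp add: br_simps eq_neg_iff_add_eq_0 add.commute)

lemma br_center: "br a b \<in> lie_center br" using nilpotent by (simp add: two_step_nilpotent_def)

lemma center_br: "a \<in> lie_center br \<Longrightarrow> br a b = 0" "a \<in> lie_center br \<Longrightarrow> br b a = 0"
  using antisym[of b a] by (auto simp: lie_center_def)

lemma adjoint: "ip (ad_adjoint ip br a b) w = ip b (br a w)"
proof -
  have "linear (br a)" using br by (simp add: bounded_linear.linear[OF bounded_bilinear.bounded_linear_right])
  from linear_compose[OF this linear_right[of b]] have "linear (\<lambda>w. ip b (br a w))" by (simp add: comp_def)
  then show ?thesis unfolding ad_adjoint_def by (rule represent)
qed

lemma K_ip: "ip (K y) w = ip (z0 + v0) (br y w)"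
  by (simp add: K_def adjoint)

lemma linear_K: "linear K"
  by (rule linearI; rule eqI) (simp_all add: K_ip br_simps left_simps right_simps)

lemma K_center: "a \<in> lie_center br \<Longrightarrow> K a = 0"
  by (rule eqI) (simp add: K_ip center_br left_simps right_simps)

text \<open>A bracket with a central vector vanishes, so every value of \<open>K\<close> is
  orthogonal to the centre and has no \<open>Z\<close>- or \<open>V\<close>-part.\<close>

lemma K_split: "K y = pU (K y) + pE (K y)"
  by (rule perp_C) (simp add: K_ip center_br right_simps)

lemma linear_Je: "linear Je"
  using linear_compose[OF linear_K cE.linear_component] by (simp add: Je_def[abs_def] comp_def)

lemma Je_E: "Je y \<in> E" by (simp add: Je_def cE.component_mem)

lemma J_eq: "y \<in> E \<Longrightarrow> J y = Je y"
  by (simp add: J JE Je_def K_def span_base)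

lemma JE_eq: "y \<in> span (V \<union> E) \<Longrightarrow> JE y = Je y" and JU_eq: "y \<in> span (V \<union> E) \<Longrightarrow> JU y = pU (K y)"
  by (simp_all add: JE JU Je_def K_def)

text \<open>The \<open>U\<close>-part of \<open>K a\<close> is invisible to \<open>E\<close>, so
  \<open>Je\<close> inherits the bracket formula of \<open>K\<close>; antisymmetry of the bracket
  then makes it skew-adjoint on \<open>E\<close>.\<close>

lemma Je_ip: "b \<in> E \<Longrightarrow> ip (Je a) b = ip (z0 + v0) (br a b)"
  using orthogonal(4)[of b "pU (K a)"] cU.component_mem(1)[of "K a"] K_split[of a] K_ip[of a b]
  by (metis Je_def UnI1 add_0 left_simps(2))

lemma Je_skew: "a \<in> E \<Longrightarrow> b \<in> E \<Longrightarrow> ip (Je a) b = - ip a (Je b)"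
  using Je_ip[of b a] Je_ip[of a b] antisym[of a b] commute[of a "Je b"] by (simp add: right_simps)

lemma subspace_E1: "subspace E1"
proof -
  have "E1 = E \<inter> {y. Je y = 0}" unfolding E1 using J_eq by auto
  moreover have "subspace {y. Je y = 0}"
    by (rule subspaceI) (auto simp: linear_0[OF linear_Je] linear_add[OF linear_Je] linear_scale[OF linear_Je])
  ultimately show ?thesis using subspaces(3) subspace_inter by metis
qed

lemma E_sum: "E = {a + b | a b. a \<in> E1 \<and> b \<in> E2}"
  unfolding E2(2) using subspace_E1 E2(1) by (simp add: span_Un span_eq_iff[THEN iffD2])

lemma E12_E: "y \<in> E1 \<Longrightarrow> y \<in> E" "y \<in> E2 \<Longrightarrow> y \<in> E"
  unfolding E2(2) by (auto simp: span_base)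

lemma Je_E1: "y \<in> E1 \<Longrightarrow> Je y = 0" using E1 J_eq by auto

text \<open>By skew-adjointness the image of \<open>Je\<close> on \<open>E\<close> is orthogonal to
  its kernel \<open>E1\<close>. Hence the \<open>E1\<close>-part of \<open>Je y\<close> is
  orthogonal to both summands of \<open>E\<close>, on which the form is nondegenerate.\<close>

lemma Je_E2:
  assumes y: "y \<in> E2" shows "Je y \<in> E2"
proof -
  obtain a b where ab: "Je y = a + b" "a \<in> E1" "b \<in> E2" using Je_E[of y] E_sum by auto
  have "ip a e = 0" if e: "e \<in> E" for e
  proof -
    obtain e1 e2 where d: "e = e1 + e2" "e1 \<in> E1" "e2 \<in> E2" using e E_sum by auto
    have "ip (Je y) e1 = 0" using Je_skew[of y e1] E12_E y d Je_E1 by (simp add: right_simps)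
    moreover have "ip b e1 = 0" "ip a e2 = 0" using E2(4) ab d commute[of b e1] by auto
    ultimately show ?thesis by (simp add: ab(1) d(1) left_simps right_simps)
  qed
  then have "a = 0" using ab E12_E by (intro E_nondegenerate) auto
  then show ?thesis using ab by simp
qed

lemma inj_Je: "inj_on Je E2"
proof (rule inj_onI)
  fix a b assume ab: "a \<in> E2" "b \<in> E2" "Je a = Je b"
  then have "a - b \<in> E2" "Je (a - b) = 0" using E2(1) subspace_diff by (auto simp: linear_diff[OF linear_Je])
  moreover have "a - b \<in> E1" unfolding E1 using J_eq E12_E(2) calculation by simp
  ultimately have "a - b \<in> E1 \<inter> E2" by simp
  then show "a = b" using E2(3) by simp
qed

text \<open>The kernel of \<open>Je\<close> on \<open>E\<close> meets \<open>E2\<close> trivially,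
  and an injective linear map of a finite-dimensional space into itself is onto.\<close>

lemma bij_Je: "bij_betw Je E2 E2"
proof -
  have "span E2 = E2" using E2(1) by simp
  then have "dim (Je ` E2) = dim E2" using inj_Je dim_image_eq[OF linear_Je] by metis
  then have "Je ` E2 = E2"
    using E2(1) Je_E2 linear_subspace_image[OF linear_Je] by (intro subspace_dim_equal) auto
  then show ?thesis using inj_Je by (simp add: bij_betw_def)
qed

lemma bij_J: "bij_betw J E2 E2"
  using bij_Je bij_betw_cong[of E2 J Je E2] J_eq E12_E by blast

lemma Ji_mem: "y \<in> E2 \<Longrightarrow> Ji y \<in> E2" and Je_Ji: "y \<in> E2 \<Longrightarrow> Je (Ji y) = y"
proof -
  assume y: "y \<in> E2"
  show "Ji y \<in> E2" unfolding Ji using y bij_J inv_into_into by (metis bij_betw_def)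
  moreover have "J (Ji y) = y" unfolding Ji using y bij_J f_inv_into_f by (metis bij_betw_def)
  ultimately show "Je (Ji y) = y" using J_eq E12_E by metis
qed

section \<open>The curve \<open>x\<close> and its velocity\<close>

lemma x2_mem: "x2 \<in> E2" unfolding x2 using e12 y12 Ji_mem E2(1) subspace_add by auto

lemma exp_J: "y \<in> E2 \<Longrightarrow> exp_op t J y = exp_op t Je y"
  unfolding exp_op_def using funpow_cong_on[of E2 J Je y] J_eq E12_E Je_E2 by simp

lemma exp_mem: "y \<in> E2 \<Longrightarrow> exp_op t Je y \<in> E2"
  by (rule exp_op_mem[OF linear_Je E2(1) Je_E2])

lemma exp_Ji_deriv: "y \<in> E2 \<Longrightarrow> ((\<lambda>t. exp_op t Je (Ji y)) has_vector_derivative exp_op t Je y) (at t)"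
  using exp_op_has_vector_derivative[OF linear_Je, where y="Ji y" and t=t] by (simp add: Je_Ji)

definition dx :: "real \<Rightarrow> 'a" where "dx t = x1 + exp_op t Je x2 + t *\<^sub>R y1"

lemma x_eq: "x t = t *\<^sub>R x1 + (exp_op t Je (Ji x2) - Ji x2) + (t\<^sup>2 / 2) *\<^sub>R y1"
  by (simp add: x exp_J[OF Ji_mem[OF x2_mem]])

lemma x_deriv: "(x has_vector_derivative dx t) (at t)"
proof -
  have "((\<lambda>t. (t\<^sup>2 / 2) *\<^sub>R y1) has_vector_derivative t *\<^sub>R y1) (at t)"
    by (rule bounded_linear.has_vector_derivative[OF bounded_linear_scaleR_left])
      (auto intro!: derivative_eq_intros simp: has_real_derivative_iff_has_vector_derivative[symmetric])
  moreover have "((\<lambda>t. t *\<^sub>R x1) has_vector_derivative x1) (at t)" by (auto intro!: derivative_eq_intros)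
  moreover have "((\<lambda>t. exp_op t Je (Ji x2) - Ji x2) has_vector_derivative exp_op t Je x2 - 0) (at t)"
    by (intro has_vector_derivative_diff exp_Ji_deriv[OF x2_mem] has_vector_derivative_const)
  ultimately have "((\<lambda>t. t *\<^sub>R x1 + (exp_op t Je (Ji x2) - Ji x2) + (t\<^sup>2 / 2) *\<^sub>R y1) has_vector_derivative
      x1 + (exp_op t Je x2 - 0) + t *\<^sub>R y1) (at t)"
    by (intro has_vector_derivative_add)
  then show ?thesis unfolding x_eq[abs_def] dx_def by simp
qed

lemma vector_derivative_x: "vector_derivative x (at t) = dx t"
  by (rule vector_derivative_at[OF x_deriv])

lemma E_span: "y \<in> E \<Longrightarrow> y \<in> span (V \<union> E)" "y \<in> V \<Longrightarrow> y \<in> span (V \<union> E)"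
  by (auto simp: span_base)

lemma x1_span: "x1 \<in> span (V \<union> E)"
  unfolding x1 using e12 y12 in_parts Ji_mem E12_E
  by (intro span_add span_diff) (auto intro: E_span)

lemma x_span: "x t \<in> span (V \<union> E)"
  unfolding x_eq by (intro span_add span_diff span_scale x1_span E_span(1) E12_E(2) exp_mem Ji_mem x2_mem E12_E(1) y12(2))

lemma dx_span: "dx t \<in> span (V \<union> E)"
  unfolding dx_def by (intro span_add span_diff span_scale x1_span E_span(1) E12_E(2) exp_mem Ji_mem x2_mem E12_E(1) y12(2))

text \<open>\<open>Je\<close> sends \<open>x1\<close> to \<open>y1\<close>: it kills
  \<open>e1\<close>, sends \<open>v0\<close> to \<open>y1 + y2\<close>, and the shift by
  \<open>Ji y2\<close> removes \<open>y2\<close>. Since \<open>y1\<close> lies in the kernel, the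
  term linear in \<open>t\<close> contributes nothing further.\<close>

lemma dx_deriv: "(dx has_vector_derivative Je (dx t)) (at t)"
proof -
  have "(dx has_vector_derivative exp_op t Je (Je x2) + y1) (at t)"
    unfolding dx_def[abs_def]
    by (rule derivative_eq_intros exp_op_has_vector_derivative[OF linear_Je] refl)+ simp
  moreover have "Je (dx t) = exp_op t Je (Je x2) + y1"
  proof -
    have v: "Je v0 = y1 + y2" using JE_eq[OF E_span(2)[OF in_parts(3)]] y12(1) by simp
    have "Je (dx t) = (Je e1 + Je v0 - Je (Ji y2)) + Je (exp_op t Je x2) + t *\<^sub>R Je y1"
      unfolding dx_def unfolding x1
      by (simp only: linear_add[OF linear_Je] linear_diff[OF linear_Je] linear_scale[OF linear_Je])
    then show ?thesis
      unfolding v Je_Ji[OF y12(3)] Je_E1[OF e12(2)] Je_E1[OF y12(2)] exp_op_linear_image[OF linear_Je]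
      by simp
  qed
  ultimately show ?thesis by simp
qed

lemma dx_0: "dx 0 = v0 + e0"
  unfolding dx_def by (simp add: x1 x2 e12(1))

lemma continuous_of_deriv: "(\<And>t. (f has_vector_derivative f' t) (at t)) \<Longrightarrow> continuous_on UNIV f"
  for f :: "real \<Rightarrow> 'a"
  by (meson continuous_at_imp_continuous_on has_vector_derivative_continuous)

lemmas continuous_x = continuous_of_deriv[OF x_deriv] and continuous_dx = continuous_of_deriv[OF dx_deriv]

lemma \<I>_deriv: "(\<I> has_vector_derivative - (1/2) *\<^sub>R br (dx t) (x t)) (at t)"
proof -
  have "continuous_on UNIV (\<lambda>s. br (dx s) (x s))"
    by (rule bounded_bilinear.continuous_on[OF br continuous_dx continuous_x])
  from LBINT_has_vector_derivative[OF this, of t] show ?thesis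
    unfolding \<I> vector_derivative_x by (auto intro!: derivative_eq_intros)
qed

lemma \<I>_0: "\<I> 0 = 0" by (simp add: \<I> zero_ereal_def[symmetric])

lemma br_deriv:
  "(f has_vector_derivative f') (at t) \<Longrightarrow> (h has_vector_derivative h') (at t) \<Longrightarrow>
   ((\<lambda>t. br (f t) (h t)) has_vector_derivative br (f t) h' + br f' (h t)) (at t)" for t :: real
  by (rule bounded_bilinear.has_vector_derivative[OF br])

text \<open>Checked rather than derived: the right-hand side \<open>R\<close> has the same
  derivative as \<open>\<I>\<close>, and both vanish at 0.\<close>

lemma \<I>_formula:
  fixes t :: real
  shows "\<I> t = (t / 2) *\<^sub>R br (x1 + (t / 2) *\<^sub>R y1) (exp_op t J (Ji x2) + Ji x2)
        - t *\<^sub>R br y1 (exp_op t J (Ji (Ji x2)))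
        + (t ^ 3 / 12) *\<^sub>R br x1 y1
        + (1/2) *\<^sub>R br (exp_op t J (Ji x2) - Ji x2) (Ji x2)
        - br x1 (exp_op t J (Ji (Ji x2)) - Ji (Ji x2))
        + br y1 (exp_op t J (Ji (Ji (Ji x2))) - Ji (Ji (Ji x2)))
        + (1/2) *\<^sub>R (LBINT s=0..t. br (exp_op s J (Ji x2)) (exp_op s J x2))"
proof -
  note m1 = Ji_mem[OF x2_mem] note m2 = Ji_mem[OF m1] note m3 = Ji_mem[OF m2]
  define w1 w2 w3 where w: "w1 = Ji x2" "w2 = Ji w1" "w3 = Ji w2"
  \<comment> \<open>Each application of \<open>Ji\<close> undoes one differentiation of the
    exponential, so \<open>a1\<close>, \<open>a2\<close>, \<open>a3\<close> are successive
    antiderivatives of \<open>b\<close>. The bracket of \<open>a1\<close> with \<open>b\<close> is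
    the one left under the integral.\<close>
  define b a1 a2 a3 where ab: "b t = exp_op t Je x2" "a1 t = exp_op t Je w1" "a2 t = exp_op t Je w2" "a3 t = exp_op t Je w3" for t
  have D: "(a1 has_vector_derivative b t) (at t)" "(a2 has_vector_derivative a1 t) (at t)" "(a3 has_vector_derivative a2 t) (at t)" for t
    unfolding ab[abs_def] w using exp_Ji_deriv[OF x2_mem] exp_Ji_deriv[OF m1] exp_Ji_deriv[OF m2] by auto
  have cb: "continuous_on UNIV b"
    unfolding ab[abs_def] by (rule continuous_of_deriv[OF exp_op_has_vector_derivative[OF linear_Je]])
  have "continuous_on UNIV (\<lambda>s. br (a1 s) (b s))"
    by (rule bounded_bilinear.continuous_on[OF br continuous_of_deriv[OF D(1)] cb])
  note L = LBINT_has_vector_derivative[OF this]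
  define R where "R t = (t / 2) *\<^sub>R br (x1 + (t / 2) *\<^sub>R y1) (a1 t + w1) - t *\<^sub>R br y1 (a2 t) + (t ^ 3 / 12) *\<^sub>R br x1 y1
        + (1/2) *\<^sub>R br (a1 t - w1) w1 - br x1 (a2 t - w2) + br y1 (a3 t - w3)
        + (1/2) *\<^sub>R (LBINT s=0..t. br (a1 s) (b s))" for t
  \<comment> \<open>Fixes one order for each bracket, so that comparing derivatives becomes an
    identity linear in the brackets, which can be verified coordinate by coordinate.\<close>
  have swap: "br y1 x1 = - br x1 y1" "br (b t) x1 = - br x1 (b t)" "br (b t) y1 = - br y1 (b t)" "br (b t) (a1 t) = - br (a1 t) (b t)" for t
    by (rule antisym)+
  have c: "((\<lambda>t. v) has_vector_derivative 0) (at t)" for v :: 'a and t :: real by simp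
  have lin: "((\<lambda>t. x1 + (t / 2) *\<^sub>R y1) has_vector_derivative (1/2) *\<^sub>R y1) (at t)" for t
    by (auto intro!: derivative_eq_intros)
  have R': "(R has_vector_derivative
      ((t / 2) *\<^sub>R (br (x1 + (t / 2) *\<^sub>R y1) (b t + 0) + br ((1/2) *\<^sub>R y1) (a1 t + w1)) + (1/2) *\<^sub>R br (x1 + (t / 2) *\<^sub>R y1) (a1 t + w1))
      - (t *\<^sub>R (br y1 (a1 t) + br 0 (a2 t)) + 1 *\<^sub>R br y1 (a2 t)) + (t\<^sup>2 / 4) *\<^sub>R br x1 y1
      + (1/2) *\<^sub>R (br (a1 t - w1) 0 + br (b t - 0) w1) - (br x1 (a1 t - 0) + br 0 (a2 t - w2)) + (br y1 (a2 t - 0) + br 0 (a3 t - w3))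
      + (1/2) *\<^sub>R br (a1 t) (b t)) (at t)" for t
    unfolding R_def[abs_def]
    by (intro has_vector_derivative_add has_vector_derivative_diff has_vector_derivative_scaleR br_deriv c D lin
        bounded_linear.has_vector_derivative[OF bounded_linear_scaleR_right]
        bounded_linear.has_vector_derivative[OF bounded_linear_scaleR_left] L)
      (auto intro!: derivative_eq_intros simp: has_real_derivative_iff_has_vector_derivative[symmetric] power2_eq_square)
  have "((\<lambda>t. R t - \<I> t) has_vector_derivative 0) (at t)" for t
  proof -
    have dx: "dx t = x1 + b t + t *\<^sub>R y1" and x: "x t = t *\<^sub>R x1 + (a1 t - w1) + (t\<^sup>2 / 2) *\<^sub>R y1"
      by (simp_all add: dx_def x_eq ab w)
    have expand: "br (dx t) (x t) = - (t\<^sup>2 / 2) *\<^sub>R br x1 y1 + br x1 (a1 t) - br x1 w1 + t *\<^sub>R br y1 (a1 t) - t *\<^sub>R br y1 w1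
        - t *\<^sub>R br x1 (b t) - (t\<^sup>2 / 2) *\<^sub>R br y1 (b t) - br (a1 t) (b t) - br (b t) w1"
      unfolding dx x
      by (simp only: br_simps alternating swap, rule euclidean_eqI)
        (simp add: inner_add_left inner_diff_left field_simps power2_eq_square)
    show ?thesis
      by (rule has_vector_derivative_eq_rhs[OF has_vector_derivative_diff[OF R'[of t] \<I>_deriv[of t]]], unfold expand,
        simp only: br_simps, rule euclidean_eqI)
        (simp add: inner_add_left inner_diff_left field_simps power2_eq_square)
  qed
  then have "R t - \<I> t = R 0 - \<I> 0" for t
    by (rule has_vector_derivative_zero_imp_eq[OF convex_UNIV]) auto
  moreover have "R 0 = 0" by (simp add: R_def ab br_simps zero_ereal_def[symmetric])
  ultimately have "\<I> t = R t" by (simp add: \<I>_0)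
  then show ?thesis
    unfolding R_def ab w using exp_J[OF x2_mem] exp_J[OF m1] exp_J[OF m2] exp_J[OF m3] by simp
qed

text \<open>The inner of the two integrals in \<open>u\<close>; \<open>u0 + P t\<close> will be the
  \<open>U\<close>-part of the logarithmic derivative.\<close>

definition P :: "real \<Rightarrow> 'a" where "P t = (LBINT r=0..t. JU (vector_derivative x (at r)))"

lemma P_deriv: "(P has_vector_derivative pU (K (dx t))) (at t)" and P_mem: "P t \<in> U"
proof -
  have eq: "P = (\<lambda>t. LBINT r=0..t. pU (K (dx r)))"
    by (simp add: P_def fun_eq_iff vector_derivative_x JU_eq[OF dx_span])
  have "bounded_linear (\<lambda>y. pU (K y))"
    using linear_compose[OF linear_K cU.linear_component] by (simp add: comp_def linear_conv_bounded_linear)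
  then have cont: "continuous_on UNIV (\<lambda>t. pU (K (dx t)))"
    by (rule bounded_linear.continuous_on[OF _ continuous_dx])
  show "(P has_vector_derivative pU (K (dx t))) (at t)"
    unfolding eq by (rule LBINT_has_vector_derivative[OF cont])
  have "pU (P t) = P t"
    unfolding eq by (rule LBINT_linear_invariant[OF cont cU.linear_component])
      (rule cU.component_left[OF cU.component_mem(1)])
  then show "P t \<in> U" by (metis cU.component_mem(1))
qed

lemma u_eq: "u t = t *\<^sub>R u0 + pU (\<I> t) + (LBINT s=0..t. P s)"
  by (simp add: u P_def)

lemma u_mem: "u t \<in> U"
proof -
  have "pU (LBINT s=0..t. P s) = (LBINT s=0..t. P s)"
    by (rule LBINT_linear_invariant[OF continuous_of_deriv[OF P_deriv] cU.linear_component])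
      (rule cU.component_left[OF P_mem])
  then have "(LBINT s=0..t. P s) \<in> U" by (metis cU.component_mem(1))
  then show ?thesis
    unfolding u_eq by (intro subspace_add subspace_scale subspaces(1) in_parts(1) cU.component_mem(1))
qed

lemma z_mem: "z t \<in> Z"
  unfolding z by (intro subspace_add subspace_scale subspaces(2) in_parts(2) cZ.component_mem(1))

lemma center_split: "a \<in> lie_center br \<Longrightarrow> pU a + pZ a = a"
proof -
  assume "a \<in> lie_center br"
  then obtain u' z' where a: "u' \<in> U" "z' \<in> Z" "a = u' + z'" by (rule C_decomposition)
  have "pU a = u'" "pZ a = z'"
    using a by (auto intro!: cU.component_eq cZ.component_eq simp: span_base)
  then show ?thesis using a by simp
qed

text \<open>The \<open>U\<close>- and \<open>Z\<close>-parts of \<open>\<I>\<close> recombine,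
  because brackets are central, and contribute half of \<open>br (x t) (dx t)\<close> to the
  derivative of the exponent. The correction term of the logarithmic derivative sees only
  \<open>x\<close> and \<open>dx\<close> and cancels exactly this.\<close>

lemma log_deriv_formula:
  obtains n' where "((\<lambda>t. u t + z t + x t) has_vector_derivative n') (at t)"
    "n' - (1/2) *\<^sub>R br (u t + z t + x t) n' = u0 + P t + z0 + dx t"
proof -
  let ?c = "- (1/2) *\<^sub>R br (dx t) (x t)"
  define n' where "n' = u0 + pU ?c + P t + (z0 + pZ ?c) + dx t"
  have p: "((\<lambda>t. pU (\<I> t)) has_vector_derivative pU ?c) (at t)" "((\<lambda>t. pZ (\<I> t)) has_vector_derivative pZ ?c) (at t)"
    by (intro bounded_linear.has_vector_derivative[OF linear_conv_bounded_linear[THEN iffD1] \<I>_deriv] cU.linear_component cZ.linear_component)+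
  have l: "((\<lambda>t. t *\<^sub>R a) has_vector_derivative a) (at t)" for a :: 'a
    by (auto intro!: derivative_eq_intros)
  have "((\<lambda>t. u t + z t + x t) has_vector_derivative n') (at t)"
    unfolding u_eq z n'_def
    by (intro has_vector_derivative_add l p x_deriv LBINT_has_vector_derivative continuous_of_deriv[OF P_deriv])
  moreover have n': "n' = (u0 + P t + z0 + ?c) + dx t"
  proof -
    have "?c \<in> lie_center br" using br_center subspace_scale[OF C] by blast
    from center_split[OF this] show ?thesis by (simp add: n'_def algebra_simps)
  qed
  moreover have "n' - (1/2) *\<^sub>R br (u t + z t + x t) n' = u0 + P t + z0 + dx t"
  proof -
    have "u t \<in> lie_center br" "z t \<in> lie_center br" "u0 \<in> lie_center br" "P t \<in> lie_center br" "z0 \<in> lie_center br"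
      using u_mem z_mem P_mem in_parts U_C Z_C by auto
    moreover have "?c \<in> lie_center br" using br_center subspace_scale[OF C] by blast
    ultimately have "br (u t + z t + x t) ((u0 + P t + z0 + ?c) + dx t) = br (x t) (dx t)"
      by (simp only: br_simps(1,2) center_br add_0 add_0_right)
    also have "\<dots> = - br (dx t) (x t)" by (rule antisym)
    finally have "br (u t + z t + x t) n' = - br (dx t) (x t)" unfolding n' .
    then show ?thesis by (simp add: n')
  qed
  ultimately show ?thesis by (intro that[of n'])
qed

lemma velocity_formula:
  assumes T: "open T" "is_interval T" "0 \<in> T"
    and w: "\<And>t. t \<in> T \<Longrightarrow> (w has_vector_derivative ad_adjoint ip br (w t) (w t)) (at t)"
    and w0: "w 0 = u0 + z0 + v0 + e0" and t: "t \<in> T"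
  shows "w t = u0 + P t + z0 + dx t"
proof -
  \<comment> \<open>The derivative of the pairing is \<open>ip (w t) (br (w t) Y)\<close>, which is
    0 for central \<open>Y\<close>. In the initial value \<open>u0\<close> and \<open>e0\<close>
    drop out, being orthogonal to the centre.\<close>
  have momentum: "ip (w t) Y = ip (z0 + v0) Y" if t: "t \<in> T" and Y: "Y \<in> lie_center br" for t Y
  proof -
    have "((\<lambda>t. ip (w t) Y) has_vector_derivative 0) (at t)" if "t \<in> T" for t
      using bounded_linear.has_vector_derivative[OF bounded_bilinear.bounded_linear_left[OF bounded_bilinear] w[OF that], of Y]
      by (simp add: adjoint center_br(2)[OF Y] right_simps)
    then have "ip (w t) Y = ip (w 0) Y"
      using T t by (intro has_vector_derivative_zero_imp_eq[where f="\<lambda>t. ip (w t) Y" and T=T]) (auto simp: is_interval_convex)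
    also have "\<dots> = ip u0 Y + ip (z0 + v0) Y + ip e0 Y" by (simp add: w0 left_simps)
    also have "ip u0 Y = 0" using orthogonal(1) in_parts Y by blast
    also have "ip e0 Y = 0"
      by (rule C_decomposition[OF Y]) (use orthogonal(3)[OF in_parts(4)] in \<open>simp add: right_simps\<close>)
    finally show ?thesis by simp
  qed
  \<comment> \<open>The adjoint pairs \<open>w t\<close> only with brackets, and these are central,
    so \<open>momentum\<close> replaces it by \<open>z0 + v0\<close> and the quadratic equation
    becomes linear.\<close>
  have wK: "(w has_vector_derivative K (w t)) (at t)" if "t \<in> T" for t
  proof -
    have "ad_adjoint ip br (w t) (w t) = K (w t)"
      by (rule eqI) (simp add: adjoint K_ip momentum[OF that br_center])
    then show ?thesis using w[OF that] by simp
  qed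
  \<comment> \<open>The explicit curve solves the same equation: its derivative is
    \<open>K (dx t)\<close> by \<open>K_split\<close>, and \<open>K\<close> does not see the central
    terms \<open>u0\<close>, \<open>P t\<close> and \<open>z0\<close>.\<close>
  have "w t - (u0 + P t + z0 + dx t) = 0"
  proof (rule linear_ode_zero[OF linear_K T(2,1,3) _ _ t, where d="\<lambda>t. w t - (u0 + P t + z0 + dx t)"])
    show "w 0 - (u0 + P 0 + z0 + dx 0) = 0"
      by (simp add: w0 dx_0 P_def zero_ereal_def[symmetric])
    fix t assume t: "t \<in> T"
    have "((\<lambda>t. w t - (u0 + P t + z0 + dx t)) has_vector_derivative K (w t) - (0 + pU (K (dx t)) + 0 + Je (dx t))) (at t)"
      by (intro has_vector_derivative_diff has_vector_derivative_add has_vector_derivative_const wK t P_deriv dx_deriv)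
    moreover have "0 + pU (K (dx t)) + 0 + Je (dx t) = K (dx t)" using K_split[of "dx t"] by (simp add: Je_def)
    moreover have "K (w t - (u0 + P t + z0 + dx t)) = K (w t) - K (dx t)"
    proof -
      have "K u0 = 0" "K (P t) = 0" "K z0 = 0"
        using P_mem in_parts U_C Z_C by (auto intro!: K_center)
      then show ?thesis by (simp add: linear_diff[OF linear_K] linear_add[OF linear_K])
    qed
    ultimately show "((\<lambda>t. w t - (u0 + P t + z0 + dx t)) has_vector_derivative
        K (w t - (u0 + P t + z0 + dx t))) (at t)" by simp
  qed
  then show ?thesis by simp
qed

lemma uzx_0: "u 0 + z 0 + x 0 = 0"
  by (simp add: u_eq z x_eq \<I>_0 linear_0[OF cU.linear_component] linear_0[OF cZ.linear_component] zero_ereal_def[symmetric])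

end

theorem theorem4p11:
  fixes G :: "'g::{t2_space, second_countable_topology} monoid"
    and A :: "('g, 'a::euclidean_space) chart set"
    and g :: "('g, 'a) metric"
    and c :: "('g, 'a) chart"
    and br :: "'a \<Rightarrow> 'a \<Rightarrow> 'a"
    and ip :: "'a \<Rightarrow> 'a \<Rightarrow> real"
    and U Z V E E\<^sub>1 E\<^sub>2 :: "'a set"
    and \<gamma> :: "real \<Rightarrow> 'g"
    and T :: "real set"
    and u\<^sub>0 z\<^sub>0 v\<^sub>0 e\<^sub>0 e\<^sub>1 e\<^sub>2 y\<^sub>1 y\<^sub>2 x\<^sub>1 x\<^sub>2 :: 'a
    and JE JU J Ji :: "'a \<Rightarrow> 'a"
    and x z u \<I> :: "real \<Rightarrow> 'a"
  assumes N: "lie_group G A" "connected (UNIV :: 'g set)"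
    and metric: "pseudo_riemannian_metric A g" "left_invariant_metric G A g"
    and chart: "c \<in> A" "\<one>\<^bsub>G\<^esub> \<in> dom_of c"
    and br: "br = lie_bracket G c"
    and ip: "ip = g c (coord c \<one>\<^bsub>G\<^esub>)"
    and nilpotent: "two_step_nilpotent br"
    and U: "U = lie_center br \<inter> perp ip (lie_center br)"
    and V: "subspace V" "totally_null ip V" "dim V = dim U" "dually_paired ip U V"
    and Z: "Z = lie_center br \<inter> perp ip U \<inter> perp ip V"
    and E: "E = perp ip Z \<inter> (perp ip U \<inter> perp ip V)"
    and geodesic: "open T" "is_interval T" "0 \<in> T" "geodesic_on A g T \<gamma>"
    and initial: "\<gamma> 0 = \<one>\<^bsub>G\<^esub>" "velocity c \<gamma> 0 = u\<^sub>0 + z\<^sub>0 + v\<^sub>0 + e\<^sub>0"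
    and in_parts: "u\<^sub>0 \<in> U" "z\<^sub>0 \<in> Z" "v\<^sub>0 \<in> V" "e\<^sub>0 \<in> E"
    and JE: "JE = restrict (\<lambda>y. component E (span (U \<union> Z \<union> V)) (ad_adjoint ip br y (z\<^sub>0 + v\<^sub>0))) (span (V \<union> E))"
    and JU: "JU = restrict (\<lambda>y. component U (span (Z \<union> V \<union> E)) (ad_adjoint ip br y (z\<^sub>0 + v\<^sub>0))) (span (V \<union> E))"
    and J: "J = restrict JE E"
    and E\<^sub>1: "E\<^sub>1 = {y \<in> E. J y = 0}"
    and E\<^sub>2: "subspace E\<^sub>2" "E = span (E\<^sub>1 \<union> E\<^sub>2)" "E\<^sub>1 \<inter> E\<^sub>2 = {0}" "\<forall>a\<in>E\<^sub>1. \<forall>b\<in>E\<^sub>2. ip a b = 0"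
    and Ji: "Ji = inv_into E\<^sub>2 J"
    and y\<^sub>1\<^sub>2: "JE v\<^sub>0 = y\<^sub>1 + y\<^sub>2" "y\<^sub>1 \<in> E\<^sub>1" "y\<^sub>2 \<in> E\<^sub>2"
    and e\<^sub>1\<^sub>2: "e\<^sub>0 = e\<^sub>1 + e\<^sub>2" "e\<^sub>1 \<in> E\<^sub>1" "e\<^sub>2 \<in> E\<^sub>2"
    and x\<^sub>1: "x\<^sub>1 = e\<^sub>1 + v\<^sub>0 - Ji y\<^sub>2"
    and x\<^sub>2: "x\<^sub>2 = e\<^sub>2 + Ji y\<^sub>2"
    and x: "x = (\<lambda>t. t *\<^sub>R x\<^sub>1 + (exp_op t J (Ji x\<^sub>2) - Ji x\<^sub>2) + (t\<^sup>2 / 2) *\<^sub>R y\<^sub>1)"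
    and \<I>: "\<I> = (\<lambda>t. - (1/2) *\<^sub>R (LBINT s=0..t. br (vector_derivative x (at s)) (x s)))"
    and z: "z = (\<lambda>t. t *\<^sub>R z\<^sub>0 + component Z (span (U \<union> V \<union> E)) (\<I> t))"
    and u: "u = (\<lambda>t. t *\<^sub>R u\<^sub>0 + component U (span (Z \<union> V \<union> E)) (\<I> t)
                 + (LBINT s=0..t. (LBINT r=0..s. JU (vector_derivative x (at r)))))"
  shows "bij_betw J E\<^sub>2 E\<^sub>2 \<and>
      (\<forall>t. u t \<in> U \<and> z t \<in> Z \<and> x t \<in> span (V \<union> E)) \<and>
      (\<forall>t\<in>T. \<gamma> t = lie_exp G c (u t + z t + x t)) \<and>
      (\<forall>t. \<I> t =
          (t / 2) *\<^sub>R br (x\<^sub>1 + (t / 2) *\<^sub>R y\<^sub>1) (exp_op t J (Ji x\<^sub>2) + Ji x\<^sub>2)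
        - t *\<^sub>R br y\<^sub>1 (exp_op t J (Ji (Ji x\<^sub>2)))
        + (t ^ 3 / 12) *\<^sub>R br x\<^sub>1 y\<^sub>1
        + (1/2) *\<^sub>R br (exp_op t J (Ji x\<^sub>2) - Ji x\<^sub>2) (Ji x\<^sub>2)
        - br x\<^sub>1 (exp_op t J (Ji (Ji x\<^sub>2)) - Ji (Ji x\<^sub>2))
        + br y\<^sub>1 (exp_op t J (Ji (Ji (Ji x\<^sub>2))) - Ji (Ji (Ji x\<^sub>2)))
        + (1/2) *\<^sub>R (LBINT s=0..t. br (exp_op s J (Ji x\<^sub>2)) (exp_op s J x\<^sub>2)))"
proof -
  interpret L: lie_group_chart G A c
    by (intro lie_group_chart.intro lie_group_chart_axioms.intro N chart)
  interpret geo: left_invariant_geodesic G A c g T \<gamma>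
    by (intro left_invariant_geodesic.intro left_invariant_geodesic_axioms.intro L.lie_group_chart_axioms
        metric geodesic)
  have bb: "bounded_bilinear br" unfolding br by (rule L.bounded_bilinear_lie_bracket)
  interpret D: two_step_geodesic_data ip br U Z V E E\<^sub>1 E\<^sub>2 u\<^sub>0 z\<^sub>0 v\<^sub>0 e\<^sub>0 e\<^sub>1 e\<^sub>2 y\<^sub>1 y\<^sub>2 x\<^sub>1 x\<^sub>2 JE JU J Ji x z u \<I>
  proof (intro two_step_geodesic_data.intro center_decomposition.intro center_decomposition_axioms.intro
      two_step_geodesic_data_axioms.intro)
    show "scalar_product ip" unfolding ip by (rule geo.scalar_product_ip)
    show "subspace (lie_center br)" by (rule subspace_lie_center[OF bb])
    show "br a a = 0" for a unfolding br by (rule L.lie_bracket_self)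
  qed (fact U V Z E bb nilpotent in_parts JE JU J E\<^sub>1 E\<^sub>2 Ji y\<^sub>1\<^sub>2 e\<^sub>1\<^sub>2 x\<^sub>1 x\<^sub>2 x \<I> z u)+
  obtain w where w: "\<And>t. t \<in> T \<Longrightarrow> L.log_deriv \<gamma> t (w t)"
    "\<And>t. t \<in> T \<Longrightarrow> (w has_vector_derivative ad_adjoint ip br (w t) (w t)) (at t)"
    using geo.geodesic_euler_arnold unfolding ip br by metis
  \<comment> \<open>At the identity the left-invariant field of a vector takes that vector as its
    value in the chart \<open>c\<close>, so the given initial velocity is the initial value of
    \<open>w\<close>.\<close>
  have "((coord c \<circ> \<gamma>) has_vector_derivative w 0) (at 0)"
    using L.log_deriv_iff_chart[of c \<gamma> 0 "w 0"] w(1)[OF geodesic(3)] chart initial(1) L.lfield_one by simp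
  then have w0: "w 0 = u\<^sub>0 + z\<^sub>0 + v\<^sub>0 + e\<^sub>0"
    using initial(2) unfolding velocity_def by (metis vector_derivative_at)
  have "\<gamma> t = lie_exp G c (u t + z t + x t)" if t: "t \<in> T" for t
  proof (rule L.log_deriv_eq_imp_eq[OF geodesic(1) _ geodesic(3) t, where w=w and \<xi>="\<lambda>t. lie_exp G c (u t + z t + x t)"])
    show "connected T" using geodesic(2) by (rule is_interval_connected)
    show "\<gamma> 0 = lie_exp G c (u 0 + z 0 + x 0)" using initial(1) L.lie_exp_zero D.uzx_0 by simp
    show "L.log_deriv \<gamma> t (w t)" if "t \<in> T" for t using that by (rule w(1))
    show "L.log_deriv (\<lambda>t. lie_exp G c (u t + z t + x t)) t (w t)" if t: "t \<in> T" for t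
    proof -
      obtain n' where n': "((\<lambda>t. u t + z t + x t) has_vector_derivative n') (at t)"
        "n' - (1/2) *\<^sub>R br (u t + z t + x t) n' = u\<^sub>0 + D.P t + z\<^sub>0 + D.dx t"
        by (rule D.log_deriv_formula)
      have "w t = u\<^sub>0 + D.P t + z\<^sub>0 + D.dx t"
        by (rule D.velocity_formula[OF geodesic(1-3) w(2) w0 t])
      then show ?thesis
        using L.log_deriv_lie_exp[OF nilpotent[unfolded br] n'(1)] n'(2) unfolding br by simp
    qed
  qed
  then show ?thesis using D.bij_J D.u_mem D.z_mem D.x_span D.\<I>_formula by blast
qed

end
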